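(* Let $n\ge0$. The Magnus representation $r:\mathrm{Aut}\,F_n^{\mathrm{acy}}\to M(n,\Lambda_{F_n^{\mathrm{acy}}})$ is a crossed homomorphism, i.e. $r(\varphi\psi)=r(\varphi)\cdot{}^{\varphi}r(\psi)$ for all $\varphi,\psi\in\mathrm{Aut}\,F_n^{\mathrm{acy}}$. In particular, the image of $r$ is contained in the set of invertible matrices.
   Context: **Acyclic closure.** For a group $G$ and a free group $F_m=\langle x_1,\dots,x_m\rangle$, an element $w\in G*F_m$ is acyclic if it lies in the kernel of $G*F_m\to F_m\to H_1(F_m)$. An acyclic system over $G$ is a system of equations $x_i=w_i(x_1,\dots,x_m)$, $i=1,\dots,m$, with every $w_i\in G*F_m$ acyclic. $G$ is acyclically closed (AC) if every acyclic system over $G$, for every $m\ge0$, has a unique solution in $G$. The acyclic closure of $G$ is the pair $(G^{\mathrm{acy}},\iota_G:G\to G^{\mathrm{acy}})$, unique up to isomorphism, such that $G^{\mathrm{acy}}$ is AC and every homomorphism $f:G\to A$ to an AC-group factors uniquely through $\iota_G$. The map $\iota_{F_n}:F_n=\langle x_1,\dots,x_n\rangle\to F_n^{\mathrm{acy}}$ is injective, and $x_i$ also denotes its image in $F_n^{\mathrm{acy}}$. **Cohn localization.** For a group $G$ with augmentation $\varepsilon:\mathbb{Z}G\to\mathbb{Z}$, $l_G:\mathbb{Z}G\to\Lambda_G$ is the ring homomorphism that is universal (initial) among ring homomorphisms from $\mathbb{Z}G$ with the property that every matrix $m$ over $\mathbb{Z}G$ with $\varepsilon(m)$ invertible becomes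 invertible. Each automorphism of $G$ induces a ring automorphism of $\Lambda_G$, and the involution of $\mathbb{Z}G$ induced by $x\mapsto x^{-1}$ ($x\in G$) extends to an involution of $\Lambda_G$, denoted by an overline. For a matrix $A$ over $\Lambda_G$ and a ring homomorphism $\varphi$, ${}^{\varphi}A$ and $\overline A$ denote the matrices obtained by applying $\varphi$, resp. the involution, to each entry. **Magnus representation.** Let $I(F_n^{\mathrm{acy}})=\mathrm{Ker}(\varepsilon:\mathbb{Z}F_n^{\mathrm{acy}}\to\mathbb{Z})$. It is known (following Le Dimet) that $v:\Lambda_{F_n^{\mathrm{acy}}}^n\to I(F_n^{\mathrm{acy}})\otimes_{\mathbb{Z}F_n^{\mathrm{acy}}}\Lambda_{F_n^{\mathrm{acy}}}$, $(a_1,\dots,a_n)\mapsto\sum_{i=1}^n(x_i^{-1}-1)\otimes a_i$, is an isomorphism of right $\Lambda_{F_n^{\mathrm{acy}}}$-modules. Define maps $\partial/\partial x_i:F_n^{\mathrm{acy}}\to\Lambda_{F_n^{\mathrm{acy}}}$ by $$\left(\frac{\partial g}{\partial x_1},\dots,\frac{\partial g}{\partial x_n}\right)=\overline{v^{-1}((g^{-1}-1)\otimes1)},$$ so that $(g^{-1}-1)\otimes1=\sum_{i=1}^n(x_i^{-1}-1)\otimes\overline{(\partial g/\partial x_i)}$. The Magnus representation is $r(\varphi):=\left(\overline{\left(\frac{\partial\varphi(x_j)}{\partial x_i}\right)}\right)_{i,j}$ for $\varphi\in\mathrm{Aut}\,F_n^{\mathrm{acy}}$. *)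

theory Defs
  imports
    "HOL-Algebra.Algebra"
    "HOL-Algebra.Free_Abelian_Groups"
    "Jordan_Normal_Form.Matrix"
begin

section \<open>Free groups and free products\<close>

text \<open>
  Both are given by monoid presentations: words over a set of letters \<open>L\<close> modulo the congruence
  generated by a set of pairs of words. Elements are congruence classes of words.
\<close>

inductive_set presentation_cong :: "'l set \<Rightarrow> ('l list \<times> 'l list) set \<Rightarrow> ('l list \<times> 'l list) set"
  for L :: "'l set" and rels :: "('l list \<times> 'l list) set"
where
  base: "\<lbrakk>(u, v) \<in> rels; u \<in> lists L; v \<in> lists L; a \<in> lists L; b \<in> lists L\<rbrakk>
         \<Longrightarrow> (a @ u @ b, a @ v @ b) \<in> presentation_cong L rels"
| refl: "w \<in> lists L \<Longrightarrow> (w, w) \<in> presentation_cong L rels"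
| sym: "(u, v) \<in> presentation_cong L rels \<Longrightarrow> (v, u) \<in> presentation_cong L rels"
| trans: "\<lbrakk>(u, v) \<in> presentation_cong L rels; (v, w) \<in> presentation_cong L rels\<rbrakk>
         \<Longrightarrow> (u, w) \<in> presentation_cong L rels"

definition presented_monoid :: "'l set \<Rightarrow> ('l list \<times> 'l list) set \<Rightarrow> 'l list set monoid"
  where "presented_monoid L rels =
    \<lparr>carrier = lists L // presentation_cong L rels,
     monoid.mult = (\<lambda>A B. \<Union>u\<in>A. \<Union>v\<in>B. presentation_cong L rels `` {u @ v}),
     one = presentation_cong L rels `` {[]}\<rparr>"

text \<open>
  The free group \<open>F\<^sub>m\<close> on \<open>x\<^sub>0, \<dots>, x\<^sub>m\<^sub>-\<^sub>1\<close>: the letter \<open>(i, True)\<close> stands for \<open>x\<^sub>i\<close> and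
  \<open>(i, False)\<close> for its inverse.
\<close>

type_synonym free_elem = "(nat \<times> bool) list set"

definition free_letters :: "nat \<Rightarrow> (nat \<times> bool) set"
  where "free_letters m = {..<m} \<times> UNIV"

definition free_rels :: "nat \<Rightarrow> ((nat \<times> bool) list \<times> (nat \<times> bool) list) set"
  where "free_rels m = {([(i, b), (i, \<not> b)], []) | i b. i < m}"

definition free_group :: "nat \<Rightarrow> free_elem monoid"
  where "free_group m = presented_monoid (free_letters m) (free_rels m)"

definition free_gen :: "nat \<Rightarrow> nat \<Rightarrow> free_elem"
  where "free_gen m i = presentation_cong (free_letters m) (free_rels m) `` {[(i, True)]}"

definition free_group_lift :: "nat \<Rightarrow> ('k, 'b) monoid_scheme \<Rightarrow> (nat \<Rightarrow> 'k) \<Rightarrow> free_elem \<Rightarrow> 'k"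
  where "free_group_lift m K y =
    (THE h. h \<in> hom (free_group m) K \<inter> extensional (carrier (free_group m)) \<and>
            (\<forall>i<m. h (free_gen m i) = y i))"

definition free_product_letters ::
    "('g, 'c) monoid_scheme \<Rightarrow> ('h, 'd) monoid_scheme \<Rightarrow> ('g + 'h) set"
  where "free_product_letters G H = carrier G <+> carrier H"

definition free_product_rels ::
    "('g, 'c) monoid_scheme \<Rightarrow> ('h, 'd) monoid_scheme \<Rightarrow> (('g + 'h) list \<times> ('g + 'h) list) set"
  where "free_product_rels G H =
    {([Inl a, Inl b], [Inl (a \<otimes>\<^bsub>G\<^esub> b)]) | a b. a \<in> carrier G \<and> b \<in> carrier G} \<union>
    {([Inr a, Inr b], [Inr (a \<otimes>\<^bsub>H\<^esub> b)]) | a b. a \<in> carrier H \<and> b \<in> carrier H} \<union>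
    {([Inl \<one>\<^bsub>G\<^esub>], []), ([Inr \<one>\<^bsub>H\<^esub>], [])}"

definition free_product ::
    "('g, 'c) monoid_scheme \<Rightarrow> ('h, 'd) monoid_scheme \<Rightarrow> ('g + 'h) list set monoid"
  where "free_product G H = presented_monoid (free_product_letters G H) (free_product_rels G H)"

definition free_product_inl ::
    "('g, 'c) monoid_scheme \<Rightarrow> ('h, 'd) monoid_scheme \<Rightarrow> 'g \<Rightarrow> ('g + 'h) list set"
  where "free_product_inl G H a =
    presentation_cong (free_product_letters G H) (free_product_rels G H) `` {[Inl a]}"

definition free_product_inr ::
    "('g, 'c) monoid_scheme \<Rightarrow> ('h, 'd) monoid_scheme \<Rightarrow> 'h \<Rightarrow> ('g + 'h) list set"
  where "free_product_inr G H a =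
    presentation_cong (free_product_letters G H) (free_product_rels G H) `` {[Inr a]}"

definition free_product_lift ::
    "('g, 'c) monoid_scheme \<Rightarrow> ('h, 'd) monoid_scheme \<Rightarrow> ('k, 'e) monoid_scheme \<Rightarrow>
     ('g \<Rightarrow> 'k) \<Rightarrow> ('h \<Rightarrow> 'k) \<Rightarrow> ('g + 'h) list set \<Rightarrow> 'k"
  where "free_product_lift G H K f g =
    (THE h. h \<in> hom (free_product G H) K \<inter> extensional (carrier (free_product G H)) \<and>
            (\<forall>a\<in>carrier G. h (free_product_inl G H a) = f a) \<and>
            (\<forall>a\<in>carrier H. h (free_product_inr G H a) = g a))"


section \<open>Acyclic systems and the acyclic closure\<close>

type_synonym 'g equation_word = "('g + free_elem) list set"

definition first_homology :: "('g, 'c) monoid_scheme \<Rightarrow> 'g set monoid"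
  where "first_homology G = G Mod (derived G (carrier G))"

definition acyclic_elements :: "('g, 'c) monoid_scheme \<Rightarrow> nat \<Rightarrow> 'g equation_word set"
  where "acyclic_elements G m =
    kernel (free_product G (free_group m)) (first_homology (free_group m))
      (\<lambda>w. derived (free_group m) (carrier (free_group m)) #>\<^bsub>free_group m\<^esub>
           free_product_lift G (free_group m) (free_group m) (\<lambda>_. \<one>\<^bsub>free_group m\<^esub>) (\<lambda>z. z) w)"

text \<open>The value \<open>w(y\<^sub>0, \<dots>, y\<^sub>m\<^sub>-\<^sub>1)\<close> in \<open>G\<close> of \<open>w \<in> G * F\<^sub>m\<close>.\<close>

definition substitute :: "('g, 'c) monoid_scheme \<Rightarrow> nat \<Rightarrow> (nat \<Rightarrow> 'g) \<Rightarrow> 'g equation_word \<Rightarrow> 'g"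
  where "substitute G m y =
    free_product_lift G (free_group m) G (\<lambda>g. g) (free_group_lift m G y)"

definition acyclically_closed :: "('g, 'c) monoid_scheme \<Rightarrow> bool"
  where "acyclically_closed G \<longleftrightarrow> group G \<and>
    (\<forall>m. \<forall>w \<in> {..<m} \<rightarrow> acyclic_elements G m.
       \<exists>!y. y \<in> {..<m} \<rightarrow>\<^sub>E carrier G \<and> (\<forall>i<m. y i = substitute G m y (w i)))"

text \<open>
  The universal properties of the acyclic closure and of the Cohn localization are tested against
  groups and rings whose elements belong to the same type \<open>'u\<close> as those of the universal object,
  since HOL cannot quantify over types within a formula. For the acyclic closure \<open>G\<close> of a free
  group of finite rank and for the Cohn localization of its group ring this is no restriction as
  soon as \<open>'u\<close> is infinite: the objects that are universal without restriction are countable,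
  so they have copies in \<open>'u\<close>, and any object that is universal within \<open>'u\<close> is
  isomorphic to such a copy.
\<close>

definition acyclic_closure ::
    "('g, 'c) monoid_scheme \<Rightarrow> 'u monoid \<Rightarrow> ('g \<Rightarrow> 'u) \<Rightarrow> bool"
  where "acyclic_closure G Gacy \<iota> \<longleftrightarrow>
    acyclically_closed Gacy \<and> \<iota> \<in> hom G Gacy \<and>
    (\<forall>A :: 'u monoid. acyclically_closed A \<longrightarrow>
       (\<forall>f \<in> hom G A. \<exists>!h. h \<in> hom Gacy A \<inter> extensional (carrier Gacy) \<and>
                          (\<forall>x\<in>carrier G. h (\<iota> x) = f x)))"


section \<open>Matrices over rings with explicit carrier\<close>

text \<open>
  The type \<open>'a mat\<close> is used only as a container; the ring operations come from \<open>R\<close>, which need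
  not be commutative.
\<close>

definition matrix_ring :: "('a, 'b) ring_scheme \<Rightarrow> nat \<Rightarrow> 'a mat ring"
  where "matrix_ring R n =
    \<lparr>carrier = {A \<in> carrier_mat n n. \<forall>i<n. \<forall>j<n. A $$ (i, j) \<in> carrier R},
     monoid.mult = (\<lambda>A B. mat n n (\<lambda>(i, j). \<Oplus>\<^bsub>R\<^esub>k\<in>{..<n}. A $$ (i, k) \<otimes>\<^bsub>R\<^esub> B $$ (k, j))),
     one = mat n n (\<lambda>(i, j). if i = j then \<one>\<^bsub>R\<^esub> else \<zero>\<^bsub>R\<^esub>),
     ring.zero = mat n n (\<lambda>_. \<zero>\<^bsub>R\<^esub>),
     ring.add = (\<lambda>A B. mat n n (\<lambda>(i, j). A $$ (i, j) \<oplus>\<^bsub>R\<^esub> B $$ (i, j)))\<rparr>"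


section \<open>Integral group rings and Cohn localization\<close>

text \<open>
  Elements are finitely supported functions \<open>'g \<Rightarrow>\<^sub>0 int\<close> with support in the carrier of \<open>G\<close>;
  \<open>frag_of g\<close> is the basis element \<open>g\<close>.
\<close>

definition group_ring :: "('g, 'c) monoid_scheme \<Rightarrow> ('g \<Rightarrow>\<^sub>0 int) ring"
  where "group_ring G =
    \<lparr>carrier = {c. Poly_Mapping.keys c \<subseteq> carrier G},
     monoid.mult = (\<lambda>a b. frag_extend (\<lambda>g. frag_extend (\<lambda>h. frag_of (g \<otimes>\<^bsub>G\<^esub> h)) b) a),
     one = frag_of \<one>\<^bsub>G\<^esub>,
     ring.zero = 0,
     ring.add = (+)\<rparr>"

definition augmentation :: "('g \<Rightarrow>\<^sub>0 int) \<Rightarrow> int"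
  where "augmentation c = (\<Sum>g\<in>Poly_Mapping.keys c. Poly_Mapping.lookup c g)"

definition augmentation_ideal :: "('g, 'c) monoid_scheme \<Rightarrow> ('g \<Rightarrow>\<^sub>0 int) set"
  where "augmentation_ideal G = {c \<in> carrier (group_ring G). augmentation c = 0}"

definition group_ring_map :: "('g \<Rightarrow> 'h) \<Rightarrow> ('g \<Rightarrow>\<^sub>0 int) \<Rightarrow> ('h \<Rightarrow>\<^sub>0 int)"
  where "group_ring_map \<phi> = frag_extend (\<lambda>g. frag_of (\<phi> g))"

definition group_ring_involution :: "('g, 'c) monoid_scheme \<Rightarrow> ('g \<Rightarrow>\<^sub>0 int) \<Rightarrow> ('g \<Rightarrow>\<^sub>0 int)"
  where "group_ring_involution G = frag_extend (\<lambda>g. frag_of (inv\<^bsub>G\<^esub> g))"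

text \<open>
  It suffices to consider square matrices, because a matrix over \<open>\<int>\<close> with a two-sided inverse
  is square.
\<close>

definition inverting ::
    "('g, 'c) monoid_scheme \<Rightarrow> ('r, 'd) ring_scheme \<Rightarrow> (('g \<Rightarrow>\<^sub>0 int) \<Rightarrow> 'r) \<Rightarrow> bool"
  where "inverting G R f \<longleftrightarrow> f \<in> Ring.ring_hom (group_ring G) R \<and>
    (\<forall>k. \<forall>M \<in> carrier (matrix_ring (group_ring G) k).
       map_mat augmentation M \<in> Units (matrix_ring \<Z> k) \<longrightarrow>
       map_mat f M \<in> Units (matrix_ring R k))"

definition Cohn_localization ::
    "('g, 'c) monoid_scheme \<Rightarrow> 'u ring \<Rightarrow> (('g \<Rightarrow>\<^sub>0 int) \<Rightarrow> 'u) \<Rightarrow> bool"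
  where "Cohn_localization G \<Lambda> l \<longleftrightarrow>
    ring \<Lambda> \<and> inverting G \<Lambda> l \<and>
    (\<forall>R :: 'u ring. ring R \<longrightarrow>
       (\<forall>f. inverting G R f \<longrightarrow>
         (\<exists>!h. h \<in> Ring.ring_hom \<Lambda> R \<inter> extensional (carrier \<Lambda>) \<and>
               (\<forall>c\<in>carrier (group_ring G). h (l c) = f c))))"

text \<open>The endomorphism of \<open>\<Lambda>\<close> induced by an endomorphism \<open>\<phi>\<close> of \<open>G\<close>.\<close>

definition localization_map ::
    "('g, 'c) monoid_scheme \<Rightarrow> 'u ring \<Rightarrow> (('g \<Rightarrow>\<^sub>0 int) \<Rightarrow> 'u) \<Rightarrow> ('g \<Rightarrow> 'g) \<Rightarrow> 'u \<Rightarrow> 'u"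
  where "localization_map G \<Lambda> l \<phi> =
    (THE h. h \<in> Ring.ring_hom \<Lambda> \<Lambda> \<inter> extensional (carrier \<Lambda>) \<and>
            (\<forall>c\<in>carrier (group_ring G). h (l c) = l (group_ring_map \<phi> c)))"

definition opposite_ring :: "'u ring \<Rightarrow> 'u ring"
  where "opposite_ring R = R\<lparr>monoid.mult := (\<lambda>a b. b \<otimes>\<^bsub>R\<^esub> a)\<rparr>"

text \<open>An involution of a ring reverses products, i.e. is a homomorphism to the opposite ring.\<close>

definition localization_involution ::
    "('g, 'c) monoid_scheme \<Rightarrow> 'u ring \<Rightarrow> (('g \<Rightarrow>\<^sub>0 int) \<Rightarrow> 'u) \<Rightarrow> 'u \<Rightarrow> 'u"
  where "localization_involution G \<Lambda> l =
    (THE h. h \<in> Ring.ring_hom \<Lambda> (opposite_ring \<Lambda>) \<inter> extensional (carrier \<Lambda>) \<and>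
            (\<forall>a\<in>carrier \<Lambda>. h (h a) = a) \<and>
            (\<forall>c\<in>carrier (group_ring G). h (l c) = l (group_ring_involution G c)))"


section \<open>The Magnus representation\<close>

text \<open>
  The tensor product \<open>I(G) \<otimes>\<^bsub>\<int>G\<^esub> \<Lambda>\<close>: the free abelian group on \<open>I(G) \<times> \<Lambda>\<close> modulo biadditivity
  and \<open>xz \<otimes> a = x \<otimes> l(z)a\<close>. As for all groups in HOL-Algebra, its group operation is
  written multiplicatively, so that sums in it become products.
\<close>

definition tensor_rels ::
    "('g, 'c) monoid_scheme \<Rightarrow> 'u ring \<Rightarrow> (('g \<Rightarrow>\<^sub>0 int) \<Rightarrow> 'u) \<Rightarrow>
     ((('g \<Rightarrow>\<^sub>0 int) \<times> 'u) \<Rightarrow>\<^sub>0 int) set"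
  where "tensor_rels G \<Lambda> l =
    {frag_of (x + y, a) - frag_of (x, a) - frag_of (y, a) | x y a.
       x \<in> augmentation_ideal G \<and> y \<in> augmentation_ideal G \<and> a \<in> carrier \<Lambda>} \<union>
    {frag_of (x, a \<oplus>\<^bsub>\<Lambda>\<^esub> b) - frag_of (x, a) - frag_of (x, b) | x a b.
       x \<in> augmentation_ideal G \<and> a \<in> carrier \<Lambda> \<and> b \<in> carrier \<Lambda>} \<union>
    {frag_of (x \<otimes>\<^bsub>group_ring G\<^esub> z, a) - frag_of (x, l z \<otimes>\<^bsub>\<Lambda>\<^esub> a) | x z a.
       x \<in> augmentation_ideal G \<and> z \<in> carrier (group_ring G) \<and> a \<in> carrier \<Lambda>}"

definition tensor_free ::
    "('g, 'c) monoid_scheme \<Rightarrow> 'u ring \<Rightarrow> ((('g \<Rightarrow>\<^sub>0 int) \<times> 'u) \<Rightarrow>\<^sub>0 int) monoid"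
  where "tensor_free G \<Lambda> = free_Abelian_group (augmentation_ideal G \<times> carrier \<Lambda>)"

definition tensor_subgroup ::
    "('g, 'c) monoid_scheme \<Rightarrow> 'u ring \<Rightarrow> (('g \<Rightarrow>\<^sub>0 int) \<Rightarrow> 'u) \<Rightarrow>
     ((('g \<Rightarrow>\<^sub>0 int) \<times> 'u) \<Rightarrow>\<^sub>0 int) set"
  where "tensor_subgroup G \<Lambda> l = generate (tensor_free G \<Lambda>) (tensor_rels G \<Lambda> l)"

definition tensor_group ::
    "('g, 'c) monoid_scheme \<Rightarrow> 'u ring \<Rightarrow> (('g \<Rightarrow>\<^sub>0 int) \<Rightarrow> 'u) \<Rightarrow>
     ((('g \<Rightarrow>\<^sub>0 int) \<times> 'u) \<Rightarrow>\<^sub>0 int) set monoid"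
  where "tensor_group G \<Lambda> l = tensor_free G \<Lambda> Mod tensor_subgroup G \<Lambda> l"

definition tensor ::
    "('g, 'c) monoid_scheme \<Rightarrow> 'u ring \<Rightarrow> (('g \<Rightarrow>\<^sub>0 int) \<Rightarrow> 'u) \<Rightarrow>
     ('g \<Rightarrow>\<^sub>0 int) \<Rightarrow> 'u \<Rightarrow> ((('g \<Rightarrow>\<^sub>0 int) \<times> 'u) \<Rightarrow>\<^sub>0 int) set"
  where "tensor G \<Lambda> l x a = tensor_subgroup G \<Lambda> l #>\<^bsub>tensor_free G \<Lambda>\<^esub> frag_of (x, a)"

definition inv_minus_one :: "('g, 'c) monoid_scheme \<Rightarrow> 'g \<Rightarrow> ('g \<Rightarrow>\<^sub>0 int)"
  where "inv_minus_one G g = frag_of (inv\<^bsub>G\<^esub> g) - frag_of \<one>\<^bsub>G\<^esub>"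

text \<open>
  In the remaining definitions \<open>n\<close>, \<open>G\<close> and \<open>x\<close> are the rank \<open>n\<close>, the group \<open>G = F\<^sub>n\<^sup>a\<^sup>c\<^sup>y\<close> and
  the images \<open>x 0, \<dots>, x (n - 1)\<close> in \<open>G\<close> of the free generators. For these, \<open>magnus_v\<close> is
  bijective from \<open>\<Lambda>\<^sup>n\<close> onto the tensor product, so that \<open>inv_into\<close> is its inverse.
\<close>

definition magnus_v ::
    "nat \<Rightarrow> ('g, 'c) monoid_scheme \<Rightarrow> (nat \<Rightarrow> 'g) \<Rightarrow> 'u ring \<Rightarrow> (('g \<Rightarrow>\<^sub>0 int) \<Rightarrow> 'u) \<Rightarrow>
     (nat \<Rightarrow> 'u) \<Rightarrow> ((('g \<Rightarrow>\<^sub>0 int) \<times> 'u) \<Rightarrow>\<^sub>0 int) set"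
  where "magnus_v n G x \<Lambda> l a =
    (\<Otimes>\<^bsub>tensor_group G \<Lambda> l\<^esub>i\<in>{..<n}. tensor G \<Lambda> l (inv_minus_one G (x i)) (a i))"

definition fox_derivative ::
    "nat \<Rightarrow> ('g, 'c) monoid_scheme \<Rightarrow> (nat \<Rightarrow> 'g) \<Rightarrow> 'u ring \<Rightarrow> (('g \<Rightarrow>\<^sub>0 int) \<Rightarrow> 'u) \<Rightarrow>
     'g \<Rightarrow> nat \<Rightarrow> 'u"
  where "fox_derivative n G x \<Lambda> l g i =
    localization_involution G \<Lambda> l
      (inv_into ({..<n} \<rightarrow>\<^sub>E carrier \<Lambda>) (magnus_v n G x \<Lambda> l)
         (tensor G \<Lambda> l (inv_minus_one G g) \<one>\<^bsub>\<Lambda>\<^esub>) i)"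

definition magnus_rep ::
    "nat \<Rightarrow> ('g, 'c) monoid_scheme \<Rightarrow> (nat \<Rightarrow> 'g) \<Rightarrow> 'u ring \<Rightarrow> (('g \<Rightarrow>\<^sub>0 int) \<Rightarrow> 'u) \<Rightarrow>
     ('g \<Rightarrow> 'g) \<Rightarrow> 'u mat"
  where "magnus_rep n G x \<Lambda> l \<phi> =
    map_mat (localization_involution G \<Lambda> l)
      (mat n n (\<lambda>(i, j). fox_derivative n G x \<Lambda> l (\<phi> (x j)) i))"

end

theory Submission
  imports Defs
begin

text \<open>
  Let \<open>G = F\<^sub>n\<^sup>a\<^sup>c\<^sup>y\<close>. If a group ring homomorphism \<open>\<int>G \<rightarrow> R\<close> inverts the matrices that
  augment to invertible ones, then for every right \<open>R\<close>-module \<open>A\<close> the semidirect product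
  \<open>A \<rtimes> G\<close> is again acyclically closed: over a solution in \<open>G\<close> an acyclic system becomes a linear
  system for the components in \<open>A\<close>, and its matrix \<open>1 - D\<close> augments to the identity. The universal
  property of \<open>G\<close>, applied to \<open>A \<rtimes> G\<close>, says that a (twisted) derivation \<open>G \<rightarrow> A\<close> exists and is
  unique for prescribed values on \<open>x\<^sub>0, \<dots>, x\<^sub>n\<^sub>-\<^sub>1\<close>.

  For \<open>A = \<Lambda>\<close> this gives the Fox derivatives, hence a left inverse of \<open>v\<close>; for
  \<open>A = I(G) \<otimes> \<Lambda>\<close> the derivations \<open>g \<mapsto> (g\<^sup>-\<^sup>1 - 1) \<otimes> 1\<close> and \<open>g \<mapsto> v(\<partial>g)\<close> agree on the
  generators, hence everywhere. The crossed homomorphism property is the chain rule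
  \<open>\<partial>\<^sub>i \<phi>(g) = \<Sum>\<^sub>k \<partial>\<^sub>i \<phi>(x\<^sub>k) \<cdot> \<phi>(\<partial>\<^sub>k g)\<close>: both sides are derivations twisted by \<open>\<phi>\<close> that agree on
  the generators. All groups involved embed into the type of \<open>G\<close> because it is infinite.
\<close>

section \<open>Words and presented monoids\<close>

text \<open>The universal property of \<open>G\<close> speaks about groups, derivations about
  modules. The bridge is that \<open>g\<close> maps to \<open>(D g, \<phi> g)\<close>
  homomorphically into A \<rtimes> G exactly when \<open>D\<close> is a derivation twisted by
  \<open>\<phi>\<close>, so two derivations with the same twist are compared as two homomorphisms.
  The linear system over a solution in \<open>G\<close> has coefficients that are, up to the
  involution, Fox derivatives of the words. Their augmentations are exponent sums of the variables;
  these vanish on acyclic words because the integers are abelian and exponent sums therefore kill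
  the derived subgroup. This is why 1 - D augments to the identity. The universal property is tested
  only on groups with elements in \<open>'u\<close>, whereas A \<rtimes> G consists of pairs, for
  the tensor product even pairs with a coset of formal sums. Each such group is first copied into
  \<open>'u\<close>, and being acyclically closed is carried along the isomorphism. The bar in the
  Fox derivative and the bar in \<open>magnus_rep\<close> cancel, so the matrices consist of the
  coordinates under the inverse of v themselves, and the proof works with these.\<close>

definition word_eval :: "('k, 'b) monoid_scheme \<Rightarrow> ('l \<Rightarrow> 'k) \<Rightarrow> 'l list \<Rightarrow> 'k"
  where "word_eval K f w = foldr (\<lambda>x a. f x \<otimes>\<^bsub>K\<^esub> a) w \<one>\<^bsub>K\<^esub>"

lemma word_eval_simps [simp]:
  "word_eval K f [] = \<one>\<^bsub>K\<^esub>"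
  "word_eval K f (x # w) = f x \<otimes>\<^bsub>K\<^esub> word_eval K f w"
  by (simp_all add: word_eval_def)

lemma word_eval_cong: "(\<And>x. x \<in> set w \<Longrightarrow> f x = g x) \<Longrightarrow> word_eval K f w = word_eval K g w"
  by (induction w) auto

lemma word_eval_map: "word_eval K f (map g w) = word_eval K (\<lambda>x. f (g x)) w"
  by (induction w) auto

context monoid
begin

lemma word_eval_closed:
  "f \<in> L \<rightarrow> carrier G \<Longrightarrow> w \<in> lists L \<Longrightarrow> word_eval G f w \<in> carrier G"
  by (induction w) auto

lemma word_eval_append:
  "f \<in> L \<rightarrow> carrier G \<Longrightarrow> u \<in> lists L \<Longrightarrow> v \<in> lists L \<Longrightarrow>
   word_eval G f (u @ v) = word_eval G f u \<otimes> word_eval G f v"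
proof (induction u)
  case Nil
  then show ?case by (simp add: word_eval_closed)
next
  case (Cons x u)
  then have "f x \<in> carrier G" "word_eval G f u \<in> carrier G" "word_eval G f v \<in> carrier G"
    by (auto intro: word_eval_closed[of f L])
  then show ?case using Cons by (simp add: m_assoc)
qed

end

lemma (in group_hom) hom_word_eval:
  "f \<in> L \<rightarrow> carrier G \<Longrightarrow> w \<in> lists L \<Longrightarrow>
   h (word_eval G f w) = word_eval H (\<lambda>x. h (f x)) w"
proof (induction w)
  case (Cons x w)
  then have "f x \<in> carrier G" "word_eval G f w \<in> carrier G"
    by (auto intro: G.word_eval_closed[of f L])
  then show ?case using Cons by simp
qed simp

definition word_class :: "'l set \<Rightarrow> ('l list \<times> 'l list) set \<Rightarrow> 'l list \<Rightarrow> 'l list set"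
  where "word_class L R w = presentation_cong L R `` {w}"

lemma presentation_cong_lists:
  "(u, v) \<in> presentation_cong L R \<Longrightarrow> u \<in> lists L \<and> v \<in> lists L"
  by (induction rule: presentation_cong.induct) auto

lemma equiv_presentation_cong: "equiv (lists L) (presentation_cong L R)"
proof (rule equivI)
  show "presentation_cong L R \<subseteq> lists L \<times> lists L" by (auto dest: presentation_cong_lists)
  show "refl_on (lists L) (presentation_cong L R)"
    by (simp add: refl_on_def presentation_cong.refl)
  show "sym (presentation_cong L R)" by (meson symI presentation_cong.sym)
  show "trans (presentation_cong L R)" by (meson transI presentation_cong.trans)
qed

lemma presentation_cong_context:
  assumes "(u, v) \<in> presentation_cong L R" "a \<in> lists L" "b \<in> lists L"
  shows "(a @ u @ b, a @ v @ b) \<in> presentation_cong L R"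
  using assms
proof (induction rule: presentation_cong.induct)
  case (base u v c d)
  then have "(((a @ c) @ u @ (d @ b)), ((a @ c) @ v @ (d @ b))) \<in> presentation_cong L R"
    by (intro presentation_cong.base) auto
  then show ?case by simp
next
  case (refl w)
  then show ?case by (intro presentation_cong.refl) auto
next
  case (sym u v)
  then show ?case by (blast intro: presentation_cong.sym)
next
  case (trans u v w)
  then show ?case by (blast intro: presentation_cong.trans)
qed

lemma presentation_cong_append:
  assumes "(u, u') \<in> presentation_cong L R" "(v, v') \<in> presentation_cong L R"
  shows "(u @ v, u' @ v') \<in> presentation_cong L R"
proof -
  have "(u @ v, u' @ v) \<in> presentation_cong L R"
    using presentation_cong_context[OF assms(1), of "[]" v] presentation_cong_lists[OF assms(2)]
    by simp
  moreover have "(u' @ v, u' @ v') \<in> presentation_cong L R"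
    using presentation_cong_context[OF assms(2), of u' "[]"] presentation_cong_lists[OF assms(1)]
    by simp
  ultimately show ?thesis by (rule presentation_cong.trans)
qed

lemma word_class_eq_iff:
  "u \<in> lists L \<Longrightarrow> v \<in> lists L \<Longrightarrow>
   word_class L R u = word_class L R v \<longleftrightarrow> (u, v) \<in> presentation_cong L R"
  unfolding word_class_def by (rule eq_equiv_class_iff[OF equiv_presentation_cong])

lemma word_class_rel:
  assumes "(u, v) \<in> R" "u \<in> lists L" "v \<in> lists L"
  shows "word_class L R u = word_class L R v"
  using presentation_cong.base[OF assms, of "[]" "[]"] assms(2,3) by (simp add: word_class_eq_iff)

lemma carrier_presented_monoid: "carrier (presented_monoid L R) = word_class L R ` lists L"
  by (auto simp: presented_monoid_def quotient_def word_class_def)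

lemma word_class_closed [intro]:
  "w \<in> lists L \<Longrightarrow> word_class L R w \<in> carrier (presented_monoid L R)"
  by (simp add: carrier_presented_monoid)

lemma one_presented_monoid: "\<one>\<^bsub>presented_monoid L R\<^esub> = word_class L R []"
  by (simp add: presented_monoid_def word_class_def)

lemma mult_presented_monoid:
  assumes "u \<in> lists L" "v \<in> lists L"
  shows "word_class L R u \<otimes>\<^bsub>presented_monoid L R\<^esub> word_class L R v = word_class L R (u @ v)"
proof -
  have "word_class L R (u' @ v') = word_class L R (u @ v)"
    if "u' \<in> word_class L R u" "v' \<in> word_class L R v" for u' v'
  proof -
    have "(u @ v, u' @ v') \<in> presentation_cong L R"
      using that by (intro presentation_cong_append) (auto simp: word_class_def)
    then show ?thesis
      using presentation_cong_lists[of "u @ v" "u' @ v'"]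
        word_class_eq_iff[of "u @ v" L "u' @ v'" R] by auto
  qed
  moreover have "u \<in> word_class L R u" "v \<in> word_class L R v"
    using assms by (auto simp: word_class_def intro: presentation_cong.refl)
  ultimately have "(\<Union>u'\<in>word_class L R u. \<Union>v'\<in>word_class L R v. word_class L R (u' @ v'))
      = word_class L R (u @ v)"
    by blast
  then show ?thesis by (simp add: presented_monoid_def word_class_def)
qed

lemma monoid_presented_monoid: "monoid (presented_monoid L R)"
proof (rule monoidI)
  fix x y assume "x \<in> carrier (presented_monoid L R)" "y \<in> carrier (presented_monoid L R)"
  then obtain u v where x: "x = word_class L R u" "u \<in> lists L" and y: "y = word_class L R v" "v \<in> lists L"
    by (auto simp: carrier_presented_monoid)
  show "x \<otimes>\<^bsub>presented_monoid L R\<^esub> y \<in> carrier (presented_monoid L R)"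
    unfolding x y mult_presented_monoid[OF x(2) y(2)] using x y by (intro word_class_closed) simp
  fix z assume "z \<in> carrier (presented_monoid L R)"
  then obtain w where z: "z = word_class L R w" "w \<in> lists L"
    by (auto simp: carrier_presented_monoid)
  have "u @ v \<in> lists L" "v @ w \<in> lists L" using x y z by simp_all
  then show "x \<otimes>\<^bsub>presented_monoid L R\<^esub> y \<otimes>\<^bsub>presented_monoid L R\<^esub> z
      = x \<otimes>\<^bsub>presented_monoid L R\<^esub> (y \<otimes>\<^bsub>presented_monoid L R\<^esub> z)"
    using x y z by (simp add: mult_presented_monoid del: append_in_lists_conv)
next
  fix x assume "x \<in> carrier (presented_monoid L R)"
  then obtain u where "x = word_class L R u" "u \<in> lists L" by (auto simp: carrier_presented_monoid)
  then show "\<one>\<^bsub>presented_monoid L R\<^esub> \<otimes>\<^bsub>presented_monoid L R\<^esub> x = x"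
    "x \<otimes>\<^bsub>presented_monoid L R\<^esub> \<one>\<^bsub>presented_monoid L R\<^esub> = x"
    by (simp_all add: one_presented_monoid mult_presented_monoid)
qed (auto simp: one_presented_monoid)

lemma word_eval_presentation_cong:
  assumes K: "monoid K" and f: "f \<in> L \<rightarrow> carrier K"
    and R: "\<And>u v. (u, v) \<in> R \<Longrightarrow> u \<in> lists L \<Longrightarrow> v \<in> lists L \<Longrightarrow> word_eval K f u = word_eval K f v"
    and uv: "(u, v) \<in> presentation_cong L R"
  shows "word_eval K f u = word_eval K f v"
  using uv
proof (induction rule: presentation_cong.induct)
  case (base u v a b)
  then show ?case
    by (simp add: monoid.word_eval_append[OF K f] R)
qed auto

lemma hom_presented_monoid_word_class:
  assumes K: "group K" and h: "h \<in> hom (presented_monoid L R) K"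
    and f: "\<And>x. x \<in> L \<Longrightarrow> h (word_class L R [x]) = f x" and w: "w \<in> lists L"
  shows "h (word_class L R w) = word_eval K f w"
  using w
proof (induction w)
  case Nil
  let ?e = "word_class L R []"
  have e: "?e \<in> carrier (presented_monoid L R)" by auto
  then have he: "h ?e \<in> carrier K" using h by (auto simp: hom_def)
  \<comment> \<open>Membership in \<open>hom\<close> does not include preservation of the unit. The
    image of the empty word is idempotent, hence trivial because \<open>K\<close> is a
    group.\<close>
  have "h ?e = h ?e \<otimes>\<^bsub>K\<^esub> h ?e"
    using hom_mult[OF h e e] mult_presented_monoid[of "[]" L "[]" R] by simp
  then show ?case using he K
    by (metis group.is_monoid group.l_cancel_one word_eval_simps(1))
next
  case (Cons x w)
  then have x: "x \<in> L" "w \<in> lists L" by auto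
  have "h (word_class L R (x # w)) = h (word_class L R [x] \<otimes>\<^bsub>presented_monoid L R\<^esub> word_class L R w)"
    using mult_presented_monoid[of "[x]" L w R] x by simp
  also have "\<dots> = f x \<otimes>\<^bsub>K\<^esub> word_eval K f w"
    using x Cons by (subst hom_mult[OF h]) (auto simp: f)
  finally show ?case by simp
qed

lemma presented_monoid_lift_exists:
  assumes K: "monoid K" and f: "f \<in> L \<rightarrow> carrier K"
    and R: "\<And>u v. (u, v) \<in> R \<Longrightarrow> u \<in> lists L \<Longrightarrow> v \<in> lists L \<Longrightarrow> word_eval K f u = word_eval K f v"
  obtains h where "h \<in> hom (presented_monoid L R) K"
    "h \<in> extensional (carrier (presented_monoid L R))"
    "\<And>w. w \<in> lists L \<Longrightarrow> h (word_class L R w) = word_eval K f w"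
proof -
  interpret K: monoid K by (rule K)
  \<comment> \<open>Evaluate an arbitrary representative of the class; congruent words have equal
    values, so the choice does not matter.\<close>
  define h where "h = restrict (\<lambda>c. word_eval K f (SOME w. w \<in> lists L \<and> c = word_class L R w))
    (carrier (presented_monoid L R))"
  have h: "h (word_class L R w) = word_eval K f w" if w: "w \<in> lists L" for w
  proof -
    define v where "v = (SOME v. v \<in> lists L \<and> word_class L R w = word_class L R v)"
    have v: "v \<in> lists L \<and> word_class L R w = word_class L R v"
      unfolding v_def
      by (rule someI[of "\<lambda>v. v \<in> lists L \<and> word_class L R w = word_class L R v" w])
        (use w in simp)
    then have "(w, v) \<in> presentation_cong L R" using v w word_class_eq_iff[of w L v R] by simp
    from word_eval_presentation_cong[OF K f _ this] have "word_eval K f w = word_eval K f v"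
      using R by blast
    moreover have "h (word_class L R w) = word_eval K f v"
      unfolding h_def v_def using word_class_closed[OF w] by (rule restrict_apply')
    ultimately show ?thesis by simp
  qed
  show thesis
  proof (rule that[of h])
    show "h \<in> hom (presented_monoid L R) K"
    proof (rule homI)
      fix x y assume "x \<in> carrier (presented_monoid L R)" "y \<in> carrier (presented_monoid L R)"
      then obtain u v where x: "x = word_class L R u" "u \<in> lists L"
        and y: "y = word_class L R v" "v \<in> lists L"
        by (auto simp: carrier_presented_monoid)
      show "h x \<in> carrier K" unfolding x h[OF x(2)] by (rule K.word_eval_closed[OF f x(2)])
      have "u @ v \<in> lists L" using x y by simp
      then show "h (x \<otimes>\<^bsub>presented_monoid L R\<^esub> y) = h x \<otimes>\<^bsub>K\<^esub> h y"
        using x y by (simp add: mult_presented_monoid h K.word_eval_append[OF f] del: append_in_lists_conv)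
    qed
    show "h \<in> extensional (carrier (presented_monoid L R))" by (simp add: h_def)
  qed (rule h)
qed

lemma presented_monoid_hom_unique:
  assumes "group K" "h \<in> hom (presented_monoid L R) K" "h' \<in> hom (presented_monoid L R) K"
    and "\<And>x. x \<in> L \<Longrightarrow> h (word_class L R [x]) = h' (word_class L R [x])"
    and "z \<in> carrier (presented_monoid L R)"
  shows "h z = h' z"
proof -
  obtain w where w: "w \<in> lists L" "z = word_class L R w"
    using assms(5) by (auto simp: carrier_presented_monoid)
  show ?thesis
    using hom_presented_monoid_word_class[OF assms(1,2) assms(4) w(1)]
      hom_presented_monoid_word_class[OF assms(1,3) HOL.refl w(1)] w(2) by simp
qed

section \<open>Free groups, free products and their lifts\<close>

lemma free_group_letter_inverse:
  assumes i: "i < m"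
  shows "word_class (free_letters m) (free_rels m) [(i, b)] \<otimes>\<^bsub>free_group m\<^esub>
    word_class (free_letters m) (free_rels m) [(i, \<not> b)] = \<one>\<^bsub>free_group m\<^esub>"
proof -
  have "word_class (free_letters m) (free_rels m) [(i, b), (i, \<not> b)]
      = word_class (free_letters m) (free_rels m) []"
    by (rule word_class_rel) (use i in \<open>auto simp: free_rels_def free_letters_def\<close>)
  then show ?thesis
    unfolding free_group_def one_presented_monoid
    by (subst mult_presented_monoid) (use i in \<open>auto simp: free_letters_def\<close>)
qed

text \<open>The two relators for a letter and its opposite make every letter a unit, and units are
  closed under products, so every word is a unit.\<close>

lemma group_free_group [simp, intro]: "group (free_group m)"
proof -
  let ?L = "free_letters m" and ?R = "free_rels m"
  interpret monoid "free_group m" unfolding free_group_def by (rule monoid_presented_monoid)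
  have "word_class ?L ?R w \<in> Units (free_group m)" if "w \<in> lists ?L" for w
    using that
  proof (induction w)
    case Nil
    then show ?case
      using Units_one_closed by (simp add: free_group_def one_presented_monoid)
  next
    case (Cons x w)
    obtain i b where x: "x = (i, b)" "i < m" using Cons by (auto simp: free_letters_def)
    have c: "word_class ?L ?R [(i, c)] \<in> carrier (free_group m)" for c
      unfolding free_group_def using x by (auto simp: free_letters_def)
    have "word_class ?L ?R [(i, b)] \<in> Units (free_group m)"
      using free_group_letter_inverse[OF x(2), of b] free_group_letter_inverse[OF x(2), of "\<not> b"] c
      by (auto simp: Units_def)
    then have "word_class ?L ?R [x] \<otimes>\<^bsub>free_group m\<^esub> word_class ?L ?R w \<in> Units (free_group m)"
      using Cons x by auto
    then show ?case using Cons mult_presented_monoid[of "[x]" ?L w ?R] by (simp add: free_group_def)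
  qed
  then show ?thesis
    by (intro group.intro monoid_axioms group_axioms.intro)
      (auto simp: free_group_def carrier_presented_monoid)
qed

lemma free_gen_eq: "free_gen m i = word_class (free_letters m) (free_rels m) [(i, True)]"
  by (simp add: free_gen_def word_class_def)

lemma free_gen_closed [simp]: "i < m \<Longrightarrow> free_gen m i \<in> carrier (free_group m)"
  unfolding free_gen_eq free_group_def by (auto simp: free_letters_def)

lemma inv_free_gen:
  assumes "i < m"
  shows "inv\<^bsub>free_group m\<^esub> (free_gen m i) = word_class (free_letters m) (free_rels m) [(i, False)]"
proof (rule group.inv_equality[OF group_free_group])
  show "word_class (free_letters m) (free_rels m) [(i, False)] \<in> carrier (free_group m)"
    unfolding free_group_def using assms by (auto simp: free_letters_def)
qed (use assms free_group_letter_inverse[OF assms, of False] free_gen_closed[of i m] in \<open>auto simp: free_gen_eq\<close>)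

definition signed_letter :: "('k, 'b) monoid_scheme \<Rightarrow> (nat \<Rightarrow> 'k) \<Rightarrow> nat \<times> bool \<Rightarrow> 'k"
  where "signed_letter K y p = (if snd p then y (fst p) else inv\<^bsub>K\<^esub> (y (fst p)))"

lemma (in group) signed_letter_closed:
  "y \<in> {..<m} \<rightarrow> carrier G \<Longrightarrow> signed_letter G y \<in> free_letters m \<rightarrow> carrier G"
  by (auto simp: signed_letter_def free_letters_def Pi_iff)

lemma free_group_hom_unique:
  assumes K: "group K" and h: "h \<in> hom (free_group m) K" "h' \<in> hom (free_group m) K"
    and eq: "\<And>i. i < m \<Longrightarrow> h (free_gen m i) = h' (free_gen m i)"
    and z: "z \<in> carrier (free_group m)"
  shows "h z = h' z"
proof (rule presented_monoid_hom_unique[OF K])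
  interpret h: group_hom "free_group m" K h by (rule group_hom.intro) (use K h in \<open>auto simp: group_hom_axioms_def\<close>)
  interpret h': group_hom "free_group m" K h' by (rule group_hom.intro) (use K h in \<open>auto simp: group_hom_axioms_def\<close>)
  fix x assume "x \<in> free_letters m"
  then obtain i b where x: "x = (i, b)" "i < m" by (auto simp: free_letters_def)
  show "h (word_class (free_letters m) (free_rels m) [x]) = h' (word_class (free_letters m) (free_rels m) [x])"
  proof (cases b)
    case True
    then show ?thesis using eq[of i] x by (simp add: free_gen_eq)
  next
    case False
    then show ?thesis
      using eq[of i] x inv_free_gen[of i m] h.hom_inv[of "free_gen m i"] h'.hom_inv[of "free_gen m i"] by simp
  qed
qed (use h z in \<open>auto simp: free_group_def\<close>)

text \<open>Evaluation of words with inverses for negative letters respects the relators and so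
  gives a lift; a homomorphism is determined by the generators. Hence the definite description in
  \<open>free_group_lift\<close> denotes, and it can be computed on words.\<close>

lemma free_group_lift:
  assumes K: "group K" and y: "y \<in> {..<m} \<rightarrow> carrier K"
  shows free_group_lift_hom: "free_group_lift m K y \<in> hom (free_group m) K"
    and free_group_lift_gen: "\<And>i. i < m \<Longrightarrow> free_group_lift m K y (free_gen m i) = y i"
    and free_group_lift_word: "\<And>w. w \<in> lists (free_letters m) \<Longrightarrow>
      free_group_lift m K y (word_class (free_letters m) (free_rels m) w) = word_eval K (signed_letter K y) w"
proof -
  interpret K: group K by (rule K)
  let ?L = "free_letters m" and ?R = "free_rels m"
  have f: "signed_letter K y \<in> ?L \<rightarrow> carrier K" by (rule K.signed_letter_closed[OF y])
  have R: "word_eval K (signed_letter K y) u = word_eval K (signed_letter K y) v" if "(u, v) \<in> ?R" for u v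
    using that y by (auto simp: free_rels_def signed_letter_def Pi_iff)
  obtain h where h: "h \<in> hom (presented_monoid ?L ?R) K"
    "h \<in> extensional (carrier (presented_monoid ?L ?R))"
    "\<And>w. w \<in> lists ?L \<Longrightarrow> h (word_class ?L ?R w) = word_eval K (signed_letter K y) w"
    by (rule presented_monoid_lift_exists[OF K.is_monoid f R]) auto
  have gen: "h (free_gen m i) = y i" if "i < m" for i
    using that h(3)[of "[(i, True)]"] y by (auto simp: free_gen_eq free_letters_def signed_letter_def Pi_iff)
  have eq: "free_group_lift m K y = h"
    unfolding free_group_lift_def
  proof (rule the_equality)
    show "h \<in> hom (free_group m) K \<inter> extensional (carrier (free_group m)) \<and> (\<forall>i<m. h (free_gen m i) = y i)"
      using h gen by (auto simp: free_group_def)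
  next
    fix h' assume h': "h' \<in> hom (free_group m) K \<inter> extensional (carrier (free_group m)) \<and> (\<forall>i<m. h' (free_gen m i) = y i)"
    show "h' = h"
    proof (rule extensionalityI[of _ "carrier (free_group m)"])
      fix z assume "z \<in> carrier (free_group m)"
      then show "h' z = h z"
        by (rule free_group_hom_unique[OF K, of h' m h z, rotated -1]) (use h' h gen in \<open>auto simp: free_group_def\<close>)
    qed (use h h' in \<open>auto simp: free_group_def\<close>)
  qed
  show "free_group_lift m K y \<in> hom (free_group m) K" using eq h by (simp add: free_group_def)
  show "\<And>i. i < m \<Longrightarrow> free_group_lift m K y (free_gen m i) = y i" using eq gen by simp
  show "\<And>w. w \<in> lists (free_letters m) \<Longrightarrow>
      free_group_lift m K y (word_class (free_letters m) (free_rels m) w) = word_eval K (signed_letter K y) w"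
    using eq h(3) by simp
qed

text \<open>As for free groups: the relators only express that \<open>f\<close> and \<open>g\<close>
  are homomorphisms, so evaluation of words is the unique map that the definite description asks
  for.\<close>

lemma free_product_lift_word:
  assumes G: "group G" and H: "group H" and K: "group K"
    and f: "f \<in> hom G K" and g: "g \<in> hom H K"
    and w: "w \<in> lists (free_product_letters G H)"
  shows "free_product_lift G H K f g (word_class (free_product_letters G H) (free_product_rels G H) w)
      = word_eval K (case_sum f g) w"
proof -
  interpret f: group_hom G K f by (rule group_hom.intro) (use G K f in \<open>auto simp: group_hom_axioms_def\<close>)
  interpret g: group_hom H K g by (rule group_hom.intro) (use H K g in \<open>auto simp: group_hom_axioms_def\<close>)
  let ?L = "free_product_letters G H" and ?R = "free_product_rels G H"
  have fg: "case_sum f g \<in> ?L \<rightarrow> carrier K" by (auto simp: free_product_letters_def)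
  have R: "word_eval K (case_sum f g) u = word_eval K (case_sum f g) v" if "(u, v) \<in> ?R" for u v
    using that by (auto simp: free_product_rels_def)
  obtain h where h: "h \<in> hom (presented_monoid ?L ?R) K"
    "h \<in> extensional (carrier (presented_monoid ?L ?R))"
    "\<And>w. w \<in> lists ?L \<Longrightarrow> h (word_class ?L ?R w) = word_eval K (case_sum f g) w"
    by (rule presented_monoid_lift_exists[OF f.H.is_monoid fg R]) auto
  have l: "h (free_product_inl G H a) = f a" if "a \<in> carrier G" for a
    using that h(3)[of "[Inl a]"] by (auto simp: free_product_inl_def word_class_def free_product_letters_def)
  have r: "h (free_product_inr G H a) = g a" if "a \<in> carrier H" for a
    using that h(3)[of "[Inr a]"] by (auto simp: free_product_inr_def word_class_def free_product_letters_def)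
  have eq: "free_product_lift G H K f g = h"
    unfolding free_product_lift_def
  proof (rule the_equality)
    show "h \<in> hom (free_product G H) K \<inter> extensional (carrier (free_product G H)) \<and>
            (\<forall>a\<in>carrier G. h (free_product_inl G H a) = f a) \<and>
            (\<forall>a\<in>carrier H. h (free_product_inr G H a) = g a)"
      using h l r by (auto simp: free_product_def)
  next
    fix h' assume h': "h' \<in> hom (free_product G H) K \<inter> extensional (carrier (free_product G H)) \<and>
            (\<forall>a\<in>carrier G. h' (free_product_inl G H a) = f a) \<and>
            (\<forall>a\<in>carrier H. h' (free_product_inr G H a) = g a)"
    show "h' = h"
    proof (rule extensionalityI[of _ "carrier (free_product G H)"])
      fix z assume "z \<in> carrier (free_product G H)"
      then show "h' z = h z"
        unfolding free_product_def
        by (rule presented_monoid_hom_unique[OF K, of h' ?L ?R h z, rotated -1])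
          (use h' h l r in \<open>auto simp: free_product_def free_product_letters_def free_product_inl_def
            free_product_inr_def word_class_def\<close>)
    qed (use h h' in \<open>auto simp: free_product_def\<close>)
  qed
  show ?thesis using eq h(3)[OF w] by simp
qed

section \<open>Acyclic systems as systems of words\<close>

lemma group_homI: "group G \<Longrightarrow> group H \<Longrightarrow> h \<in> hom G H \<Longrightarrow> group_hom G H h"
  by (simp add: group_hom_def group_hom_axioms_def)

text \<open>A letter of a word for an element of G * F_m may be an element of F_m, which is itself a
  class of words. The flat alphabet removes this nesting: its letters are coefficients from
  \<open>G\<close> and signed variables, so that later inductions run over single letters.\<close>

definition flat_letters :: "('g, 'c) monoid_scheme \<Rightarrow> nat \<Rightarrow> ('g + nat \<times> bool) set"
  where "flat_letters G m = (carrier G) <+> (free_letters m)"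

definition flat_eval ::
    "('k, 'b) monoid_scheme \<Rightarrow> ('g \<Rightarrow> 'k) \<Rightarrow> (nat \<Rightarrow> 'k) \<Rightarrow> ('g + nat \<times> bool) list \<Rightarrow> 'k"
  where "flat_eval K f y = word_eval K (case_sum f (signed_letter K y))"

definition acyclic_word :: "nat \<Rightarrow> ('g + nat \<times> bool) list \<Rightarrow> bool"
  where "acyclic_word m u \<longleftrightarrow>
    flat_eval (free_group m) (\<lambda>_. \<one>\<^bsub>free_group m\<^esub>) (free_gen m) u
      \<in> derived (free_group m) (carrier (free_group m))"

definition free_word :: "nat \<Rightarrow> free_elem \<Rightarrow> (nat \<times> bool) list"
  where "free_word m z = (SOME v. v \<in> lists (free_letters m) \<and>
    z = word_class (free_letters m) (free_rels m) v)"

text \<open>Each letter from F_m is replaced by a chosen word that represents it;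
  \<open>unflatten\<close> turns a signed variable into its class in F_m. They are not inverse to
  each other on lists, but both preserve values, which is all that equations depend on.\<close>

definition flatten :: "nat \<Rightarrow> ('g + free_elem) list \<Rightarrow> ('g + nat \<times> bool) list"
  where "flatten m w = concat (map (case_sum (\<lambda>g. [Inl g]) (\<lambda>z. map Inr (free_word m z))) w)"

definition unflatten :: "nat \<Rightarrow> ('g + nat \<times> bool) list \<Rightarrow> ('g + free_elem) list"
  where "unflatten m = map (map_sum (\<lambda>g. g) (\<lambda>p. word_class (free_letters m) (free_rels m) [p]))"

lemma free_word:
  assumes "z \<in> carrier (free_group m)"
  shows "free_word m z \<in> lists (free_letters m)"
    and "word_class (free_letters m) (free_rels m) (free_word m z) = z"
proof -
  have "\<exists>v. v \<in> lists (free_letters m) \<and> z = word_class (free_letters m) (free_rels m) v"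
    using assms by (auto simp: free_group_def carrier_presented_monoid)
  from someI_ex[OF this]
  show "free_word m z \<in> lists (free_letters m)"
    "word_class (free_letters m) (free_rels m) (free_word m z) = z"
    by (auto simp: free_word_def)
qed

lemma (in group) flat_letter_closed:
  "f \<in> carrier H \<rightarrow> carrier G \<Longrightarrow> y \<in> {..<m} \<rightarrow> carrier G \<Longrightarrow>
   case_sum f (signed_letter G y) \<in> flat_letters H m \<rightarrow> carrier G"
  using signed_letter_closed[of y m] by (auto simp: flat_letters_def)

lemma flatten_lists:
  "w \<in> lists (free_product_letters G (free_group m)) \<Longrightarrow> flatten m w \<in> lists (flat_letters G m)"
proof (induction w)
  case (Cons x w)
  have "case_sum (\<lambda>g. [Inl g]) (\<lambda>z. map Inr (free_word m z)) x \<in> lists (flat_letters G m)"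
  proof (cases x)
    case (Inr z)
    then have "free_word m z \<in> lists (free_letters m)"
      using Cons by (intro free_word(1)) (auto simp: free_product_letters_def)
    then show ?thesis using Inr by (auto simp: flat_letters_def in_lists_conv_set)
  qed (use Cons in \<open>auto simp: free_product_letters_def flat_letters_def\<close>)
  then show ?case using Cons by (simp add: flatten_def)
qed (simp add: flatten_def)

lemma unflatten_lists:
  "u \<in> lists (flat_letters G m) \<Longrightarrow> unflatten m u \<in> lists (free_product_letters G (free_group m))"
  by (induction u)
    (auto simp: unflatten_def free_product_letters_def flat_letters_def free_group_def
      intro!: word_class_closed)

lemma flat_eval_flatten:
  assumes K: "group K" and f: "f \<in> carrier G \<rightarrow> carrier K" and y: "y \<in> {..<m} \<rightarrow> carrier K"
    and w: "w \<in> lists (free_product_letters G (free_group m))"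
  shows "flat_eval K f y (flatten m w) = word_eval K (case_sum f (free_group_lift m K y)) w"
  using w
proof (induction w)
  case Nil
  then show ?case by (simp add: flatten_def flat_eval_def)
next
  case (Cons x w)
  interpret K: group K by (rule K)
  note cl = K.flat_letter_closed[OF f y]
  let ?e = "case_sum (\<lambda>g. [Inl g]) (\<lambda>z. map Inr (free_word m z)) x"
  have e: "?e \<in> lists (flat_letters G m)" and fw: "flatten m w \<in> lists (flat_letters G m)"
    using flatten_lists[of "[x]" G m] flatten_lists[of w G m] Cons by (auto simp: flatten_def)
  have "flat_eval K f y ?e = case_sum f (free_group_lift m K y) x"
  proof (cases x)
    case (Inl g)
    then show ?thesis using Cons f by (auto simp: flat_eval_def free_product_letters_def Pi_iff)
  next
    case (Inr z)
    then have z: "z \<in> carrier (free_group m)" using Cons by (auto simp: free_product_letters_def)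
    show ?thesis
      using free_group_lift_word[OF K y free_word(1)[OF z]] free_word(2)[OF z] Inr
      by (simp add: flat_eval_def word_eval_map)
  qed
  then show ?case
    using K.word_eval_append[OF cl e fw] Cons by (simp add: flatten_def flat_eval_def)
qed

lemma word_eval_unflatten:
  assumes K: "group K" and y: "y \<in> {..<m} \<rightarrow> carrier K" and u: "u \<in> lists (flat_letters G m)"
  shows "word_eval K (case_sum f (free_group_lift m K y)) (unflatten m u) = flat_eval K f y u"
  unfolding unflatten_def word_eval_map flat_eval_def
proof (rule word_eval_cong)
  interpret K: group K by (rule K)
  fix x assume "x \<in> set u"
  then have x: "x \<in> flat_letters G m" using u by auto
  show "case_sum f (free_group_lift m K y)
      (map_sum (\<lambda>g. g) (\<lambda>p. word_class (free_letters m) (free_rels m) [p]) x)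
    = case_sum f (signed_letter K y) x"
  proof (cases x)
    case (Inr p)
    then have p: "p \<in> free_letters m" using x by (auto simp: flat_letters_def)
    then show ?thesis
      using Inr free_group_lift_word[OF K y, of "[p]"] funcset_mem[OF K.signed_letter_closed[OF y] p]
      by simp
  qed simp
qed

text \<open>This rewrites the identity of F_m, as it occurs in the projection G * F_m to F_m, as
  evaluation at the free generators, the form to which \<open>flat_eval_flatten\<close>
  applies.\<close>

lemma free_group_lift_free_gen:
  assumes z: "z \<in> carrier (free_group m)"
  shows "free_group_lift m (free_group m) (free_gen m) z = z"
proof (rule free_group_hom_unique[OF group_free_group _ _ _ z])
  have y: "free_gen m \<in> {..<m} \<rightarrow> carrier (free_group m)" by auto
  show "free_group_lift m (free_group m) (free_gen m) \<in> hom (free_group m) (free_group m)"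
    by (rule free_group_lift_hom[OF group_free_group y])
  show "(\<lambda>z. z) \<in> hom (free_group m) (free_group m)" by (rule homI) auto
  show "free_group_lift m (free_group m) (free_gen m) (free_gen m i) = free_gen m i" if "i < m" for i
    using free_group_lift_gen[OF group_free_group y that] .
qed

text \<open>A coset of the derived subgroup is trivial exactly when its representative lies in the
  subgroup, so acyclicity can be read off from the value of a word in F_m.\<close>

lemma acyclic_elements_word_class:
  assumes G: "group G" and w: "w \<in> lists (free_product_letters G (free_group m))"
  shows "word_class (free_product_letters G (free_group m)) (free_product_rels G (free_group m)) w
      \<in> acyclic_elements G m \<longleftrightarrow>
    word_eval (free_group m)
      (case_sum (\<lambda>_. \<one>\<^bsub>free_group m\<^esub>) (free_group_lift m (free_group m) (free_gen m))) w
      \<in> derived (free_group m) (carrier (free_group m))"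
    (is "?c \<in> _ \<longleftrightarrow> ?e \<in> _")
proof -
  interpret F: group "free_group m" by auto
  let ?D = "derived (free_group m) (carrier (free_group m))"
  have D: "subgroup ?D (free_group m)" by (rule F.derived_is_subgroup) simp
  have "free_product_lift G (free_group m) (free_group m) (\<lambda>_. \<one>\<^bsub>free_group m\<^esub>) (\<lambda>z. z) ?c
      = word_eval (free_group m) (case_sum (\<lambda>_. \<one>\<^bsub>free_group m\<^esub>) (\<lambda>z. z)) w"
    by (rule free_product_lift_word[OF G F.is_group F.is_group _ _ w]) (auto intro: homI)
  also have "\<dots> = ?e"
    by (rule word_eval_cong)
      (use w free_group_lift_free_gen in \<open>auto simp: free_product_letters_def split: sum.splits\<close>)
  finally have l: "free_product_lift G (free_group m) (free_group m)
    (\<lambda>_. \<one>\<^bsub>free_group m\<^esub>) (\<lambda>z. z) ?c = ?e" .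
  have e: "?e \<in> carrier (free_group m)"
    by (rule F.word_eval_closed[OF _ w])
      (auto simp: free_product_letters_def free_group_lift_free_gen)
  have "?c \<in> carrier (free_product G (free_group m))"
    unfolding free_product_def using w by (rule word_class_closed)
  then have "?c \<in> acyclic_elements G m \<longleftrightarrow> ?D #>\<^bsub>free_group m\<^esub> ?e = ?D"
    by (simp add: acyclic_elements_def kernel_def l first_homology_def)
  also have "\<dots> \<longleftrightarrow> ?e \<in> ?D"
    using F.coset_join1[OF _ e D] F.coset_join2[OF e D] F.derived_in_carrier by blast
  finally show ?thesis .
qed

lemma substitute_word_class:
  assumes G: "group G" and y: "y \<in> {..<m} \<rightarrow> carrier G"
    and w: "w \<in> lists (free_product_letters G (free_group m))"
  shows "substitute G m y
      (word_class (free_product_letters G (free_group m)) (free_product_rels G (free_group m)) w)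
    = word_eval G (case_sum (\<lambda>g. g) (free_group_lift m G y)) w"
  unfolding substitute_def
  by (rule free_product_lift_word[OF G group_free_group G _ free_group_lift_hom[OF G y] w])
    (auto intro: homI)

definition solves_flat ::
    "('g, 'c) monoid_scheme \<Rightarrow> nat \<Rightarrow> (nat \<Rightarrow> ('g + nat \<times> bool) list) \<Rightarrow> (nat \<Rightarrow> 'g) \<Rightarrow> bool"
  where "solves_flat G m u y \<longleftrightarrow>
    y \<in> {..<m} \<rightarrow>\<^sub>E carrier G \<and> (\<forall>i<m. y i = flat_eval G (\<lambda>g. g) y (u i))"

text \<open>Systems are translated by \<open>unflatten\<close> in one direction and by
  \<open>flatten\<close> in the other. Since values are preserved, the two systems have literally
  the same solutions \<open>y\<close>, and unique solvability carries over.\<close>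

lemma acyclically_closed_iff_flat:
  "acyclically_closed G \<longleftrightarrow> group G \<and>
    (\<forall>m u. (\<forall>i<m. u i \<in> lists (flat_letters G m) \<and> acyclic_word m (u i)) \<longrightarrow>
      (\<exists>!y. solves_flat G m u y))"
proof -
  have "(\<forall>w \<in> {..<m} \<rightarrow> acyclic_elements G m.
       \<exists>!y. y \<in> {..<m} \<rightarrow>\<^sub>E carrier G \<and> (\<forall>i<m. y i = substitute G m y (w i))) \<longleftrightarrow>
     (\<forall>u. (\<forall>i<m. u i \<in> lists (flat_letters G m) \<and> acyclic_word m (u i)) \<longrightarrow>
      (\<exists>!y. solves_flat G m u y))" (is "?A \<longleftrightarrow> ?B") if G: "group G" for m
  proof
    interpret F: group "free_group m" by auto
    let ?L = "free_product_letters G (free_group m)" and ?R = "free_product_rels G (free_group m)"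
    have idc: "(\<lambda>g. g) \<in> carrier G \<rightarrow> carrier G"
      and onec: "(\<lambda>_. \<one>\<^bsub>free_group m\<^esub>) \<in> carrier G \<rightarrow> carrier (free_group m)"
      and genc: "free_gen m \<in> {..<m} \<rightarrow> carrier (free_group m)"
      by auto
    {
      assume A: ?A
      show ?B
      proof (intro allI impI)
        fix u assume u: "\<forall>i<m. u i \<in> lists (flat_letters G m) \<and> acyclic_word m (u i)"
        define w where "w i = word_class ?L ?R (unflatten m (u i))" for i
        have "w i \<in> acyclic_elements G m" if "i < m" for i
        proof -
          have ui: "u i \<in> lists (flat_letters G m)" "acyclic_word m (u i)" using u that by auto
          show ?thesis
            unfolding w_def acyclic_elements_word_class[OF G unflatten_lists[OF ui(1)]]
              word_eval_unflatten[OF group_free_group genc ui(1)]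
            using ui(2) by (simp add: acyclic_word_def)
        qed
        then have "\<exists>!y. y \<in> {..<m} \<rightarrow>\<^sub>E carrier G \<and> (\<forall>i<m. y i = substitute G m y (w i))"
          using A by auto
        moreover have "substitute G m y (w i) = flat_eval G (\<lambda>g. g) y (u i)"
          if "y \<in> {..<m} \<rightarrow>\<^sub>E carrier G" "i < m" for y i
        proof -
          have y: "y \<in> {..<m} \<rightarrow> carrier G" and ui: "u i \<in> lists (flat_letters G m)"
            using that u by auto
          show ?thesis
            unfolding w_def substitute_word_class[OF G y unflatten_lists[OF ui]]
            by (rule word_eval_unflatten[OF G y ui])
        qed
        then have "(y \<in> {..<m} \<rightarrow>\<^sub>E carrier G \<and> (\<forall>i<m. y i = substitute G m y (w i)))
            = solves_flat G m u y" for y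
          unfolding solves_flat_def by auto
        ultimately show "\<exists>!y. solves_flat G m u y" by simp
      qed
    }
    {
      assume B: ?B
      show ?A
      proof
        fix w assume w: "w \<in> {..<m} \<rightarrow> acyclic_elements G m"
        have "\<exists>v. v \<in> lists ?L \<and> w i = word_class ?L ?R v" if "i < m" for i
        proof -
          have "w i \<in> carrier (free_product G (free_group m))"
            using w that by (auto simp: acyclic_elements_def kernel_def)
          then show ?thesis by (auto simp: free_product_def carrier_presented_monoid)
        qed
        then obtain v where v: "\<And>i. i < m \<Longrightarrow> v i \<in> lists ?L \<and> w i = word_class ?L ?R (v i)"
          by metis
        define u where "u i = flatten m (v i)" for i
        have "u i \<in> lists (flat_letters G m) \<and> acyclic_word m (u i)" if "i < m" for i
        proof
          have "w i \<in> acyclic_elements G m" using w that by auto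
          then show "acyclic_word m (u i)"
            using v[OF that] acyclic_elements_word_class[OF G, of "v i" m]
              flat_eval_flatten[OF group_free_group onec genc, of "v i"]
            by (simp add: acyclic_word_def u_def)
        qed (use v[OF that] flatten_lists in \<open>auto simp: u_def\<close>)
        then have "\<exists>!y. solves_flat G m u y" using B by blast
        moreover have "substitute G m y (w i) = flat_eval G (\<lambda>g. g) y (u i)"
          if "y \<in> {..<m} \<rightarrow>\<^sub>E carrier G" "i < m" for y i
        proof -
          have y: "y \<in> {..<m} \<rightarrow> carrier G" using that by auto
          show ?thesis
            using substitute_word_class[OF G y, of "v i"] flat_eval_flatten[OF G idc y, of "v i"]
              v[OF that(2)] by (simp add: u_def)
        qed
        then have "(y \<in> {..<m} \<rightarrow>\<^sub>E carrier G \<and> (\<forall>i<m. y i = substitute G m y (w i)))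
            = solves_flat G m u y" for y
          unfolding solves_flat_def by auto
        ultimately show "\<exists>!y. y \<in> {..<m} \<rightarrow>\<^sub>E carrier G \<and> (\<forall>i<m. y i = substitute G m y (w i))"
          by simp
      qed
    }
  qed
  then show ?thesis unfolding acyclically_closed_def by (intro conj_cong HOL.refl iff_allI)
qed

section \<open>Exponent sums of acyclic words\<close>

text \<open>The exponent sum of the j-th variable in the word.\<close>

definition letter_exponent :: "nat \<Rightarrow> ('g + nat \<times> bool) list \<Rightarrow> int"
  where "letter_exponent j =
    flat_eval integer_group (\<lambda>_. 0) (\<lambda>i. if i = j then 1 else 0)"

text \<open>The exponent sum factors through a homomorphism from F_m to the integers. Its target is
  abelian, so it is trivial on the derived subgroup, where an acyclic word has its value.\<close>

lemma acyclic_word_exponent: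
  assumes u: "u \<in> lists (flat_letters G m)" and a: "acyclic_word m u"
  shows "letter_exponent j u = 0"
proof -
  let ?\<delta> = "\<lambda>i. if i = j then 1 else (0::int)"
  let ?e = "free_group_lift m integer_group ?\<delta>"
  have y: "?\<delta> \<in> {..<m} \<rightarrow> carrier integer_group" by auto
  interpret e: group_hom "free_group m" integer_group ?e
    by (intro group_homI free_group_lift_hom[OF _ y]) auto
  have genc: "free_gen m \<in> {..<m} \<rightarrow> carrier (free_group m)" by auto
  let ?w = "flat_eval (free_group m) (\<lambda>_. \<one>\<^bsub>free_group m\<^esub>) (free_gen m) u"
  have "?e ` derived (free_group m) (carrier (free_group m))
      = derived integer_group (?e ` carrier (free_group m))"
    using e.derived_img[of "carrier (free_group m)"] by simp
  also have "\<dots> = {0}"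
    using comm_group.derived_eq_singleton[OF abelian_integer_group] by simp
  finally have "?e ?w = 0" using a by (auto simp: acyclic_word_def)
  moreover have "?e ?w = word_eval integer_group
      (\<lambda>x. ?e (case_sum (\<lambda>_. \<one>\<^bsub>free_group m\<^esub>) (signed_letter (free_group m) (free_gen m)) x)) u"
    unfolding flat_eval_def
    by (rule e.hom_word_eval[OF e.G.flat_letter_closed[OF _ genc] u]) auto
  moreover have "\<dots> = letter_exponent j u"
    unfolding letter_exponent_def flat_eval_def
  proof (rule word_eval_cong)
    fix x assume "x \<in> set u"
    then have "x \<in> flat_letters G m" using u by auto
    then show "?e (case_sum (\<lambda>_. \<one>\<^bsub>free_group m\<^esub>) (signed_letter (free_group m) (free_gen m)) x)
      = case_sum (\<lambda>_. 0) (signed_letter integer_group ?\<delta>) x"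
      using free_group_lift_gen[OF group_integer_group y]
      by (auto simp: flat_letters_def free_letters_def signed_letter_def)
  qed
  ultimately show ?thesis by simp
qed

section \<open>Interchange and collapse of finite products\<close>

lemma (in comm_monoid) finprod_swap:
  assumes "finite I" "finite J" "\<And>i j. i \<in> I \<Longrightarrow> j \<in> J \<Longrightarrow> f i j \<in> carrier G"
  shows "(\<Otimes>i\<in>I. \<Otimes>j\<in>J. f i j) = (\<Otimes>j\<in>J. \<Otimes>i\<in>I. f i j)"
  using assms(1,3)
proof (induction I rule: finite_induct)
  case empty
  then show ?case by (simp add: finprod_one_eqI)
next
  case (insert i I)
  have f: "f i \<in> J \<rightarrow> carrier G" "\<And>j. j \<in> J \<Longrightarrow> (\<lambda>i. f i j) \<in> I \<rightarrow> carrier G"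
    "(\<lambda>i. finprod G (f i) J) \<in> I \<rightarrow> carrier G" "(\<lambda>j. \<Otimes>i\<in>I. f i j) \<in> J \<rightarrow> carrier G"
    using insert.prems by (auto intro!: finprod_closed)
  have "(\<Otimes>i\<in>insert i I. \<Otimes>j\<in>J. f i j) = (\<Otimes>j\<in>J. f i j) \<otimes> (\<Otimes>j\<in>J. \<Otimes>i\<in>I. f i j)"
    using insert f by simp
  also have "\<dots> = (\<Otimes>j\<in>J. f i j \<otimes> (\<Otimes>i\<in>I. f i j))"
    using f by (simp add: finprod_multf)
  also have "\<dots> = (\<Otimes>j\<in>J. \<Otimes>i\<in>insert i I. f i j)"
    using insert f by (intro finprod_cong') (auto intro!: finprod_closed)
  finally show ?case .
qed

lemma (in comm_monoid) finprod_delta: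
  assumes "finite I" "i \<in> I" "\<And>j. j \<in> I \<Longrightarrow> j \<noteq> i \<Longrightarrow> f j = \<one>" "f i \<in> carrier G"
  shows "(\<Otimes>j\<in>I. f j) = f i"
proof -
  have "(\<Otimes>j\<in>I. f j) = (\<Otimes>j\<in>I. if i = j then f j else \<one>)"
    using assms by (intro finprod_cong') auto
  also have "\<dots> = f i"
    using finprod_singleton[OF assms(2,1), of f] assms by (metis (no_types, lifting) Pi_I one_closed)
  finally show ?thesis .
qed

section \<open>Right modules\<close>

text \<open>\<open>A\<close> is written multiplicatively, with its unit as the zero of the module,
  so that the locale covers both \<open>add_monoid\<close> of a ring and the tensor product, which
  is a quotient group.\<close>

locale right_module = R: ring R + A: comm_group A
  for R :: "('r, 'd) ring_scheme" (structure) and A :: "'a monoid" +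
  fixes act :: "'a \<Rightarrow> 'r \<Rightarrow> 'a" (infixl \<open>\<odot>\<close> 75)
  assumes act_closed [simp]: "\<lbrakk>a \<in> carrier A; r \<in> carrier R\<rbrakk> \<Longrightarrow> a \<odot> r \<in> carrier A"
    and act_mult_left: "\<lbrakk>a \<in> carrier A; b \<in> carrier A; r \<in> carrier R\<rbrakk> \<Longrightarrow>
      (a \<otimes>\<^bsub>A\<^esub> b) \<odot> r = (a \<odot> r) \<otimes>\<^bsub>A\<^esub> (b \<odot> r)"
    and act_add: "\<lbrakk>a \<in> carrier A; r \<in> carrier R; s \<in> carrier R\<rbrakk> \<Longrightarrow>
      a \<odot> (r \<oplus> s) = (a \<odot> r) \<otimes>\<^bsub>A\<^esub> (a \<odot> s)"
    and act_act: "\<lbrakk>a \<in> carrier A; r \<in> carrier R; s \<in> carrier R\<rbrakk> \<Longrightarrow> a \<odot> r \<odot> s = a \<odot> (r \<otimes> s)"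
    and act_one [simp]: "a \<in> carrier A \<Longrightarrow> a \<odot> \<one> = a"
begin

lemma act_zero [simp]: "a \<in> carrier A \<Longrightarrow> a \<odot> \<zero> = \<one>\<^bsub>A\<^esub>"
  using act_add[of a \<zero> \<zero>] A.l_cancel_one'[of "a \<odot> \<zero>" "a \<odot> \<zero>"] by simp

lemma one_act [simp]: "r \<in> carrier R \<Longrightarrow> \<one>\<^bsub>A\<^esub> \<odot> r = \<one>\<^bsub>A\<^esub>"
  using act_mult_left[of "\<one>\<^bsub>A\<^esub>" "\<one>\<^bsub>A\<^esub>" r] A.l_cancel_one'[of "\<one>\<^bsub>A\<^esub> \<odot> r" "\<one>\<^bsub>A\<^esub> \<odot> r"] by simp

lemma act_minus: "\<lbrakk>a \<in> carrier A; r \<in> carrier R\<rbrakk> \<Longrightarrow> a \<odot> (\<ominus> r) = inv\<^bsub>A\<^esub> (a \<odot> r)"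
  using act_add[of a "\<ominus> r" r] by (intro A.inv_equality[symmetric]) (auto simp: R.l_neg)

lemma finprod_act:
  assumes "finite I" "\<And>i. i \<in> I \<Longrightarrow> f i \<in> carrier A" "r \<in> carrier R"
  shows "finprod A f I \<odot> r = (\<Otimes>\<^bsub>A\<^esub>i\<in>I. f i \<odot> r)"
  using assms
proof (induction I rule: finite_induct)
  case (insert i I)
  then have "f \<in> I \<rightarrow> carrier A" "(\<lambda>i. f i \<odot> r) \<in> I \<rightarrow> carrier A" by auto
  then show ?case using insert by (simp add: act_mult_left)
qed simp

lemma act_finsum:
  assumes "finite I" "\<And>i. i \<in> I \<Longrightarrow> f i \<in> carrier R" "a \<in> carrier A"
  shows "a \<odot> finsum R f I = (\<Otimes>\<^bsub>A\<^esub>i\<in>I. a \<odot> f i)"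
  using assms
proof (induction I rule: finite_induct)
  case (insert i I)
  then have "f \<in> I \<rightarrow> carrier R" "(\<lambda>i. a \<odot> f i) \<in> I \<rightarrow> carrier A" by auto
  then show ?case using insert by (simp add: act_add)
qed simp

text \<open>The product of the row vector \<open>a\<close> with the matrix \<open>U\<close>. Scalars
  act from the right, so vectors of module elements must be rows.\<close>

definition row_mult :: "nat \<Rightarrow> (nat \<Rightarrow> 'a) \<Rightarrow> 'r mat \<Rightarrow> nat \<Rightarrow> 'a"
  where "row_mult m a U i = (\<Otimes>\<^bsub>A\<^esub>j\<in>{..<m}. a j \<odot> U $$ (j, i))"

lemma row_mult_closed:
  "\<lbrakk>a \<in> {..<m} \<rightarrow> carrier A; U \<in> carrier (matrix_ring R m); i < m\<rbrakk> \<Longrightarrow>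
   row_mult m a U i \<in> carrier A"
  unfolding row_mult_def by (rule A.finprod_closed) (auto simp: matrix_ring_def Pi_iff)

lemma row_mult_mult:
  assumes a: "a \<in> {..<m} \<rightarrow> carrier A" and U: "U \<in> carrier (matrix_ring R m)"
    and V: "V \<in> carrier (matrix_ring R m)" and i: "i < m"
  shows "row_mult m (row_mult m a U) V i = row_mult m a (U \<otimes>\<^bsub>matrix_ring R m\<^esub> V) i"
proof -
  have a': "\<And>j. j < m \<Longrightarrow> a j \<in> carrier A" using a by auto
  have U': "\<And>j k. j < m \<Longrightarrow> k < m \<Longrightarrow> U $$ (j, k) \<in> carrier R" using U by (auto simp: matrix_ring_def)
  have V': "\<And>k. k < m \<Longrightarrow> V $$ (k, i) \<in> carrier R" using V i by (auto simp: matrix_ring_def)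
  have "row_mult m (row_mult m a U) V i
      = (\<Otimes>\<^bsub>A\<^esub>k\<in>{..<m}. \<Otimes>\<^bsub>A\<^esub>j\<in>{..<m}. a j \<odot> (U $$ (j, k) \<otimes> V $$ (k, i)))"
    unfolding row_mult_def
  proof (rule A.finprod_cong'[OF HOL.refl])
    fix k assume "k \<in> {..<m}"
    then have k: "k < m" by simp
    have "(\<Otimes>\<^bsub>A\<^esub>j\<in>{..<m}. a j \<odot> U $$ (j, k)) \<odot> V $$ (k, i)
        = (\<Otimes>\<^bsub>A\<^esub>j\<in>{..<m}. a j \<odot> U $$ (j, k) \<odot> V $$ (k, i))"
      by (rule finprod_act) (use k a' U' V' in auto)
    also have "\<dots> = (\<Otimes>\<^bsub>A\<^esub>j\<in>{..<m}. a j \<odot> (U $$ (j, k) \<otimes> V $$ (k, i)))"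
      by (rule A.finprod_cong') (use k a' U' V' in \<open>auto simp: act_act\<close>)
    finally show "(\<Otimes>\<^bsub>A\<^esub>j\<in>{..<m}. a j \<odot> U $$ (j, k)) \<odot> V $$ (k, i) = \<dots>" .
  qed (auto simp: a' U' V' intro!: A.finprod_closed)
  also have "\<dots> = (\<Otimes>\<^bsub>A\<^esub>j\<in>{..<m}. \<Otimes>\<^bsub>A\<^esub>k\<in>{..<m}. a j \<odot> (U $$ (j, k) \<otimes> V $$ (k, i)))"
    by (rule A.finprod_swap) (auto simp: a' U' V')
  also have "\<dots> = row_mult m a (U \<otimes>\<^bsub>matrix_ring R m\<^esub> V) i"
    unfolding row_mult_def
  proof (rule A.finprod_cong'[OF HOL.refl])
    fix j assume "j \<in> {..<m}"
    then have j: "j < m" by simp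
    have "a j \<odot> (U \<otimes>\<^bsub>matrix_ring R m\<^esub> V) $$ (j, i) = a j \<odot> (\<Oplus>k\<in>{..<m}. U $$ (j, k) \<otimes> V $$ (k, i))"
      using i j by (simp add: matrix_ring_def)
    also have "\<dots> = (\<Otimes>\<^bsub>A\<^esub>k\<in>{..<m}. a j \<odot> (U $$ (j, k) \<otimes> V $$ (k, i)))"
      by (rule act_finsum) (use j a' U' V' in auto)
    finally show "(\<Otimes>\<^bsub>A\<^esub>k\<in>{..<m}. a j \<odot> (U $$ (j, k) \<otimes> V $$ (k, i)))
        = a j \<odot> (U \<otimes>\<^bsub>matrix_ring R m\<^esub> V) $$ (j, i)" by simp
  next
    show "(\<lambda>j. a j \<odot> (U \<otimes>\<^bsub>matrix_ring R m\<^esub> V) $$ (j, i)) \<in> {..<m} \<rightarrow> carrier A"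
      using i by (auto simp: matrix_ring_def a' U' V' intro!: act_closed R.finsum_closed)
  qed
  finally show ?thesis .
qed

lemma row_mult_one:
  assumes "a \<in> {..<m} \<rightarrow> carrier A" "i < m"
  shows "row_mult m a \<one>\<^bsub>matrix_ring R m\<^esub> i = a i"
  unfolding row_mult_def
  by (subst A.finprod_delta[of _ i]) (use assms in \<open>auto simp: matrix_ring_def Pi_iff\<close>)

lemma row_mult_cong:
  "(\<And>j. j < m \<Longrightarrow> a j = b j) \<Longrightarrow> b \<in> {..<m} \<rightarrow> carrier A \<Longrightarrow>
   U \<in> carrier (matrix_ring R m) \<Longrightarrow> i < m \<Longrightarrow> row_mult m a U i = row_mult m b U i"
  unfolding row_mult_def by (intro A.finprod_cong') (auto simp: matrix_ring_def Pi_iff)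

text \<open>With \<open>V\<close> inverse to \<open>U\<close>, the equation V U = 1 shows that c V
  is a solution, and U V = 1 shows that every solution equals c V.\<close>

lemma row_mult_unit_ex1:
  assumes U: "U \<in> Units (matrix_ring R m)" and c: "c \<in> {..<m} \<rightarrow> carrier A"
  shows "\<exists>!a. a \<in> {..<m} \<rightarrow>\<^sub>E carrier A \<and> (\<forall>i<m. row_mult m a U i = c i)"
proof -
  obtain V where UV: "U \<in> carrier (matrix_ring R m)" "V \<in> carrier (matrix_ring R m)"
    "V \<otimes>\<^bsub>matrix_ring R m\<^esub> U = \<one>\<^bsub>matrix_ring R m\<^esub>" "U \<otimes>\<^bsub>matrix_ring R m\<^esub> V = \<one>\<^bsub>matrix_ring R m\<^esub>"
    using U by (auto simp: Units_def)
  show ?thesis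
  proof (rule ex1I)
    let ?a = "restrict (row_mult m c V) {..<m}"
    have "row_mult m ?a U i = c i" if i: "i < m" for i
    proof -
      have "row_mult m ?a U i = row_mult m (row_mult m c V) U i"
        by (rule row_mult_cong) (use i UV c in \<open>auto intro!: row_mult_closed\<close>)
      then show ?thesis using row_mult_mult[OF c UV(2,1) i] row_mult_one[OF c i] UV by simp
    qed
    then show "?a \<in> {..<m} \<rightarrow>\<^sub>E carrier A \<and> (\<forall>i<m. row_mult m ?a U i = c i)"
      using row_mult_closed[OF c UV(2)] by auto
  next
    fix a assume a: "a \<in> {..<m} \<rightarrow>\<^sub>E carrier A \<and> (\<forall>i<m. row_mult m a U i = c i)"
    then have ac: "a \<in> {..<m} \<rightarrow> carrier A" by auto
    show "a = restrict (row_mult m c V) {..<m}"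
    proof (rule extensionalityI[of _ "{..<m}"])
      fix i assume "i \<in> {..<m}"
      then have i: "i < m" by simp
      have "row_mult m c V i = row_mult m (row_mult m a U) V i"
        by (rule row_mult_cong) (use a i UV ac in \<open>auto intro!: row_mult_closed\<close>)
      also have "\<dots> = a i" using row_mult_mult[OF ac UV(1,2) i] row_mult_one[OF ac i] UV by simp
      finally show "a i = restrict (row_mult m c V) {..<m} i" using i by simp
    qed (use a in \<open>auto simp: PiE_def\<close>)
  qed
qed

end

section \<open>Group rings\<close>

lemma group_ring_simps [simp]:
  "c \<in> carrier (group_ring G) \<longleftrightarrow> Poly_Mapping.keys c \<subseteq> carrier G"
  "\<one>\<^bsub>group_ring G\<^esub> = frag_of \<one>\<^bsub>G\<^esub>" "\<zero>\<^bsub>group_ring G\<^esub> = 0" "a \<oplus>\<^bsub>group_ring G\<^esub> b = a + b"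
  by (simp_all add: group_ring_def)

lemma group_ring_mult:
  "a \<otimes>\<^bsub>group_ring G\<^esub> b = frag_extend (\<lambda>g. frag_extend (\<lambda>h. frag_of (g \<otimes>\<^bsub>G\<^esub> h)) b) a"
  by (simp add: group_ring_def)

lemma group_ring_mult_of [simp]:
  "frag_of g \<otimes>\<^bsub>group_ring G\<^esub> frag_of h = frag_of (g \<otimes>\<^bsub>G\<^esub> h)"
  by (simp add: group_ring_mult)

lemma group_ring_mult_zero [simp]:
  "0 \<otimes>\<^bsub>group_ring G\<^esub> b = 0" "a \<otimes>\<^bsub>group_ring G\<^esub> 0 = 0"
  by (simp_all add: group_ring_mult frag_extend_eq_0)

lemma group_ring_mult_diff_left:
  "(a - b) \<otimes>\<^bsub>group_ring G\<^esub> c = a \<otimes>\<^bsub>group_ring G\<^esub> c - b \<otimes>\<^bsub>group_ring G\<^esub> c"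
  by (simp add: group_ring_mult frag_extend_diff)

lemma group_ring_mult_diff_right:
  "c \<otimes>\<^bsub>group_ring G\<^esub> (a - b) = c \<otimes>\<^bsub>group_ring G\<^esub> a - c \<otimes>\<^bsub>group_ring G\<^esub> b"
  using subset_UNIV
proof (induction c rule: frag_induction)
  case (one x)
  then show ?case by (simp add: group_ring_mult frag_extend_diff)
qed (simp_all add: group_ring_mult_diff_left)

lemma keys_group_ring_mult:
  assumes "group G" "Poly_Mapping.keys a \<subseteq> carrier G" "Poly_Mapping.keys b \<subseteq> carrier G"
  shows "Poly_Mapping.keys (a \<otimes>\<^bsub>group_ring G\<^esub> b) \<subseteq> carrier G"
proof -
  interpret group G by fact
  have "Poly_Mapping.keys (a \<otimes>\<^bsub>group_ring G\<^esub> b) \<subseteq> (\<Union>g\<in>Poly_Mapping.keys a. \<Union>h\<in>Poly_Mapping.keys b. {g \<otimes>\<^bsub>G\<^esub> h})"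
    unfolding group_ring_mult
    by (rule order_trans[OF keys_frag_extend], rule UN_mono[OF order_refl])
      (rule order_trans[OF keys_frag_extend], simp)
  then show ?thesis using assms by auto
qed

text \<open>The augmentation is the linear extension of the map from \<open>G\<close> to a point,
  once the integers are identified with formal multiples of that point. Additivity is then inherited
  from \<open>frag_extend\<close>.\<close>

lemma augmentation_eq: "augmentation c = Poly_Mapping.lookup (frag_extend (\<lambda>_. frag_of ()) c) ()"
  by (simp add: augmentation_def frag_extend_def lookup_sum)

lemma augmentation_simps [simp]:
  "augmentation 0 = 0" "augmentation (frag_of g) = 1"
  "augmentation (a - b) = augmentation a - augmentation b"
  "augmentation (a + b) = augmentation a + augmentation b"
  "augmentation (- a) = - augmentation a"
  by (simp_all add: augmentation_eq frag_extend_diff frag_extend_add frag_extend_minus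
      lookup_minus lookup_add)

lemma augmentation_mult_of [simp]:
  "augmentation (a \<otimes>\<^bsub>group_ring G\<^esub> frag_of h) = augmentation a"
  using subset_UNIV by (induction a rule: frag_induction) (simp_all add: group_ring_mult_diff_left)

lemma augmentation_mult [simp]:
  "augmentation (a \<otimes>\<^bsub>group_ring G\<^esub> b) = augmentation a * augmentation b"
  using subset_UNIV
  by (induction b rule: frag_induction) (simp_all add: group_ring_mult_diff_right algebra_simps)

locale group_ring_hom = G: group G + R: ring R
  for G :: "('g, 'c) monoid_scheme" and R :: "('r, 'd) ring_scheme" (structure)
    and l :: "('g \<Rightarrow>\<^sub>0 int) \<Rightarrow> 'r" +
  assumes l_hom: "l \<in> Ring.ring_hom (group_ring G) R"
begin

lemma l_closed [simp]: "Poly_Mapping.keys c \<subseteq> carrier G \<Longrightarrow> l c \<in> carrier R"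
  using l_hom by (auto simp: Ring.ring_hom_def)

lemma l_add: "\<lbrakk>Poly_Mapping.keys a \<subseteq> carrier G; Poly_Mapping.keys b \<subseteq> carrier G\<rbrakk> \<Longrightarrow> l (a + b) = l a \<oplus> l b"
  using l_hom by (auto simp: Ring.ring_hom_def)

lemma l_mult: "\<lbrakk>Poly_Mapping.keys a \<subseteq> carrier G; Poly_Mapping.keys b \<subseteq> carrier G\<rbrakk> \<Longrightarrow>
    l (a \<otimes>\<^bsub>group_ring G\<^esub> b) = l a \<otimes> l b"
  using l_hom by (auto simp: Ring.ring_hom_def)

lemma l_one [simp]: "l (frag_of \<one>\<^bsub>G\<^esub>) = \<one>"
  using l_hom by (auto simp: Ring.ring_hom_def)

lemma l_zero [simp]: "l 0 = \<zero>"
  using l_add[of 0 0] R.add.l_cancel_one'[of "l 0" "l 0"] by simp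

lemma l_minus: "Poly_Mapping.keys a \<subseteq> carrier G \<Longrightarrow> l (- a) = \<ominus> l a"
  using l_add[of "- a" a] R.minus_equality[of "l (- a)" "l a"] by simp

lemma l_diff: "\<lbrakk>Poly_Mapping.keys a \<subseteq> carrier G; Poly_Mapping.keys b \<subseteq> carrier G\<rbrakk> \<Longrightarrow> l (a - b) = l a \<ominus> l b"
  using l_add[of a "- b"] by (simp add: l_minus R.minus_eq)

lemma l_of_mult: "\<lbrakk>g \<in> carrier G; h \<in> carrier G\<rbrakk> \<Longrightarrow>
    l (frag_of (g \<otimes>\<^bsub>G\<^esub> h)) = l (frag_of g) \<otimes> l (frag_of h)"
  using l_mult[of "frag_of g" "frag_of h"] by simp

end

section \<open>Exponent sums and evaluation of flat words under maps\<close>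

lemma letter_exponent_Cons:
  "letter_exponent j (x # u) = letter_exponent j [x] + letter_exponent j u"
  by (simp add: letter_exponent_def flat_eval_def)

lemma letter_exponent_simps:
  "letter_exponent j [] = 0"
  "letter_exponent j [Inl g] = 0"
  "letter_exponent j [Inr (i, b)] = (if i = j then if b then 1 else -1 else 0)"
  by (simp_all add: letter_exponent_def flat_eval_def signed_letter_def)

definition map_flat :: "('g \<Rightarrow> 'h) \<Rightarrow> ('g + nat \<times> bool) list \<Rightarrow> ('h + nat \<times> bool) list"
  where "map_flat f = map (map_sum f (\<lambda>p. p))"

lemma map_flat_simps [simp]:
  "map_flat f [] = []" "map_flat f (x # u) = map_sum f (\<lambda>p. p) x # map_flat f u"
  by (simp_all add: map_flat_def)

lemma map_flat_lists:
  "f \<in> carrier G \<rightarrow> carrier H \<Longrightarrow> u \<in> lists (flat_letters G m) \<Longrightarrow> map_flat f u \<in> lists (flat_letters H m)"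
  by (induction u) (auto simp: flat_letters_def)

lemma flat_eval_map_flat: "flat_eval K f y (map_flat g u) = flat_eval K (\<lambda>x. f (g x)) y u"
  unfolding flat_eval_def map_flat_def word_eval_map
  by (rule word_eval_cong) (simp split: sum.split)

lemma acyclic_word_map_flat [simp]: "acyclic_word m (map_flat f u) \<longleftrightarrow> acyclic_word m u"
  by (simp add: acyclic_word_def flat_eval_map_flat)

lemma flat_eval_cong:
  assumes "u \<in> lists (flat_letters G m)" "\<And>g. g \<in> carrier G \<Longrightarrow> f g = f' g" "\<And>i. i < m \<Longrightarrow> y i = y' i"
  shows "flat_eval K f y u = flat_eval K f' y' u"
  unfolding flat_eval_def
  by (rule word_eval_cong)
    (use assms in \<open>auto simp: flat_letters_def free_letters_def signed_letter_def in_lists_conv_set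
      split: sum.split\<close>)

lemma (in group_hom) hom_flat_eval:
  assumes f: "f \<in> carrier K \<rightarrow> carrier G" and y: "y \<in> {..<m} \<rightarrow> carrier G"
    and u: "u \<in> lists (flat_letters K m)"
  shows "h (flat_eval G f y u) = flat_eval H (\<lambda>x. h (f x)) (\<lambda>i. h (y i)) u"
proof -
  have "h (flat_eval G f y u) = word_eval H (\<lambda>x. h (case_sum f (signed_letter G y) x)) u"
    unfolding flat_eval_def by (rule hom_word_eval[OF G.flat_letter_closed[OF f y] u])
  also have "\<dots> = flat_eval H (\<lambda>x. h (f x)) (\<lambda>i. h (y i)) u"
    unfolding flat_eval_def
    by (rule word_eval_cong)
      (use u y in \<open>auto simp: flat_letters_def free_letters_def signed_letter_def in_lists_conv_set
        Pi_iff split: sum.split\<close>)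
  finally show ?thesis .
qed

text \<open>To be inverted, a matrix that augments to the identity needs the integral identity
  matrix to be a unit; this is checked entrywise from the explicit form of
  \<open>matrix_ring\<close>.\<close>

lemma inverting_unit:
  assumes "inverting G R f" "M \<in> carrier (matrix_ring (group_ring G) k)"
    "map_mat augmentation M = \<one>\<^bsub>matrix_ring \<Z> k\<^esub>"
  shows "map_mat f M \<in> Units (matrix_ring R k)"
proof -
  have "\<one>\<^bsub>matrix_ring \<Z> k\<^esub> \<otimes>\<^bsub>matrix_ring \<Z> k\<^esub> \<one>\<^bsub>matrix_ring \<Z> k\<^esub> = \<one>\<^bsub>matrix_ring \<Z> k\<^esub>"
  proof (rule eq_matI)
    interpret Z: comm_monoid "add_monoid \<Z>"
      by (rule comm_monoidI) auto
    fix i j assume "i < dim_row (\<one>\<^bsub>matrix_ring \<Z> k\<^esub>)" "j < dim_col (\<one>\<^bsub>matrix_ring \<Z> k\<^esub>)"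
    then have ij: "i < k" "j < k" by (auto simp: matrix_ring_def)
    let ?I = "\<one>\<^bsub>matrix_ring \<Z> k\<^esub>"
    have "(?I \<otimes>\<^bsub>matrix_ring \<Z> k\<^esub> ?I) $$ (i, j) = (\<Oplus>\<^bsub>\<Z>\<^esub>n\<in>{..<k}. ?I $$ (i, n) * ?I $$ (n, j))"
      using ij by (simp add: matrix_ring_def)
    also have "\<dots> = ?I $$ (i, i) * ?I $$ (i, j)"
      unfolding finsum_def by (rule Z.finprod_delta) (use ij in \<open>auto simp: matrix_ring_def\<close>)
    also have "\<dots> = ?I $$ (i, j)" using ij by (simp add: matrix_ring_def)
    finally show "(?I \<otimes>\<^bsub>matrix_ring \<Z> k\<^esub> ?I) $$ (i, j) = ?I $$ (i, j)" .
  qed (auto simp: matrix_ring_def)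
  then have "\<one>\<^bsub>matrix_ring \<Z> k\<^esub> \<in> Units (matrix_ring \<Z> k)"
    unfolding Units_def by (auto simp: matrix_ring_def)
  then show ?thesis using assms by (auto simp: inverting_def)
qed

section \<open>Semidirect products with a module\<close>

locale group_ring_module = group_ring_hom G R l + right_module R A act
  for G :: "('g, 'c) monoid_scheme" and R :: "('r, 'd) ring_scheme" (structure)
    and l :: "('g \<Rightarrow>\<^sub>0 int) \<Rightarrow> 'r" and A :: "'a monoid" and act :: "'a \<Rightarrow> 'r \<Rightarrow> 'a" (infixl \<open>\<odot>\<close> 75)
begin

text \<open>The left action of \<open>G\<close> on \<open>A\<close> by which the product is formed is \<open>g \<cdot> a = a l(g\<^sup>-\<^sup>1)\<close>.\<close>

definition semidirect :: "('a \<times> 'g) monoid"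
  where "semidirect = \<lparr>carrier = carrier A \<times> carrier G,
    monoid.mult = (\<lambda>p q. (fst p \<otimes>\<^bsub>A\<^esub> fst q \<odot> l (frag_of (inv\<^bsub>G\<^esub> (snd p))), snd p \<otimes>\<^bsub>G\<^esub> snd q)),
    one = (\<one>\<^bsub>A\<^esub>, \<one>\<^bsub>G\<^esub>)\<rparr>"

lemma semidirect_simps [simp]:
  "p \<in> carrier semidirect \<longleftrightarrow> fst p \<in> carrier A \<and> snd p \<in> carrier G"
  "\<one>\<^bsub>semidirect\<^esub> = (\<one>\<^bsub>A\<^esub>, \<one>\<^bsub>G\<^esub>)"
  "p \<otimes>\<^bsub>semidirect\<^esub> q = (fst p \<otimes>\<^bsub>A\<^esub> fst q \<odot> l (frag_of (inv\<^bsub>G\<^esub> (snd p))), snd p \<otimes>\<^bsub>G\<^esub> snd q)"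
  by (cases p; simp add: semidirect_def)+

text \<open>Associativity rests on l((gh)^-1) = l(h^-1) l(g^-1): the inverse turns the right action
  of the ring into a left action of the group.\<close>

lemma group_semidirect: "group semidirect"
proof (rule groupI)
  fix p q r assume "p \<in> carrier semidirect" "q \<in> carrier semidirect" "r \<in> carrier semidirect"
  then show "p \<otimes>\<^bsub>semidirect\<^esub> q \<otimes>\<^bsub>semidirect\<^esub> r = p \<otimes>\<^bsub>semidirect\<^esub> (q \<otimes>\<^bsub>semidirect\<^esub> r)"
    by (simp add: act_mult_left act_act G.inv_mult_group l_of_mult A.m_assoc G.m_assoc)
next
  fix p assume p: "p \<in> carrier semidirect"
  \<comment> \<open>The second component must be the inverse of \<open>snd p\<close>. It then acts
    on \<open>fst p\<close> through \<open>l\<close> of \<open>snd p\<close> itself, and the first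
    component has to cancel the result.\<close>
  let ?q = "(inv\<^bsub>A\<^esub> (fst p \<odot> l (frag_of (snd p))), inv\<^bsub>G\<^esub> (snd p))"
  have "?q \<otimes>\<^bsub>semidirect\<^esub> p = \<one>\<^bsub>semidirect\<^esub>" "?q \<in> carrier semidirect"
    using p by (simp_all add: A.l_inv)
  then show "\<exists>q\<in>carrier semidirect. q \<otimes>\<^bsub>semidirect\<^esub> p = \<one>\<^bsub>semidirect\<^esub>" by blast
qed auto

lemma inv_semidirect:
  "p \<in> carrier semidirect \<Longrightarrow>
   inv\<^bsub>semidirect\<^esub> p = (inv\<^bsub>A\<^esub> (fst p \<odot> l (frag_of (snd p))), inv\<^bsub>G\<^esub> (snd p))"
  by (rule group.inv_equality[OF group_semidirect]) (simp_all add: A.l_inv)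

lemma snd_hom_semidirect: "snd \<in> hom semidirect G"
  by (rule homI) auto

text \<open>In additive notation the linear form sum_j a_j l(D_j). The coefficients are kept in the
  group ring and not in \<open>R\<close>, because their augmentation is needed.\<close>

definition linear_part :: "nat \<Rightarrow> (nat \<Rightarrow> ('g \<Rightarrow>\<^sub>0 int)) \<Rightarrow> (nat \<Rightarrow> 'a) \<Rightarrow> 'a"
  where "linear_part m D a = (\<Otimes>\<^bsub>A\<^esub>j\<in>{..<m}. a j \<odot> l (D j))"

lemma linear_part_closed:
  "\<lbrakk>\<And>j. j < m \<Longrightarrow> Poly_Mapping.keys (D j) \<subseteq> carrier G; a \<in> {..<m} \<rightarrow> carrier A\<rbrakk> \<Longrightarrow>
   linear_part m D a \<in> carrier A"
  unfolding linear_part_def by (rule A.finprod_closed) (auto simp: Pi_iff)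

lemma linear_part_add:
  assumes "\<And>j. j < m \<Longrightarrow> Poly_Mapping.keys (D j) \<subseteq> carrier G"
    "\<And>j. j < m \<Longrightarrow> Poly_Mapping.keys (E j) \<subseteq> carrier G" "a \<in> {..<m} \<rightarrow> carrier A"
  shows "linear_part m (\<lambda>j. D j + E j) a = linear_part m D a \<otimes>\<^bsub>A\<^esub> linear_part m E a"
proof -
  have "linear_part m (\<lambda>j. D j + E j) a = (\<Otimes>\<^bsub>A\<^esub>j\<in>{..<m}. a j \<odot> l (D j) \<otimes>\<^bsub>A\<^esub> a j \<odot> l (E j))"
    unfolding linear_part_def
    by (rule A.finprod_cong') (use assms in \<open>auto simp: l_add act_add Pi_iff\<close>)
  then show ?thesis
    unfolding linear_part_def by (subst A.finprod_multf[symmetric]) (use assms in \<open>auto simp: Pi_iff\<close>)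
qed

lemma linear_part_mult:
  assumes "\<And>j. j < m \<Longrightarrow> Poly_Mapping.keys (D j) \<subseteq> carrier G" "h \<in> carrier G" "a \<in> {..<m} \<rightarrow> carrier A"
  shows "linear_part m (\<lambda>j. D j \<otimes>\<^bsub>group_ring G\<^esub> frag_of h) a = linear_part m D a \<odot> l (frag_of h)"
proof -
  have "linear_part m (\<lambda>j. D j \<otimes>\<^bsub>group_ring G\<^esub> frag_of h) a
      = (\<Otimes>\<^bsub>A\<^esub>j\<in>{..<m}. a j \<odot> l (D j) \<odot> l (frag_of h))"
    unfolding linear_part_def
    by (rule A.finprod_cong') (use assms in \<open>auto simp: l_mult act_act Pi_iff\<close>)
  then show ?thesis
    unfolding linear_part_def by (subst finprod_act) (use assms in \<open>auto simp: Pi_iff\<close>)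
qed

lemma linear_part_delta:
  assumes "Poly_Mapping.keys d \<subseteq> carrier G" "a \<in> {..<m} \<rightarrow> carrier A" "i < m"
  shows "linear_part m (\<lambda>j. if j = i then d else 0) a = a i \<odot> l d"
  unfolding linear_part_def by (subst A.finprod_delta[of _ i]) (use assms in \<open>auto simp: Pi_iff\<close>)

lemma linear_part_zero: "a \<in> {..<m} \<rightarrow> carrier A \<Longrightarrow> linear_part m (\<lambda>_. 0) a = \<one>\<^bsub>A\<^esub>"
  unfolding linear_part_def by (rule A.finprod_one_eqI) (auto simp: Pi_iff)

text \<open>A coefficient contributes a constant and no linear part; a signed variable contributes a
  single linear term and no constant.\<close>

lemma affine_letter:
  assumes g: "g \<in> {..<m} \<rightarrow> carrier G" and x: "x \<in> flat_letters semidirect m"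
  obtains c D where "c \<in> carrier A"
    "\<And>j. j < m \<Longrightarrow> Poly_Mapping.keys (D j) \<subseteq> carrier G \<and> augmentation (D j) = letter_exponent j [x]"
    "\<And>a. a \<in> {..<m} \<rightarrow> carrier A \<Longrightarrow>
      case_sum (\<lambda>p. p) (signed_letter semidirect (\<lambda>i. (a i, g i))) x
      = (c \<otimes>\<^bsub>A\<^esub> linear_part m D a, case_sum (\<lambda>h. h) (signed_letter G g) (map_sum snd (\<lambda>p. p) x))"
proof (cases x)
  case (Inl p)
  then have "p \<in> carrier semidirect" using x by (auto simp: flat_letters_def)
  then have p: "fst p \<in> carrier A" by simp
  show ?thesis
  proof (rule that[of "fst p" "\<lambda>_. 0"])
    fix a assume a: "a \<in> {..<m} \<rightarrow> carrier A"
    show "case_sum (\<lambda>p. p) (signed_letter semidirect (\<lambda>i. (a i, g i))) x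
      = (fst p \<otimes>\<^bsub>A\<^esub> linear_part m (\<lambda>_. 0) a, case_sum (\<lambda>h. h) (signed_letter G g) (map_sum snd (\<lambda>p. p) x))"
      using p by (simp add: Inl linear_part_zero[OF a])
  qed (use p in \<open>simp_all add: Inl letter_exponent_simps\<close>)
next
  case (Inr q)
  then obtain i b where q: "x = Inr (i, b)" "i < m" using x
    by (auto simp: flat_letters_def free_letters_def)
  \<comment> \<open>The inverse of \<open>(a i, g i)\<close> has, additively, first component -a_i
    l(g_i); hence the coefficient -g_i, whose augmentation -1 is the exponent of the letter.\<close>
  let ?d = "if b then frag_of \<one>\<^bsub>G\<^esub> else - frag_of (g i)"
  have gi: "g i \<in> carrier G" using g q by auto
  have d: "Poly_Mapping.keys ?d \<subseteq> carrier G" using gi by simp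
  show ?thesis
  proof (rule that[of "\<one>\<^bsub>A\<^esub>" "\<lambda>j. if j = i then ?d else 0"])
    fix a assume a: "a \<in> {..<m} \<rightarrow> carrier A"
    have ai: "a i \<in> carrier A" using a q by auto
    show "case_sum (\<lambda>p. p) (signed_letter semidirect (\<lambda>i. (a i, g i))) x
      = (\<one>\<^bsub>A\<^esub> \<otimes>\<^bsub>A\<^esub> linear_part m (\<lambda>j. if j = i then ?d else 0) a,
         case_sum (\<lambda>h. h) (signed_letter G g) (map_sum snd (\<lambda>p. p) x))"
      unfolding linear_part_delta[OF d a q(2)]
      using ai gi q by (simp add: signed_letter_def inv_semidirect l_minus act_minus)
  next
    fix j assume "j < m"
    show "Poly_Mapping.keys (if j = i then ?d else 0) \<subseteq> carrier G \<and>
        augmentation (if j = i then ?d else 0) = letter_exponent j [x]"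
      unfolding q(1) letter_exponent_simps using gi by (cases "j = i") simp_all
  qed simp
qed

text \<open>With the components in \<open>G\<close> fixed, a product in the semidirect product
  depends on the components in \<open>A\<close> by an affine map. The coefficients built here
  satisfy D(xu) = D(x) + D(u) x^-1; after the involution this is Fox's product rule, and the
  augmentations add up to the exponent sums.\<close>

lemma affine_word:
  assumes g: "g \<in> {..<m} \<rightarrow> carrier G" and u: "u \<in> lists (flat_letters semidirect m)"
  shows "\<exists>c D. c \<in> carrier A \<and>
    (\<forall>j<m. Poly_Mapping.keys (D j) \<subseteq> carrier G \<and> augmentation (D j) = letter_exponent j u) \<and>
    (\<forall>a. a \<in> {..<m} \<rightarrow> carrier A \<longrightarrow>
      flat_eval semidirect (\<lambda>p. p) (\<lambda>i. (a i, g i)) u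
      = (c \<otimes>\<^bsub>A\<^esub> linear_part m D a, flat_eval G (\<lambda>h. h) g (map_flat snd u)))"
  using u
proof (induction u)
  case Nil
  show ?case
    by (rule exI[of _ "\<one>\<^bsub>A\<^esub>"], rule exI[of _ "\<lambda>_. 0"])
      (auto simp: flat_eval_def linear_part_zero letter_exponent_simps)
next
  case (Cons x u)
  obtain c D where c: "c \<in> carrier A"
    and D: "\<And>j. j < m \<Longrightarrow> Poly_Mapping.keys (D j) \<subseteq> carrier G"
      "\<And>j. j < m \<Longrightarrow> augmentation (D j) = letter_exponent j u"
    and cD: "\<And>a. a \<in> {..<m} \<rightarrow> carrier A \<Longrightarrow>
      flat_eval semidirect (\<lambda>p. p) (\<lambda>i. (a i, g i)) u
      = (c \<otimes>\<^bsub>A\<^esub> linear_part m D a, flat_eval G (\<lambda>h. h) g (map_flat snd u))"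
    using Cons.IH by blast
  have x: "x \<in> flat_letters semidirect m" using Cons by simp
  from affine_letter[OF g x] obtain b E where b: "b \<in> carrier A"
    and E': "\<And>j. j < m \<Longrightarrow> Poly_Mapping.keys (E j) \<subseteq> carrier G \<and> augmentation (E j) = letter_exponent j [x]"
    and bE: "\<And>a. a \<in> {..<m} \<rightarrow> carrier A \<Longrightarrow>
      case_sum (\<lambda>p. p) (signed_letter semidirect (\<lambda>i. (a i, g i))) x
      = (b \<otimes>\<^bsub>A\<^esub> linear_part m E a, case_sum (\<lambda>h. h) (signed_letter G g) (map_sum snd (\<lambda>p. p) x))"
    by blast
  have E: "Poly_Mapping.keys (E j) \<subseteq> carrier G" "augmentation (E j) = letter_exponent j [x]" if "j < m" for j
    using E'[OF that] by simp_all
  define h where "h = case_sum (\<lambda>h. h) (signed_letter G g) (map_sum snd (\<lambda>p. p) x)"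
  have h: "h \<in> carrier G"
  proof -
    have "map_sum snd (\<lambda>p. p) x \<in> flat_letters G m" using x by (auto simp: flat_letters_def)
    then show ?thesis
      unfolding h_def using G.flat_letter_closed[of "\<lambda>h. h" G g m] g by auto
  qed
  let ?h = "frag_of (inv\<^bsub>G\<^esub> h)"
  \<comment> \<open>The first letter has component \<open>h\<close> in \<open>G\<close>, which acts
    on the contribution of the remaining word through \<open>l\<close> of the inverse of
    \<open>h\<close>.\<close>
  let ?D = "\<lambda>j. D j \<otimes>\<^bsub>group_ring G\<^esub> ?h"
  have kh: "Poly_Mapping.keys ?h \<subseteq> carrier G" using h by simp
  have kD: "Poly_Mapping.keys (?D j) \<subseteq> carrier G" if "j < m" for j
    using keys_group_ring_mult[OF G.is_group D(1)[OF that] kh] .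
  show ?case
  proof (intro exI[of _ "b \<otimes>\<^bsub>A\<^esub> c \<odot> l ?h"] exI[of _ "\<lambda>j. E j + ?D j"] conjI allI impI)
    show "b \<otimes>\<^bsub>A\<^esub> c \<odot> l ?h \<in> carrier A" using b c h by simp
    fix j assume j: "j < m"
    show "Poly_Mapping.keys (E j + ?D j) \<subseteq> carrier G"
      using kD[OF j] E(1)[OF j] by (meson Poly_Mapping.keys_add order_trans Un_least)
    show "augmentation (E j + ?D j) = letter_exponent j (x # u)"
      using D(2)[OF j] E[OF j] letter_exponent_Cons[of j x u] by simp
  next
    fix a assume a: "a \<in> {..<m} \<rightarrow> carrier A"
    have [simp]: "linear_part m D a \<in> carrier A" "linear_part m E a \<in> carrier A"
      using linear_part_closed[OF D(1) a] linear_part_closed[OF E(1) a] by simp_all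
    have "flat_eval semidirect (\<lambda>p. p) (\<lambda>i. (a i, g i)) (x # u)
      = (b \<otimes>\<^bsub>A\<^esub> linear_part m E a, h) \<otimes>\<^bsub>semidirect\<^esub>
        (c \<otimes>\<^bsub>A\<^esub> linear_part m D a, flat_eval G (\<lambda>h. h) g (map_flat snd u))"
      using bE[OF a] cD[OF a] by (simp add: flat_eval_def h_def)
    also have "\<dots> = (b \<otimes>\<^bsub>A\<^esub> linear_part m E a \<otimes>\<^bsub>A\<^esub> (c \<odot> l ?h \<otimes>\<^bsub>A\<^esub> linear_part m D a \<odot> l ?h),
        h \<otimes>\<^bsub>G\<^esub> flat_eval G (\<lambda>h. h) g (map_flat snd u))"
      using c h by (simp add: act_mult_left)
    also have "b \<otimes>\<^bsub>A\<^esub> linear_part m E a \<otimes>\<^bsub>A\<^esub> (c \<odot> l ?h \<otimes>\<^bsub>A\<^esub> linear_part m D a \<odot> l ?h)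
        = (b \<otimes>\<^bsub>A\<^esub> c \<odot> l ?h) \<otimes>\<^bsub>A\<^esub> (linear_part m E a \<otimes>\<^bsub>A\<^esub> linear_part m D a \<odot> l ?h)"
      using b c h by (simp add: A.m_ac)
    also have "linear_part m E a \<otimes>\<^bsub>A\<^esub> linear_part m D a \<odot> l ?h = linear_part m (\<lambda>j. E j + ?D j) a"
      using linear_part_add[of m E ?D a] linear_part_mult[of m D "inv\<^bsub>G\<^esub> h" a] E D kD a h by simp
    also have "h \<otimes>\<^bsub>G\<^esub> flat_eval G (\<lambda>h. h) g (map_flat snd u) = flat_eval G (\<lambda>h. h) g (map_flat snd (x # u))"
      by (simp add: flat_eval_def h_def)
    finally show "flat_eval semidirect (\<lambda>p. p) (\<lambda>i. (a i, g i)) (x # u)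
      = (b \<otimes>\<^bsub>A\<^esub> c \<odot> l ?h \<otimes>\<^bsub>A\<^esub> linear_part m (\<lambda>j. E j + ?D j) a,
         flat_eval G (\<lambda>h. h) g (map_flat snd (x # u)))" .
  qed
qed

text \<open>
  In an acyclic system the coefficients of the linear part have augmentation zero, so the linear
  system for the module components has a matrix of the form \<open>1 - D\<close> that becomes invertible.
\<close>

lemma affine_system_ex1:
  assumes inv: "inverting G R l"
    and D: "\<And>i j. i < m \<Longrightarrow> j < m \<Longrightarrow> Poly_Mapping.keys (D i j) \<subseteq> carrier G \<and> augmentation (D i j) = 0"
    and c: "c \<in> {..<m} \<rightarrow> carrier A"
  shows "\<exists>!a. a \<in> {..<m} \<rightarrow>\<^sub>E carrier A \<and> (\<forall>i<m. a i = c i \<otimes>\<^bsub>A\<^esub> linear_part m (D i) a)"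
proof -
  \<comment> \<open>The matrix 1 - D with row and column exchanged: entry (j, i) is the coefficient
    of \<open>a j\<close> in the i-th equation, as multiplication by a row vector requires.\<close>
  define M where "M = mat m m (\<lambda>(j, i). (if j = i then frag_of \<one>\<^bsub>G\<^esub> else 0) - D i j)"
  have keys: "Poly_Mapping.keys ((if j = i then frag_of \<one>\<^bsub>G\<^esub> else 0) - D i j) \<subseteq> carrier G"
    if "i < m" "j < m" for i j
    using D[OF that] keys_diff[of "if j = i then frag_of \<one>\<^bsub>G\<^esub> else 0" "D i j"] by auto
  have "M \<in> carrier (matrix_ring (group_ring G) m)"
    using keys by (simp add: M_def matrix_ring_def)
  moreover have "map_mat augmentation M = \<one>\<^bsub>matrix_ring \<Z> m\<^esub>"
    by (rule eq_matI) (use D in \<open>auto simp: M_def matrix_ring_def\<close>)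
  ultimately have "map_mat l M \<in> Units (matrix_ring R m)" by (rule inverting_unit[OF inv])
  from row_mult_unit_ex1[OF this c]
  have *: "\<exists>!a. a \<in> {..<m} \<rightarrow>\<^sub>E carrier A \<and> (\<forall>i<m. row_mult m a (map_mat l M) i = c i)" .
  have "row_mult m a (map_mat l M) i = c i \<longleftrightarrow> a i = c i \<otimes>\<^bsub>A\<^esub> linear_part m (D i) a"
    if a: "a \<in> {..<m} \<rightarrow>\<^sub>E carrier A" and i: "i < m" for a i
  proof -
    have ac: "a \<in> {..<m} \<rightarrow> carrier A" using a by auto
    let ?E = "\<lambda>j. (if j = i then frag_of \<one>\<^bsub>G\<^esub> else 0) - D i j"
    have row: "row_mult m a (map_mat l M) i = linear_part m ?E a"
      unfolding row_mult_def linear_part_def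
      by (rule A.finprod_cong') (use i ac keys in \<open>auto simp: M_def Pi_iff\<close>)
    \<comment> \<open>Since \<open>?E\<close> is the i-th unit vector minus \<open>D i\<close>,
      adding back the linear part of \<open>D i\<close> leaves \<open>a i\<close>. Cancelling that
      summand turns the equation with 1 - D into the fixed point equation.\<close>
    have sum: "linear_part m ?E a \<otimes>\<^bsub>A\<^esub> linear_part m (D i) a = a i"
    proof -
      have "linear_part m ?E a \<otimes>\<^bsub>A\<^esub> linear_part m (D i) a = linear_part m (\<lambda>j. ?E j + D i j) a"
        by (rule linear_part_add[symmetric]) (use i keys D ac in auto)
      also have "\<dots> = a i" using linear_part_delta[of "frag_of \<one>\<^bsub>G\<^esub>" a m i] i ac by (simp add: Pi_iff)
      finally show ?thesis .
    qed
    have "linear_part m ?E a \<in> carrier A"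
      by (rule linear_part_closed[OF keys[OF i] ac])
    moreover have "linear_part m (D i) a \<in> carrier A"
      by (rule linear_part_closed[OF _ ac]) (use D i in simp)
    moreover have "c i \<in> carrier A" using c i by auto
    ultimately have "(linear_part m ?E a \<otimes>\<^bsub>A\<^esub> linear_part m (D i) a = c i \<otimes>\<^bsub>A\<^esub> linear_part m (D i) a)
        = (linear_part m ?E a = c i)"
      by (simp only: A.right_cancel)
    then show ?thesis by (simp only: row sum)
  qed
  then have "(a \<in> {..<m} \<rightarrow>\<^sub>E carrier A \<and> (\<forall>i<m. row_mult m a (map_mat l M) i = c i))
    \<longleftrightarrow> (a \<in> {..<m} \<rightarrow>\<^sub>E carrier A \<and> (\<forall>i<m. a i = c i \<otimes>\<^bsub>A\<^esub> linear_part m (D i) a))" for a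
    by blast
  then show ?thesis using * by simp
qed

text \<open>The projection to \<open>G\<close> preserves acyclicity, since coefficients do not enter
  it. The projected system therefore has exactly one solution \<open>g\<close>, and over this
  \<open>g\<close> the equations for the components in \<open>A\<close> are affine with coefficients
  of augmentation zero.\<close>

theorem acyclically_closed_semidirect:
  assumes AC: "acyclically_closed G" and inv: "inverting G R l"
  shows "acyclically_closed semidirect"
  unfolding acyclically_closed_iff_flat
proof (intro conjI allI impI group_semidirect)
  fix m u
  assume u: "\<forall>i<m. u i \<in> lists (flat_letters semidirect m) \<and> acyclic_word m (u i)"
  let ?u = "\<lambda>i. map_flat snd (u i)"
  have snd: "snd \<in> carrier semidirect \<rightarrow> carrier G" by auto
  have u': "\<forall>i<m. ?u i \<in> lists (flat_letters G m) \<and> acyclic_word m (?u i)"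
    using u by (simp add: map_flat_lists[OF snd] del: in_lists_conv_set)
  have ex1g: "\<exists>!g. solves_flat G m ?u g"
    by (rule conjunct2[OF AC[unfolded acyclically_closed_iff_flat], THEN spec, THEN spec, THEN mp, OF u'])
  define g where "g = (THE g. solves_flat G m ?u g)"
  have g: "solves_flat G m ?u g" unfolding g_def by (rule theI'[OF ex1g])
  have guniq: "g' = g" if "solves_flat G m ?u g'" for g'
    unfolding g_def using the1_equality[OF ex1g, OF that] by (rule HOL.sym)
  have gc: "g \<in> {..<m} \<rightarrow> carrier G" using g by (auto simp: solves_flat_def)
  define P where "P i c D \<longleftrightarrow> c \<in> carrier A \<and>
    (\<forall>j<m. Poly_Mapping.keys (D j) \<subseteq> carrier G \<and> augmentation (D j) = letter_exponent j (u i)) \<and>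
    (\<forall>a. a \<in> {..<m} \<rightarrow> carrier A \<longrightarrow>
      flat_eval semidirect (\<lambda>p. p) (\<lambda>k. (a k, g k)) (u i)
      = (c \<otimes>\<^bsub>A\<^esub> linear_part m D a, flat_eval G (\<lambda>h. h) g (?u i)))" for i c D
  have "\<exists>c D. P i c D" if "i < m" for i
    unfolding P_def by (rule affine_word[OF gc]) (use u that in blast)
  then obtain c D where P: "\<And>i. i < m \<Longrightarrow> P i (c i) (D i)" by metis
  have cD: "c i \<in> carrier A"
    "\<And>j. j < m \<Longrightarrow> Poly_Mapping.keys (D i j) \<subseteq> carrier G \<and> augmentation (D i j) = letter_exponent j (u i)"
    "\<And>a. a \<in> {..<m} \<rightarrow> carrier A \<Longrightarrow> flat_eval semidirect (\<lambda>p. p) (\<lambda>k. (a k, g k)) (u i)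
      = (c i \<otimes>\<^bsub>A\<^esub> linear_part m (D i) a, flat_eval G (\<lambda>h. h) g (?u i))"
    if "i < m" for i
    using P[OF that] unfolding P_def by blast+
  have ex1a: "\<exists>!a. a \<in> {..<m} \<rightarrow>\<^sub>E carrier A \<and> (\<forall>i<m. a i = c i \<otimes>\<^bsub>A\<^esub> linear_part m (D i) a)"
  proof (rule affine_system_ex1[OF inv])
    fix i j assume ij: "i < m" "j < m"
    show "Poly_Mapping.keys (D i j) \<subseteq> carrier G \<and> augmentation (D i j) = 0"
      using cD(2)[OF ij] acyclic_word_exponent[of "u i" semidirect m j] u ij by simp
  qed (use cD(1) in auto)
  define a where "a = (THE a. a \<in> {..<m} \<rightarrow>\<^sub>E carrier A \<and> (\<forall>i<m. a i = c i \<otimes>\<^bsub>A\<^esub> linear_part m (D i) a))"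
  have a: "a \<in> {..<m} \<rightarrow>\<^sub>E carrier A" "\<And>i. i < m \<Longrightarrow> a i = c i \<otimes>\<^bsub>A\<^esub> linear_part m (D i) a"
    using theI'[OF ex1a] unfolding a_def[symmetric] by blast+
  have auniq: "a' = a" if "a' \<in> {..<m} \<rightarrow>\<^sub>E carrier A \<and> (\<forall>i<m. a' i = c i \<otimes>\<^bsub>A\<^esub> linear_part m (D i) a')" for a'
    unfolding a_def using the1_equality[OF ex1a, OF that] by (rule HOL.sym)
  have ac: "a \<in> {..<m} \<rightarrow> carrier A" using a by auto
  let ?y = "\<lambda>i\<in>{..<m}. (a i, g i)"
  show "\<exists>!y. solves_flat semidirect m u y"
  proof (rule ex1I)
    show "solves_flat semidirect m u ?y"
      unfolding solves_flat_def
    proof (intro conjI allI impI)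
      show "?y \<in> {..<m} \<rightarrow>\<^sub>E carrier semidirect" using ac gc by auto
      fix i assume i: "i < m"
      have "flat_eval semidirect (\<lambda>p. p) ?y (u i) = flat_eval semidirect (\<lambda>p. p) (\<lambda>k. (a k, g k)) (u i)"
        by (rule flat_eval_cong[of _ semidirect m]) (use u i in auto)
      also have "\<dots> = (a i, g i)"
        unfolding cD(3)[OF i ac] using a(2)[OF i] g i by (simp add: solves_flat_def)
      finally show "?y i = flat_eval semidirect (\<lambda>p. p) ?y (u i)" using i by simp
    qed
  next
    fix y assume y: "solves_flat semidirect m u y"
    then have yc: "y \<in> {..<m} \<rightarrow> carrier semidirect" by (auto simp: solves_flat_def)
    interpret snd: group_hom semidirect G snd
      by (rule group_homI[OF group_semidirect G.is_group snd_hom_semidirect])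
    \<comment> \<open>For uniqueness the two components are treated in turn. The second one solves
      the projected system and is forced to be \<open>g\<close>; only then are the equations for the
      first one those with the coefficients \<open>c\<close> and \<open>D\<close>.\<close>
    let ?g = "\<lambda>i\<in>{..<m}. snd (y i)" and ?a = "\<lambda>i\<in>{..<m}. fst (y i)"
    have ac': "?a \<in> {..<m} \<rightarrow> carrier A" using yc by (auto simp: Pi_iff)
    have "solves_flat G m ?u ?g"
      unfolding solves_flat_def
    proof (intro conjI allI impI)
      show "?g \<in> {..<m} \<rightarrow>\<^sub>E carrier G" using yc by (auto simp: Pi_iff)
      fix i assume i: "i < m"
      have ui: "u i \<in> lists (flat_letters semidirect m)" using u i by auto
      have "snd (y i) = snd (flat_eval semidirect (\<lambda>p. p) y (u i))"
        using y i by (simp add: solves_flat_def)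
      also have "\<dots> = flat_eval G (\<lambda>x. snd x) (\<lambda>i. snd (y i)) (u i)"
        by (rule snd.hom_flat_eval[OF _ yc ui]) auto
      also have "\<dots> = flat_eval G (\<lambda>x. snd x) ?g (u i)"
        by (rule flat_eval_cong[OF ui]) auto
      finally show "?g i = flat_eval G (\<lambda>h. h) ?g (?u i)"
        using i by (simp add: flat_eval_map_flat)
    qed
    then have g': "?g = g" by (rule guniq)
    have gi: "snd (y i) = g i" if "i < m" for i
      using fun_cong[OF g', of i] that by simp
    have "?a i = c i \<otimes>\<^bsub>A\<^esub> linear_part m (D i) ?a" if i: "i < m" for i
    proof -
      have ui: "u i \<in> lists (flat_letters semidirect m)" using u i by auto
      have "y i = flat_eval semidirect (\<lambda>p. p) y (u i)" using y i by (simp add: solves_flat_def)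
      also have "\<dots> = flat_eval semidirect (\<lambda>p. p) (\<lambda>k. (?a k, g k)) (u i)"
        by (rule flat_eval_cong[OF ui]) (use gi in \<open>auto simp: prod_eq_iff\<close>)
      also have "\<dots> = (c i \<otimes>\<^bsub>A\<^esub> linear_part m (D i) ?a, flat_eval G (\<lambda>h. h) g (?u i))"
        by (rule cD(3)[OF i ac'])
      finally have "fst (y i) = c i \<otimes>\<^bsub>A\<^esub> linear_part m (D i) ?a" by simp
      then show ?thesis using i by simp
    qed
    moreover have "?a \<in> {..<m} \<rightarrow>\<^sub>E carrier A" using yc by (auto simp: Pi_iff)
    ultimately have a': "?a = a" by (intro auniq conjI allI impI)
    show "y = ?y"
    proof (rule extensionalityI[of _ "{..<m}"])
      show "y \<in> extensional {..<m}" using y by (auto simp: solves_flat_def PiE_def)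
      fix i assume "i \<in> {..<m}"
      then show "y i = ?y i"
        using gi fun_cong[OF a', of i] by (simp add: prod_eq_iff)
    qed auto
  qed
qed

end

section \<open>The universal property beyond the type of the closure\<close>

text \<open>Pull the coefficients back along \<open>g\<close>, solve in \<open>S\<close>, and push
  the solution forward with \<open>f\<close>. Being stated for a one-sided inverse, it can be used
  again with the two maps exchanged.\<close>

lemma solves_flat_iso:
  assumes f: "group_hom S T f" and g: "g \<in> carrier T \<rightarrow> carrier S"
    and fg: "\<And>t. t \<in> carrier T \<Longrightarrow> f (g t) = t"
    and u: "\<And>i. i < m \<Longrightarrow> u i \<in> lists (flat_letters T m)"
    and y: "solves_flat S m (\<lambda>i. map_flat g (u i)) y"
  shows "solves_flat T m u (\<lambda>i\<in>{..<m}. f (y i))"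
  unfolding solves_flat_def
proof (intro conjI allI impI)
  interpret group_hom S T f by (rule f)
  have yc: "y \<in> {..<m} \<rightarrow> carrier S" using y by (auto simp: solves_flat_def)
  then show "(\<lambda>i\<in>{..<m}. f (y i)) \<in> {..<m} \<rightarrow>\<^sub>E carrier T" by (auto simp: Pi_iff)
  fix i assume i: "i < m"
  have "f (y i) = f (flat_eval S (\<lambda>x. g x) y (u i))"
    using y i by (simp add: solves_flat_def flat_eval_map_flat)
  also have "\<dots> = flat_eval T (\<lambda>x. f (g x)) (\<lambda>i. f (y i)) (u i)"
    by (rule hom_flat_eval[OF g yc u[OF i]])
  also have "\<dots> = flat_eval T (\<lambda>x. x) (\<lambda>i\<in>{..<m}. f (y i)) (u i)"
    by (rule flat_eval_cong[OF u[OF i]]) (auto simp: fg)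
  finally show "(\<lambda>i\<in>{..<m}. f (y i)) i = flat_eval T (\<lambda>x. x) (\<lambda>i\<in>{..<m}. f (y i)) (u i)"
    using i by simp
qed

lemma map_flat_inverse:
  "(\<And>t. t \<in> carrier T \<Longrightarrow> f (g t) = t) \<Longrightarrow> w \<in> lists (flat_letters T m) \<Longrightarrow> map_flat f (map_flat g w) = w"
  by (induction w) (auto simp: flat_letters_def)

lemma acyclically_closed_iso:
  assumes S: "acyclically_closed S" and f: "group_hom S T f" and g: "group_hom T S g"
    and fg: "\<And>t. t \<in> carrier T \<Longrightarrow> f (g t) = t" and gf: "\<And>s. s \<in> carrier S \<Longrightarrow> g (f s) = s"
  shows "acyclically_closed T"
  unfolding acyclically_closed_iff_flat
proof (intro conjI allI impI)
  interpret f: group_hom S T f by (rule f)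
  interpret g: group_hom T S g by (rule g)
  show "group T" by (rule f.H.is_group)
  have fc: "f \<in> carrier S \<rightarrow> carrier T" and gc: "g \<in> carrier T \<rightarrow> carrier S" by auto
  fix m u assume u: "\<forall>i<m. u i \<in> lists (flat_letters T m) \<and> acyclic_word m (u i)"
  let ?v = "\<lambda>i. map_flat g (u i)"
  have v: "\<forall>i<m. ?v i \<in> lists (flat_letters S m) \<and> acyclic_word m (?v i)"
    using u by (simp add: map_flat_lists[OF gc] del: in_lists_conv_set)
  have ex1: "\<exists>!y. solves_flat S m ?v y"
    by (rule conjunct2[OF S[unfolded acyclically_closed_iff_flat], THEN spec, THEN spec, THEN mp, OF v])
  then obtain y where y: "solves_flat S m ?v y" by (rule ex1E)
  show "\<exists>!y. solves_flat T m u y"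
  proof (rule ex1I)
    show "solves_flat T m u (\<lambda>i\<in>{..<m}. f (y i))"
      by (rule solves_flat_iso[OF f gc fg _ y]) (use u in auto)
  next
    fix z assume z: "solves_flat T m u z"
    then have zc: "z \<in> {..<m} \<rightarrow>\<^sub>E carrier T" by (simp add: solves_flat_def)
    \<comment> \<open>Pulling the system back and pushing it forward returns it. So \<open>z\<close>
      solves the pushed-forward form of \<open>?v\<close>, and \<open>solves_flat_iso\<close> with
      the roles exchanged carries \<open>z\<close> to the unique solution in
      \<open>S\<close>.\<close>
    have inv: "map_flat f (?v i) = u i" if "i < m" for i
      by (rule map_flat_inverse[of T f g, OF fg]) (use u that in auto)
    have "solves_flat T m (\<lambda>i. map_flat f (?v i)) z \<longleftrightarrow> solves_flat T m u z"
      unfolding solves_flat_def by (intro conj_cong HOL.refl iff_allI imp_cong) (simp add: inv)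
    with z have sz: "solves_flat T m (\<lambda>i. map_flat f (?v i)) z" by simp
    have "solves_flat S m ?v (\<lambda>i\<in>{..<m}. g (z i))"
      by (rule solves_flat_iso[OF g fc gf _ sz]) (use v in auto)
    then have eq: "(\<lambda>i\<in>{..<m}. g (z i)) = y" using y ex1 by (metis (no_types, lifting))
    show "z = (\<lambda>i\<in>{..<m}. f (y i))"
    proof (rule extensionalityI[of _ "{..<m}"])
      show "z \<in> extensional {..<m}" using z by (auto simp: solves_flat_def PiE_def)
      fix i assume i: "i \<in> {..<m}"
      have "z i \<in> carrier T" using zc i by (rule PiE_mem)
      then show "z i = (\<lambda>i\<in>{..<m}. f (y i)) i"
        using i fun_cong[OF eq, of i] fg[of "z i"] by simp
    qed auto
  qed
qed

text \<open>Transport of structure along an injection. It provides an isomorphic copy in the type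
  \<open>'u\<close> over which the universal property of the closure quantifies.\<close>

lemma group_copy:
  assumes S: "group S" and j: "inj_on j (carrier S)"
  obtains T :: "'u monoid" where "group_hom S T (j :: _ \<Rightarrow> 'u)" "group_hom T S (inv_into (carrier S) j)"
    "carrier T = j ` carrier S"
proof -
  interpret S: group S by (rule S)
  let ?k = "inv_into (carrier S) j"
  define T where "T = \<lparr>carrier = j ` carrier S, monoid.mult = (\<lambda>x y. j (?k x \<otimes>\<^bsub>S\<^esub> ?k y)), one = j \<one>\<^bsub>S\<^esub>\<rparr>"
  have k: "?k (j s) = s" if "s \<in> carrier S" for s using j that by simp
  have T: "group T"
  proof (rule groupI)
    fix x assume "x \<in> carrier T"
    then obtain s where s: "x = j s" "s \<in> carrier S" by (auto simp: T_def)
    then show "\<exists>y\<in>carrier T. y \<otimes>\<^bsub>T\<^esub> x = \<one>\<^bsub>T\<^esub>"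
      by (intro bexI[of _ "j (inv\<^bsub>S\<^esub> s)"]) (auto simp: T_def k)
  qed (auto simp: T_def k S.m_assoc)
  show thesis
  proof (rule that[of T])
    show "group_hom S T j" by (rule group_homI[OF S T], rule homI) (auto simp: T_def k)
    show "group_hom T S ?k" by (rule group_homI[OF T S], rule homI) (auto simp: T_def k)
  qed (simp add: T_def)
qed

locale free_acyclic_closure =
  fixes n :: nat and G :: "'u monoid" and \<iota> :: "free_elem \<Rightarrow> 'u"
  assumes closure: "acyclic_closure (free_group n) G \<iota>"
begin

definition gen :: "nat \<Rightarrow> 'u"
  where "gen i = \<iota> (free_gen n i)"

lemma acyclically_closed_G: "acyclically_closed G"
  using closure by (simp add: acyclic_closure_def)

lemma group_G: "group G"
  using acyclically_closed_G by (simp add: acyclically_closed_def)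

lemma group_hom_\<iota>: "group_hom (free_group n) G \<iota>"
  using closure group_G by (intro group_homI) (auto simp: acyclic_closure_def)

lemma gen_closed [simp]: "i < n \<Longrightarrow> gen i \<in> carrier G"
  using group_hom.hom_closed[OF group_hom_\<iota>] by (simp add: gen_def)

text \<open>After copying \<open>S\<close> into \<open>'u\<close>, both maps extend the same
  homomorphism from the free group, because there agreement on the generators is enough; the
  uniqueness of extensions to the closure then applies.\<close>

lemma hom_eq_on_gens:
  assumes S: "acyclically_closed S" and j: "inj_on (j :: 's \<Rightarrow> 'u) (carrier S)"
    and h: "h \<in> hom G S" "h' \<in> hom G S" and eq: "\<And>i. i < n \<Longrightarrow> h (gen i) = h' (gen i)"
    and g: "g \<in> carrier G"
  shows "h g = h' g"
proof -
  have grp: "group S" using S by (simp add: acyclically_closed_def)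
  obtain T :: "'u monoid" where T: "group_hom S T j" "group_hom T S (inv_into (carrier S) j)"
    "carrier T = j ` carrier S"
    by (rule group_copy[OF grp j])
  interpret j: group_hom S T j by (rule T)
  have AT: "acyclically_closed T"
    by (rule acyclically_closed_iso[OF S T(1,2)]) (use j T(3) in auto)
  interpret h: group_hom G S h by (rule group_homI[OF group_G grp h(1)])
  interpret h': group_hom G S h' by (rule group_homI[OF group_G grp h(2)])
  interpret \<iota>: group_hom "free_group n" G \<iota> by (rule group_hom_\<iota>)
  \<comment> \<open>The universal property counts extensional maps, so the composites are restricted
    to the carrier before they are compared.\<close>
  let ?k = "\<lambda>g\<in>carrier G. j (h g)" and ?k' = "\<lambda>g\<in>carrier G. j (h' g)"
  let ?f = "\<lambda>z. j (h (\<iota> z))"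
  have hom: "?f \<in> hom (free_group n) T" "(\<lambda>z. j (h' (\<iota> z))) \<in> hom (free_group n) T"
    by (auto intro!: homI)
  have eqf: "j (h' (\<iota> z)) = ?f z" if "z \<in> carrier (free_group n)" for z
    by (rule free_group_hom_unique[OF j.H.is_group hom(2) hom(1) _ that]) (simp add: eq[symmetric] gen_def[symmetric])
  have ex1: "\<exists>!k. k \<in> hom G T \<inter> extensional (carrier G) \<and> (\<forall>x\<in>carrier (free_group n). k (\<iota> x) = ?f x)"
    by (rule conjunct2[OF conjunct2[OF closure[unfolded acyclic_closure_def]], THEN spec, THEN mp, OF AT,
      THEN bspec, OF hom(1)])
  have k: "?k \<in> hom G T \<inter> extensional (carrier G) \<and> (\<forall>x\<in>carrier (free_group n). ?k (\<iota> x) = ?f x)"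
    "?k' \<in> hom G T \<inter> extensional (carrier G) \<and> (\<forall>x\<in>carrier (free_group n). ?k' (\<iota> x) = ?f x)"
    using eqf by (auto intro!: homI)
  have "?k = ?k'" using the1_equality[OF ex1, OF k(1)] the1_equality[OF ex1, OF k(2)] by simp
  then have "j (h g) = j (h' g)" using g by (metis restrict_apply')
  then show ?thesis using j g by (auto dest!: inj_onD)
qed

lemma hom_extends_from_gens:
  assumes S: "acyclically_closed S" and j: "inj_on (j :: 's \<Rightarrow> 'u) (carrier S)"
    and y: "y \<in> {..<n} \<rightarrow> carrier S"
  obtains h where "h \<in> hom G S" "\<And>i. i < n \<Longrightarrow> h (gen i) = y i"
proof -
  have grp: "group S" using S by (simp add: acyclically_closed_def)
  obtain T :: "'u monoid" where T: "group_hom S T j" "group_hom T S (inv_into (carrier S) j)"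
    "carrier T = j ` carrier S"
    by (rule group_copy[OF grp j])
  interpret j: group_hom S T j by (rule T)
  interpret k: group_hom T S "inv_into (carrier S) j" by (rule T)
  have AT: "acyclically_closed T"
    by (rule acyclically_closed_iso[OF S T(1,2)]) (use j T(3) in auto)
  interpret f: group_hom "free_group n" S "free_group_lift n S y"
    by (rule group_homI[OF group_free_group grp free_group_lift_hom[OF grp y]])
  let ?f = "\<lambda>z. j (free_group_lift n S y z)"
  have "?f \<in> hom (free_group n) T" by (auto intro!: homI)
  then obtain h where h: "h \<in> hom G T" "\<And>z. z \<in> carrier (free_group n) \<Longrightarrow> h (\<iota> z) = ?f z"
    using closure AT unfolding acyclic_closure_def by blast
  interpret h: group_hom G T h by (rule group_homI[OF group_G j.H.is_group h(1)])
  show thesis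
  proof (rule that[of "\<lambda>g. inv_into (carrier S) j (h g)"])
    show "(\<lambda>g. inv_into (carrier S) j (h g)) \<in> hom G S" by (auto intro!: homI)
    fix i assume i: "i < n"
    have "y i \<in> carrier S" using y i by auto
    then show "inv_into (carrier S) j (h (gen i)) = y i"
      using h(2)[of "free_gen n i"] i free_group_lift_gen[OF grp y i] j by (simp add: gen_def)
  qed
qed

end

section \<open>Twisted derivations\<close>

text \<open>The product rule is the first component of the statement that \<open>g\<close> maps to
  \<open>(D g, \<phi> g)\<close> homomorphically into \<open>semidirect\<close>.\<close>

definition (in group_ring_module) derivation :: "('g \<Rightarrow> 'g) \<Rightarrow> ('g \<Rightarrow> 'a) \<Rightarrow> bool"
  where "derivation \<phi> D \<longleftrightarrow> D \<in> carrier G \<rightarrow> carrier A \<and>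
    (\<forall>g\<in>carrier G. \<forall>h\<in>carrier G. D (g \<otimes>\<^bsub>G\<^esub> h) = D g \<otimes>\<^bsub>A\<^esub> D h \<odot> l (frag_of (inv\<^bsub>G\<^esub> (\<phi> g))))"

text \<open>The injection \<open>j\<close> allows the semidirect product to be copied into the type
  \<open>'u\<close> of the closure.\<close>

locale closure_module = free_acyclic_closure n G \<iota> + group_ring_module G R l A act
  for n :: nat and G :: "'u monoid" and \<iota> and R :: "('r, 'd) ring_scheme" (structure)
    and l :: "('u \<Rightarrow>\<^sub>0 int) \<Rightarrow> 'r" and A :: "'a monoid" and act :: "'a \<Rightarrow> 'r \<Rightarrow> 'a" (infixl \<open>\<odot>\<close> 75) +
  fixes j :: "'a \<times> 'u \<Rightarrow> 'u"
  assumes inverting_l: "inverting G R l" and inj_j: "inj_on j (carrier A \<times> carrier G)"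
begin

lemma acyclically_closed_S: "acyclically_closed semidirect"
  by (rule acyclically_closed_semidirect[OF acyclically_closed_G inverting_l])

lemma inj_j_semidirect: "inj_on j (carrier semidirect)"
  using inj_j by (simp add: semidirect_def)

lemma derivation_unique:
  assumes \<phi>: "\<phi> \<in> hom G G" and D: "derivation \<phi> D" "derivation \<phi> D'"
    and eq: "\<And>i. i < n \<Longrightarrow> D (gen i) = D' (gen i)" and g: "g \<in> carrier G"
  shows "D g = D' g"
proof -
  have hom: "(\<lambda>g. (E g, \<phi> g)) \<in> hom G semidirect" if "derivation \<phi> E" for E
    using that hom_in_carrier[OF \<phi>] hom_mult[OF \<phi>] by (intro homI) (auto simp: derivation_def)
  have "(D g, \<phi> g) = (D' g, \<phi> g)"
    by (rule hom_eq_on_gens[OF acyclically_closed_S inj_j_semidirect hom[OF D(1)] hom[OF D(2)] _ g])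
      (simp add: eq)
  then show ?thesis by simp
qed

text \<open>Extend the assignment of \<open>(a i, gen i)\<close> to the i-th generator to all of
  \<open>G\<close>. The second component of the extension is an endomorphism of \<open>G\<close>
  that fixes the generators, hence the identity, and so the first component is an untwisted
  derivation.\<close>

lemma derivation_exists:
  assumes a: "a \<in> {..<n} \<rightarrow> carrier A"
  obtains D where "derivation (\<lambda>g. g) D" "\<And>i. i < n \<Longrightarrow> D (gen i) = a i"
proof -
  have "(\<lambda>i. (a i, gen i)) \<in> {..<n} \<rightarrow> carrier semidirect" using a by auto
  then obtain h where h: "h \<in> hom G semidirect" "\<And>i. i < n \<Longrightarrow> h (gen i) = (a i, gen i)"
    using hom_extends_from_gens[OF acyclically_closed_S inj_j_semidirect] by blast
  have hc: "fst (h g) \<in> carrier A" "snd (h g) \<in> carrier G" if "g \<in> carrier G" for g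
    using hom_in_carrier[OF h(1) that] by auto
  have sndhom: "(\<lambda>g. snd (h g)) \<in> hom G G"
    by (rule homI) (use hc hom_mult[OF h(1)] in auto)
  \<comment> \<open>\<open>hom_eq_on_gens\<close> asks for an injection of its target into
    \<open>'u\<close>. The target is now \<open>G\<close>, and fixing the module component in
    \<open>j\<close> gives one.\<close>
  obtain a0 where "a0 \<in> carrier A" using A.one_closed by blast
  then have "inj_on (\<lambda>g. j (a0, g)) (carrier G)" using inj_j by (auto simp: inj_on_def)
  from hom_eq_on_gens[OF acyclically_closed_G this sndhom, of "\<lambda>g. g"]
  have snd: "snd (h g) = g" if "g \<in> carrier G" for g
    using that h(2) by (simp add: hom_def)
  show thesis
  proof (rule that[of "\<lambda>g. fst (h g)"])
    show "derivation (\<lambda>g. g) (\<lambda>g. fst (h g))"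
      using hc hom_mult[OF h(1)] snd by (auto simp: derivation_def)
  qed (simp add: h(2))
qed

end

section \<open>Cardinality\<close>

lemma inj_pair:
  assumes "infinite (UNIV :: 'u set)"
  obtains p :: "'u \<times> 'u \<Rightarrow> 'u" where "inj p"
proof -
  have "( |UNIV :: ('u \<times> 'u) set| , |UNIV :: 'u set| ) \<in> ordIso"
    using card_of_Times_same_infinite[OF assms] by simp
  then obtain p :: "'u \<times> 'u \<Rightarrow> 'u" where "bij_betw p UNIV UNIV"
    using card_of_ordIso by blast
  then show thesis using that by (auto simp: bij_betw_def)
qed

lemma inj_prod:
  assumes "infinite (UNIV :: 'u set)" and k: "inj_on (k :: 'a \<Rightarrow> 'u) S" and k': "inj_on (k' :: 'b \<Rightarrow> 'u) T"
  obtains q :: "'a \<times> 'b \<Rightarrow> 'u" where "inj_on q (S \<times> T)"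
proof -
  obtain p :: "'u \<times> 'u \<Rightarrow> 'u" where "inj p" by (rule inj_pair[OF assms(1)])
  then have "inj_on (\<lambda>(a, b). p (k a, k' b)) (S \<times> T)"
    by (auto intro!: inj_onI dest!: injD simp: inj_on_eq_iff[OF k] inj_on_eq_iff[OF k'])
  then show thesis by (rule that)
qed

text \<open>A finitely supported function is determined by its graph over the support, a finite set,
  and an infinite set has no more finite subsets than elements.\<close>

lemma inj_frag:
  assumes inf: "infinite (UNIV :: 'u set)" and k: "inj (k :: 'a \<Rightarrow> 'u)"
  obtains q :: "('a \<Rightarrow>\<^sub>0 int) \<Rightarrow> 'u" where "inj q"
proof -
  obtain c :: "nat \<Rightarrow> 'u" where c: "inj c" using infinite_countable_subset[OF inf] by auto
  have "inj (\<lambda>z. c (to_nat (z :: int)))" by (auto intro!: injI dest!: injD[OF c])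
  then obtain p :: "'a \<times> int \<Rightarrow> 'u" where p: "inj_on p (UNIV \<times> UNIV)"
    by (rule inj_prod[OF inf k])
  \<comment> \<open>The graph over the support, with every pair encoded as an element of
    \<open>'u\<close>. The values in it are nonzero, so a missing argument is recognised as having
    value 0.\<close>
  let ?r = "\<lambda>c :: 'a \<Rightarrow>\<^sub>0 int. p ` (\<lambda>x. (x, Poly_Mapping.lookup c x)) ` Poly_Mapping.keys c"
  have "inj ?r"
  proof (rule injI)
    fix c d assume "?r c = ?r d"
    then have eq: "(\<lambda>x. (x, Poly_Mapping.lookup c x)) ` Poly_Mapping.keys c
        = (\<lambda>x. (x, Poly_Mapping.lookup d x)) ` Poly_Mapping.keys d"
      using p by (simp add: inj_image_eq_iff)
    have "Poly_Mapping.lookup c x = Poly_Mapping.lookup d x" for x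
    proof -
      have "(x, y) \<in> (\<lambda>x. (x, Poly_Mapping.lookup e x)) ` Poly_Mapping.keys e \<longleftrightarrow>
          y = Poly_Mapping.lookup e x \<and> y \<noteq> 0" for y and e :: "'a \<Rightarrow>\<^sub>0 int"
        by (auto simp: image_iff in_keys_iff)
      from this[of "Poly_Mapping.lookup c x" c] this[of "Poly_Mapping.lookup c x" d]
        this[of "Poly_Mapping.lookup d x" c] this[of "Poly_Mapping.lookup d x" d]
      show ?thesis unfolding eq by auto
    qed
    then show "c = d" by (rule poly_mapping_eqI)
  qed
  moreover have "range ?r \<subseteq> Fpow UNIV" by (auto simp: Fpow_def)
  moreover obtain s :: "'u set \<Rightarrow> 'u" where "inj_on s (Fpow UNIV)"
    using eqpoll_Fpow[OF inf] by (auto simp: eqpoll_def bij_betw_def)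
  ultimately have "inj (\<lambda>c. s (?r c))"
    by (auto simp: inj_on_def inj_def) (metis (no_types, lifting) image_subset_iff rangeI range_subsetD)
  then show thesis by (rule that)
qed

text \<open>A coset is recovered from any of its representatives, so choosing one for each coset
  embeds the quotient into the type of the group elements.\<close>

lemma inj_rcosets:
  fixes H :: "('a, 'b) monoid_scheme"
  obtains q :: "'a set \<Rightarrow> 'a" where "inj_on q (carrier (H Mod N))"
proof -
  let ?q = "\<lambda>C. SOME x. C = r_coset H N x"
  have "C = r_coset H N (?q C)" if C: "C \<in> carrier (H Mod N)" for C
  proof -
    obtain x where "C = r_coset H N x" using C unfolding carrier_FactGroup by blast
    then show ?thesis by (rule someI[of "\<lambda>x. C = r_coset H N x"])
  qed
  then have "inj_on ?q (carrier (H Mod N))" by (metis (no_types, lifting) inj_onI)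
  then show thesis by (rule that)
qed

section \<open>Maps induced on the Cohn localization\<close>

lemma map_mat_matrix_ring:
  assumes M: "M \<in> carrier (matrix_ring R m)" and f: "\<And>c. c \<in> carrier R \<Longrightarrow> f c \<in> carrier S"
  shows "map_mat f M \<in> carrier (matrix_ring S m)"
proof -
  have "map_mat f M $$ (i, j) = f (M $$ (i, j))" if "i < m" "j < m" for i j
    using M that by (auto simp: matrix_ring_def)
  then show ?thesis using M f by (simp add: matrix_ring_def)
qed

lemma transpose_matrix_ring:
  assumes M: "M \<in> carrier (matrix_ring R m)"
  shows "transpose_mat M \<in> carrier (matrix_ring R m)"
proof -
  have "transpose_mat M $$ (i, j) = M $$ (j, i)" if "i < m" "j < m" for i j
    using M that by (auto simp: matrix_ring_def)
  then show ?thesis using M by (simp add: matrix_ring_def)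
qed

lemma ring_opposite_ring:
  assumes "ring R"
  shows "ring (opposite_ring R)"
proof -
  interpret R: ring R by fact
  show ?thesis
  proof (rule ringI)
    show "abelian_group (opposite_ring R)"
    proof (rule abelian_groupI)
      fix x assume "x \<in> carrier (opposite_ring R)"
      then show "\<exists>y\<in>carrier (opposite_ring R). y \<oplus>\<^bsub>opposite_ring R\<^esub> x = \<zero>\<^bsub>opposite_ring R\<^esub>"
        by (intro bexI[of _ "\<ominus>\<^bsub>R\<^esub> x"]) (auto simp: opposite_ring_def R.l_neg)
    qed (auto simp: opposite_ring_def R.a_ac)
    show "monoid (opposite_ring R)"
      by (rule monoidI) (auto simp: opposite_ring_def R.m_assoc)
  qed (auto simp: opposite_ring_def R.l_distr R.r_distr)
qed

lemma opposite_int_ring: "opposite_ring \<Z> = \<Z>"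
  by (simp add: opposite_ring_def mult.commute)

text \<open>Transposition reverses the order of the matrices, and the opposite ring reverses the
  order of the entries within each summand. Without commutativity, transposition reverses products
  only when the ring is changed in this way.\<close>

lemma transpose_mult_opposite:
  assumes "ring R" "A \<in> carrier (matrix_ring R k)" "B \<in> carrier (matrix_ring R k)"
  shows "transpose_mat A \<otimes>\<^bsub>matrix_ring (opposite_ring R) k\<^esub> transpose_mat B
    = transpose_mat (B \<otimes>\<^bsub>matrix_ring R k\<^esub> A)"
proof (rule eq_matI)
  interpret R: ring R by fact
  have A: "A \<in> carrier_mat k k" "\<And>i j. i < k \<Longrightarrow> j < k \<Longrightarrow> A $$ (i, j) \<in> carrier R"
    and B: "B \<in> carrier_mat k k" "\<And>i j. i < k \<Longrightarrow> j < k \<Longrightarrow> B $$ (i, j) \<in> carrier R"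
    using assms by (auto simp: matrix_ring_def)
  fix i j assume "i < dim_row (transpose_mat (B \<otimes>\<^bsub>matrix_ring R k\<^esub> A))"
    "j < dim_col (transpose_mat (B \<otimes>\<^bsub>matrix_ring R k\<^esub> A))"
  then have ij: "i < k" "j < k" by (auto simp: matrix_ring_def)
  have "(transpose_mat A \<otimes>\<^bsub>matrix_ring (opposite_ring R) k\<^esub> transpose_mat B) $$ (i, j)
      = (\<Oplus>\<^bsub>R\<^esub>n\<in>{..<k}. transpose_mat B $$ (n, j) \<otimes>\<^bsub>R\<^esub> transpose_mat A $$ (i, n))"
    using ij by (simp add: matrix_ring_def opposite_ring_def finsum_def)
  also have "\<dots> = (\<Oplus>\<^bsub>R\<^esub>n\<in>{..<k}. B $$ (j, n) \<otimes>\<^bsub>R\<^esub> A $$ (n, i))"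
    by (rule R.finsum_cong') (use ij A B in auto)
  also have "\<dots> = transpose_mat (B \<otimes>\<^bsub>matrix_ring R k\<^esub> A) $$ (i, j)"
    using ij by (simp add: matrix_ring_def)
  finally show "(transpose_mat A \<otimes>\<^bsub>matrix_ring (opposite_ring R) k\<^esub> transpose_mat B) $$ (i, j)
      = transpose_mat (B \<otimes>\<^bsub>matrix_ring R k\<^esub> A) $$ (i, j)" .
qed (auto simp: matrix_ring_def)

lemma transpose_unit_opposite:
  assumes R: "ring R" and "A \<in> Units (matrix_ring R k)"
  shows "transpose_mat A \<in> Units (matrix_ring (opposite_ring R) k)"
proof -
  obtain B where AB: "A \<in> carrier (matrix_ring R k)" "B \<in> carrier (matrix_ring R k)"
    "B \<otimes>\<^bsub>matrix_ring R k\<^esub> A = \<one>\<^bsub>matrix_ring R k\<^esub>" "A \<otimes>\<^bsub>matrix_ring R k\<^esub> B = \<one>\<^bsub>matrix_ring R k\<^esub>"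
    using assms by (auto simp: Units_def)
  have one: "transpose_mat \<one>\<^bsub>matrix_ring R k\<^esub> = \<one>\<^bsub>matrix_ring (opposite_ring R) k\<^esub>"
    by (rule eq_matI) (auto simp: matrix_ring_def opposite_ring_def transpose_mat_def)
  have cl: "transpose_mat C \<in> carrier (matrix_ring (opposite_ring R) k)"
    if "C \<in> carrier (matrix_ring R k)" for C
    using that by (auto simp: matrix_ring_def opposite_ring_def transpose_mat_def)
  show ?thesis
    unfolding Units_def
    using transpose_mult_opposite[OF R AB(1,2)] transpose_mult_opposite[OF R AB(2,1)] AB(3,4) one
      cl[OF AB(1)] cl[OF AB(2)] by auto
qed

section \<open>Induced maps and the involution on group rings\<close>

lemma group_ring_map_simps [simp]:
  "group_ring_map \<phi> 0 = 0" "group_ring_map \<phi> (frag_of g) = frag_of (\<phi> g)"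
  "group_ring_map \<phi> (a + b) = group_ring_map \<phi> a + group_ring_map \<phi> b"
  "group_ring_map \<phi> (a - b) = group_ring_map \<phi> a - group_ring_map \<phi> b"
  by (simp_all add: group_ring_map_def frag_extend_add frag_extend_diff)

lemma keys_group_ring_map:
  "\<phi> \<in> carrier G \<rightarrow> carrier H \<Longrightarrow> Poly_Mapping.keys c \<subseteq> carrier G \<Longrightarrow>
   Poly_Mapping.keys (group_ring_map \<phi> c) \<subseteq> carrier H"
  unfolding group_ring_map_def by (rule order_trans[OF keys_frag_extend]) auto

lemma augmentation_group_ring_map [simp]: "augmentation (group_ring_map \<phi> c) = augmentation c"
  using subset_UNIV by (induction c rule: frag_induction) simp_all

lemma group_ring_map_mult:
  assumes \<phi>: "\<phi> \<in> hom G H" and a: "Poly_Mapping.keys a \<subseteq> carrier G" and b: "Poly_Mapping.keys b \<subseteq> carrier G"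
  shows "group_ring_map \<phi> (a \<otimes>\<^bsub>group_ring G\<^esub> b) = group_ring_map \<phi> a \<otimes>\<^bsub>group_ring H\<^esub> group_ring_map \<phi> b"
  using a
proof (induction a rule: frag_induction)
  case (one g)
  show ?case
    using b by (induction b rule: frag_induction)
      (use one hom_mult[OF \<phi>] in \<open>simp_all add: group_ring_mult_diff_right\<close>)
qed (simp_all add: group_ring_mult_diff_left)

lemma group_ring_involution_eq: "group_ring_involution G = group_ring_map (\<lambda>g. inv\<^bsub>G\<^esub> g)"
  by (simp add: fun_eq_iff group_ring_involution_def group_ring_map_def)

lemma group_ring_involution_mult:
  assumes "group G" and a: "Poly_Mapping.keys a \<subseteq> carrier G" and b: "Poly_Mapping.keys b \<subseteq> carrier G"
  shows "group_ring_involution G (a \<otimes>\<^bsub>group_ring G\<^esub> b)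
    = group_ring_involution G b \<otimes>\<^bsub>group_ring G\<^esub> group_ring_involution G a"
proof -
  interpret group G by fact
  show ?thesis
    unfolding group_ring_involution_eq
    using a
  proof (induction a rule: frag_induction)
    case (one g)
    show ?case
      using b by (induction b rule: frag_induction)
        (use one in \<open>simp_all add: inv_mult_group group_ring_mult_diff_right group_ring_mult_diff_left\<close>)
  qed (simp_all add: group_ring_mult_diff_left group_ring_mult_diff_right)
qed

lemma group_ring_involution_involution:
  assumes "group G" and a: "Poly_Mapping.keys a \<subseteq> carrier G"
  shows "group_ring_involution G (group_ring_involution G a) = a"
  using a unfolding group_ring_involution_eq
  by (induction a rule: frag_induction) (simp_all add: group.inv_inv[OF assms(1)])

locale cohn_localization = G: group G
  for G :: "('g, 'c) monoid_scheme" and \<Lambda> :: "'u ring" and l :: "('g \<Rightarrow>\<^sub>0 int) \<Rightarrow> 'u" +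
  assumes cohn: "Cohn_localization G \<Lambda> l"
begin

lemma inverting_l: "inverting G \<Lambda> l"
  using cohn by (simp add: Cohn_localization_def)

end

sublocale cohn_localization \<subseteq> group_ring_hom G \<Lambda> l
  using cohn G.is_group
  by (intro group_ring_hom.intro group_ring_hom_axioms.intro) (auto simp: Cohn_localization_def inverting_def)

context cohn_localization
begin

lemma ring_\<Lambda>: "ring \<Lambda>" by (rule R.ring_axioms)

lemma lift_ex1:
  "ring R \<Longrightarrow> inverting G R f \<Longrightarrow> \<exists>!h. h \<in> Ring.ring_hom \<Lambda> R \<inter> extensional (carrier \<Lambda>) \<and>
    (\<forall>c\<in>carrier (group_ring G). h (l c) = f c)" for R :: "'u ring"
  using cohn unfolding Cohn_localization_def by blast

text \<open>Both \<open>h\<close> and the identity are lifts of \<open>l\<close> along itself, and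
  such a lift is unique. This is how identities between endomorphisms of the localization are
  reduced to the group ring.\<close>

lemma endo_id:
  assumes h: "h \<in> Ring.ring_hom \<Lambda> \<Lambda>" and l: "\<And>c. Poly_Mapping.keys c \<subseteq> carrier G \<Longrightarrow> h (l c) = l c"
    and a: "a \<in> carrier \<Lambda>"
  shows "h a = a"
proof -
  let ?h = "restrict h (carrier \<Lambda>)" and ?i = "restrict (\<lambda>a. a) (carrier \<Lambda>)"
  note ex1 = lift_ex1[OF ring_\<Lambda> inverting_l]
  have hP: "?h \<in> Ring.ring_hom \<Lambda> \<Lambda> \<inter> extensional (carrier \<Lambda>) \<and> (\<forall>c\<in>carrier (group_ring G). ?h (l c) = l c)"
    using h l by (auto simp: Ring.ring_hom_def)
  have iP: "?i \<in> Ring.ring_hom \<Lambda> \<Lambda> \<inter> extensional (carrier \<Lambda>) \<and> (\<forall>c\<in>carrier (group_ring G). ?i (l c) = l c)"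
    by (auto simp: Ring.ring_hom_def)
  have "?h = ?i" using the1_equality[OF ex1, OF hP] the1_equality[OF ex1, OF iP] by simp
  then have "?h a = ?i a" by (rule fun_cong)
  then show ?thesis using a by simp
qed

text \<open>Induced maps preserve the augmentation, so the image of the matrix under
  \<open>\<phi>\<close> still augments to a unit, and \<open>l\<close> inverts it.\<close>

lemma inverting_map:
  assumes \<phi>: "\<phi> \<in> hom G G"
  shows "inverting G \<Lambda> (\<lambda>c. l (group_ring_map \<phi> c))"
  unfolding inverting_def
proof (intro conjI allI ballI impI)
  have \<phi>c: "\<phi> \<in> carrier G \<rightarrow> carrier G" using \<phi> by (simp add: hom_def)
  note k = keys_group_ring_map[OF \<phi>c]
  have one: "\<phi> \<one>\<^bsub>G\<^esub> = \<one>\<^bsub>G\<^esub>" using hom_one[OF \<phi> G.is_group G.is_group] .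
  show "(\<lambda>c. l (group_ring_map \<phi> c)) \<in> Ring.ring_hom (group_ring G) \<Lambda>"
    unfolding Ring.ring_hom_def
    by (auto simp: k l_add one group_ring_map_mult[OF \<phi>] l_mult)
  fix m M assume M: "M \<in> carrier (matrix_ring (group_ring G) m)"
    "map_mat augmentation M \<in> Units (matrix_ring \<Z> m)"
  let ?N = "map_mat (group_ring_map \<phi>) M"
  have "?N \<in> carrier (matrix_ring (group_ring G) m)"
    using M(1) by (rule map_mat_matrix_ring) (simp add: k)
  moreover have "map_mat augmentation ?N = map_mat augmentation M" by (rule eq_matI) auto
  ultimately have "map_mat l ?N \<in> Units (matrix_ring \<Lambda> m)"
    using inverting_l M(2) by (simp add: inverting_def)
  moreover have "map_mat l ?N = map_mat (\<lambda>c. l (group_ring_map \<phi> c)) M" by (rule eq_matI) auto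
  ultimately show "map_mat (\<lambda>c. l (group_ring_map \<phi> c)) M \<in> Units (matrix_ring \<Lambda> m)" by simp
qed

lemma localization_map:
  assumes \<phi>: "\<phi> \<in> hom G G"
  shows localization_map_hom: "localization_map G \<Lambda> l \<phi> \<in> Ring.ring_hom \<Lambda> \<Lambda>"
    and localization_map_l: "\<And>c. Poly_Mapping.keys c \<subseteq> carrier G \<Longrightarrow>
      localization_map G \<Lambda> l \<phi> (l c) = l (group_ring_map \<phi> c)"
  using theI'[OF lift_ex1[OF ring_\<Lambda> inverting_map[OF \<phi>]], folded localization_map_def] by auto

lemma localization_map_inverse:
  assumes \<phi>: "\<phi> \<in> hom G G" and \<psi>: "\<psi> \<in> hom G G" and inv: "\<And>g. g \<in> carrier G \<Longrightarrow> \<phi> (\<psi> g) = g"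
    and a: "a \<in> carrier \<Lambda>"
  shows "localization_map G \<Lambda> l \<phi> (localization_map G \<Lambda> l \<psi> a) = a"
proof (rule endo_id[OF _ _ a])
  show "(\<lambda>a. localization_map G \<Lambda> l \<phi> (localization_map G \<Lambda> l \<psi> a)) \<in> Ring.ring_hom \<Lambda> \<Lambda>"
    using localization_map_hom[OF \<phi>] localization_map_hom[OF \<psi>] by (auto simp: Ring.ring_hom_def Pi_iff)
  fix c :: "'g \<Rightarrow>\<^sub>0 int" assume c: "Poly_Mapping.keys c \<subseteq> carrier G"
  have "\<psi> \<in> carrier G \<rightarrow> carrier G" using \<psi> by (simp add: hom_def)
  then have k: "Poly_Mapping.keys (group_ring_map \<psi> c) \<subseteq> carrier G" using c by (rule keys_group_ring_map)
  have "group_ring_map \<phi> (group_ring_map \<psi> c) = c"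
    using c by (induction c rule: frag_induction) (simp_all add: inv)
  then show "localization_map G \<Lambda> l \<phi> (localization_map G \<Lambda> l \<psi> (l c)) = l c"
    by (simp add: localization_map_l[OF \<psi> c] localization_map_l[OF \<phi> k])
qed

text \<open>The involution reverses products and so does passing to the opposite ring, hence the
  composite is a ring homomorphism. For matrices the reversal is absorbed by a
  transposition.\<close>

lemma inverting_involution: "inverting G (opposite_ring \<Lambda>) (\<lambda>c. l (group_ring_involution G c))"
  unfolding inverting_def
proof (intro conjI allI ballI impI)
  have k: "Poly_Mapping.keys (group_ring_involution G c) \<subseteq> carrier G"
    if "Poly_Mapping.keys c \<subseteq> carrier G" for c
    unfolding group_ring_involution_eq using that by (intro keys_group_ring_map[of _ G G]) auto
  show "(\<lambda>c. l (group_ring_involution G c)) \<in> Ring.ring_hom (group_ring G) (opposite_ring \<Lambda>)"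
    unfolding Ring.ring_hom_def
    by (auto simp: k opposite_ring_def group_ring_involution_mult[OF G.is_group] l_mult)
      (use k in \<open>simp_all add: group_ring_involution_eq l_add\<close>)
  fix m M assume M: "M \<in> carrier (matrix_ring (group_ring G) m)"
    "map_mat augmentation M \<in> Units (matrix_ring \<Z> m)"
  \<comment> \<open>The conjugate transpose of \<open>M\<close>. Its augmentation is the transpose
    of that of \<open>M\<close>, again a unit because the ring of integers is its own opposite;
    \<open>l\<close> inverts it, and transposing back leads to the opposite ring.\<close>
  let ?N = "transpose_mat (map_mat (group_ring_involution G) M)"
  have "?N \<in> carrier (matrix_ring (group_ring G) m)"
    using M(1) by (intro transpose_matrix_ring, rule map_mat_matrix_ring) (simp add: k)
  moreover have "map_mat augmentation ?N = transpose_mat (map_mat augmentation M)"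
    by (rule eq_matI) (auto simp: group_ring_involution_eq)
  moreover have "transpose_mat (map_mat augmentation M) \<in> Units (matrix_ring \<Z> m)"
    using transpose_unit_opposite[OF cring.axioms(1)[OF int_is_cring] M(2)] by (simp only: opposite_int_ring)
  ultimately have "map_mat l ?N \<in> Units (matrix_ring \<Lambda> m)"
    using inverting_l by (simp add: inverting_def)
  from transpose_unit_opposite[OF ring_\<Lambda> this]
  have "transpose_mat (map_mat l ?N) \<in> Units (matrix_ring (opposite_ring \<Lambda>) m)" .
  moreover have "transpose_mat (map_mat l ?N) = map_mat (\<lambda>c. l (group_ring_involution G c)) M"
    by (rule eq_matI) auto
  ultimately show "map_mat (\<lambda>c. l (group_ring_involution G c)) M \<in> Units (matrix_ring (opposite_ring \<Lambda>) m)"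
    by simp
qed

abbreviation bar :: "'u \<Rightarrow> 'u" where "bar \<equiv> localization_involution G \<Lambda> l"

text \<open>The unique lift \<open>h\<close> to the opposite ring reverses products, so
  \<open>h\<close> applied twice is an endomorphism; it fixes the image of \<open>l\<close> and is
  the identity by \<open>endo_id\<close>. So \<open>h\<close> meets the condition of being
  self-inverse in \<open>localization_involution\<close>, whose description therefore denotes
  \<open>h\<close>.\<close>

lemma bar_bar:
  assumes "b \<in> carrier \<Lambda>"
  shows "bar (bar b) = b"
proof -
  let ?P = "\<lambda>h. h \<in> Ring.ring_hom \<Lambda> (opposite_ring \<Lambda>) \<inter> extensional (carrier \<Lambda>) \<and>
    (\<forall>c\<in>carrier (group_ring G). h (l c) = l (group_ring_involution G c))"
  have ex1: "\<exists>!h. ?P h"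
    by (rule lift_ex1[OF ring_opposite_ring[OF ring_\<Lambda>] inverting_involution])
  then obtain h where h: "?P h" by (rule ex1E)
  have hh: "h (h a) = a" if a: "a \<in> carrier \<Lambda>" for a
  proof (rule endo_id[OF _ _ a])
    show "(\<lambda>a. h (h a)) \<in> Ring.ring_hom \<Lambda> \<Lambda>"
      using h by (auto simp: Ring.ring_hom_def opposite_ring_def Pi_iff)
    fix c :: "'g \<Rightarrow>\<^sub>0 int" assume c: "Poly_Mapping.keys c \<subseteq> carrier G"
    have "Poly_Mapping.keys (group_ring_involution G c) \<subseteq> carrier G"
      unfolding group_ring_involution_eq using c by (intro keys_group_ring_map[of _ G G]) auto
    then show "h (h (l c)) = l c"
      using h c group_ring_involution_involution[OF G.is_group c] by simp
  qed
  have "bar = h"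
    unfolding localization_involution_def
  proof (rule the_equality)
    show "h \<in> Ring.ring_hom \<Lambda> (opposite_ring \<Lambda>) \<inter> extensional (carrier \<Lambda>) \<and>
      (\<forall>a\<in>carrier \<Lambda>. h (h a) = a) \<and> (\<forall>c\<in>carrier (group_ring G). h (l c) = l (group_ring_involution G c))"
      using h hh by blast
  next
    fix h' assume "h' \<in> Ring.ring_hom \<Lambda> (opposite_ring \<Lambda>) \<inter> extensional (carrier \<Lambda>) \<and>
      (\<forall>a\<in>carrier \<Lambda>. h' (h' a) = a) \<and> (\<forall>c\<in>carrier (group_ring G). h' (l c) = l (group_ring_involution G c))"
    then have h': "?P h'" by blast
    show "h' = h" using the1_equality[OF ex1, OF h'] the1_equality[OF ex1, OF h] by simp
  qed
  then show ?thesis using hh[OF assms] by simp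
qed

end

section \<open>The tensor product\<close>

locale magnus_tensor = group_ring_hom G \<Lambda> l
  for G :: "('g, 'c) monoid_scheme" and \<Lambda> :: "'u ring" (structure) and l :: "('g \<Rightarrow>\<^sub>0 int) \<Rightarrow> 'u"
begin

abbreviation I where "I \<equiv> augmentation_ideal G"
abbreviation F where "F \<equiv> tensor_free G \<Lambda>"
abbreviation N where "N \<equiv> tensor_subgroup G \<Lambda> l"
abbreviation T where "T \<equiv> tensor_group G \<Lambda> l"
abbreviation tens where "tens \<equiv> tensor G \<Lambda> l"

lemma in_I: "x \<in> I \<longleftrightarrow> Poly_Mapping.keys x \<subseteq> carrier G \<and> augmentation x = 0"
  by (simp add: augmentation_ideal_def)

lemma I_add: "x \<in> I \<Longrightarrow> y \<in> I \<Longrightarrow> x + y \<in> I"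
  using Poly_Mapping.keys_add[of x y] by (auto simp: in_I)

lemma I_mult: "x \<in> I \<Longrightarrow> Poly_Mapping.keys z \<subseteq> carrier G \<Longrightarrow> x \<otimes>\<^bsub>group_ring G\<^esub> z \<in> I"
  using keys_group_ring_mult[OF G.is_group] by (simp add: in_I)

lemma inv_minus_one_in_I: "g \<in> carrier G \<Longrightarrow> inv_minus_one G g \<in> I"
  using keys_diff[of "frag_of (inv\<^bsub>G\<^esub> g)" "frag_of \<one>\<^bsub>G\<^esub>"]
  by (auto simp: in_I inv_minus_one_def)

lemma comm_group_F: "comm_group F"
  unfolding tensor_free_def by (rule abelian_free_Abelian_group)

lemma F_simps [simp]:
  "c \<in> carrier F \<longleftrightarrow> Poly_Mapping.keys c \<subseteq> I \<times> carrier \<Lambda>"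
  "c \<otimes>\<^bsub>F\<^esub> d = c + d" "\<one>\<^bsub>F\<^esub> = 0"
  by (simp_all add: tensor_free_def)

lemma frag_of_in_F: "frag_of (x, a) \<in> carrier F \<longleftrightarrow> x \<in> I \<and> a \<in> carrier \<Lambda>"
  by simp

lemma F_add: "c \<in> carrier F \<Longrightarrow> d \<in> carrier F \<Longrightarrow> c + d \<in> carrier F"
  using Poly_Mapping.keys_add[of c d] by auto

lemma F_diff:
  assumes "c \<in> carrier F" "d \<in> carrier F"
  shows "c - d \<in> carrier F" "c - d = c \<otimes>\<^bsub>F\<^esub> inv\<^bsub>F\<^esub> d"
proof -
  show "c - d \<in> carrier F"
    using assms order_trans[OF keys_diff[of c d] Un_least] unfolding F_simps(1) by blast
  have "inv\<^bsub>F\<^esub> d = - d" using assms by (simp add: tensor_free_def)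
  then show "c - d = c \<otimes>\<^bsub>F\<^esub> inv\<^bsub>F\<^esub> d" by simp
qed

lemma tensor_rels_closed: "tensor_rels G \<Lambda> l \<subseteq> carrier F"
  unfolding tensor_rels_def
  by (auto intro!: F_diff(1) simp: frag_of_in_F I_add I_mult simp del: F_simps(1))

lemma subgroup_N: "subgroup N F"
  unfolding tensor_subgroup_def
  by (rule group.generate_is_subgroup[OF comm_group.axioms(2)[OF comm_group_F] tensor_rels_closed])

lemma normal_N: "N \<lhd> F"
  using comm_group.normal_iff_subgroup[OF comm_group_F] subgroup_N by blast

lemma comm_group_T: "comm_group T"
  unfolding tensor_group_def by (rule comm_group.abelian_FactGroup[OF comm_group_F subgroup_N])

lemma group_hom_coset: "group_hom F T (\<lambda>c. r_coset F N c)"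
  unfolding tensor_group_def
  by (intro group_homI normal.r_coset_hom_Mod[OF normal_N] normal.factorgroup_is_group[OF normal_N]
      comm_group.axioms(2)[OF comm_group_F])

lemma tens_closed [simp]: "x \<in> I \<Longrightarrow> a \<in> carrier \<Lambda> \<Longrightarrow> tens x a \<in> carrier T"
  unfolding tensor_def using group_hom.hom_closed[OF group_hom_coset, of "frag_of (x, a)"] by simp

lemma coset_eqI:
  assumes "c \<in> carrier F" "d \<in> carrier F" "c - d \<in> N"
  shows "r_coset F N c = r_coset F N d"
proof (rule group.repr_independence[OF comm_group.axioms(2)[OF comm_group_F] _ _ subgroup_N, symmetric])
  show "c \<in> r_coset F N d"
    using assms(3) by (auto simp: r_coset_def intro!: bexI[of _ "c - d"])
qed (rule assms)

lemma coset_add: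
  "c \<in> carrier F \<Longrightarrow> d \<in> carrier F \<Longrightarrow> r_coset F N (c + d) = r_coset F N c \<otimes>\<^bsub>T\<^esub> r_coset F N d"
  using group_hom.hom_mult[OF group_hom_coset, of c d] by simp

lemma N_incl: "c \<in> tensor_rels G \<Lambda> l \<Longrightarrow> c \<in> N"
  unfolding tensor_subgroup_def by (rule generate.incl)

lemma tens_add_left:
  assumes "x \<in> I" "y \<in> I" "a \<in> carrier \<Lambda>"
  shows "tens (x + y) a = tens x a \<otimes>\<^bsub>T\<^esub> tens y a"
proof -
  have c: "frag_of (x, a) \<in> carrier F" "frag_of (y, a) \<in> carrier F" "frag_of (x + y, a) \<in> carrier F"
    using assms by (simp_all add: I_add)
  have "frag_of (x + y, a) - frag_of (x, a) - frag_of (y, a) \<in> N"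
    by (rule N_incl) (use assms in \<open>auto simp: tensor_rels_def\<close>)
  then have "r_coset F N (frag_of (x + y, a)) = r_coset F N (frag_of (x, a) + frag_of (y, a))"
    by (intro coset_eqI c F_add) (simp add: diff_diff_eq)
  then show ?thesis unfolding tensor_def using coset_add[OF c(1,2)] by simp
qed

lemma tens_add_right:
  assumes "x \<in> I" "a \<in> carrier \<Lambda>" "b \<in> carrier \<Lambda>"
  shows "tens x (a \<oplus> b) = tens x a \<otimes>\<^bsub>T\<^esub> tens x b"
proof -
  have c: "frag_of (x, a) \<in> carrier F" "frag_of (x, b) \<in> carrier F" "frag_of (x, a \<oplus> b) \<in> carrier F"
    using assms by simp_all
  have "frag_of (x, a \<oplus> b) - frag_of (x, a) - frag_of (x, b) \<in> N"
    by (rule N_incl) (use assms in \<open>auto simp: tensor_rels_def\<close>)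
  then have "r_coset F N (frag_of (x, a \<oplus> b)) = r_coset F N (frag_of (x, a) + frag_of (x, b))"
    by (intro coset_eqI c F_add) (simp add: diff_diff_eq)
  then show ?thesis unfolding tensor_def using coset_add[OF c(1,2)] by simp
qed

lemma tens_balanced:
  assumes "x \<in> I" "Poly_Mapping.keys z \<subseteq> carrier G" "a \<in> carrier \<Lambda>"
  shows "tens (x \<otimes>\<^bsub>group_ring G\<^esub> z) a = tens x (l z \<otimes> a)"
  unfolding tensor_def
proof (rule coset_eqI)
  show "frag_of (x \<otimes>\<^bsub>group_ring G\<^esub> z, a) - frag_of (x, l z \<otimes> a) \<in> N"
    by (rule N_incl) (use assms in \<open>auto simp: tensor_rels_def\<close>)
qed (use assms in \<open>simp_all add: I_mult\<close>)

text \<open>Pure tensors generate: each element is the coset of a formal sum, which is built from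
  basis elements by differences.\<close>

lemma T_hom_eq:
  assumes B: "group B" and h: "h \<in> hom T B" "h' \<in> hom T B"
    and eq: "\<And>x a. x \<in> I \<Longrightarrow> a \<in> carrier \<Lambda> \<Longrightarrow> h (tens x a) = h' (tens x a)"
    and t: "t \<in> carrier T"
  shows "h t = h' t"
proof -
  interpret q: group_hom F T "\<lambda>c. r_coset F N c" by (rule group_hom_coset)
  interpret h: group_hom T B h by (rule group_homI[OF q.H.is_group B h(1)])
  interpret h': group_hom T B h' by (rule group_homI[OF q.H.is_group B h(2)])
  obtain c where c: "c \<in> carrier F" "t = r_coset F N c"
    using t by (auto simp: tensor_group_def carrier_FactGroup simp del: F_simps)
  have "Poly_Mapping.keys c \<subseteq> I \<times> carrier \<Lambda>" using c by simp
  then have "c \<in> carrier F \<and> h (r_coset F N c) = h' (r_coset F N c)"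
  proof (induction c rule: frag_induction)
    case zero
    then show ?case using q.hom_one by simp
  next
    case (one p)
    then show ?case using eq by (cases p) (auto simp: tensor_def)
  next
    case (diff a b)
    then have ab: "a \<in> carrier F" "b \<in> carrier F" by blast+
    have "h (r_coset F N (a \<otimes>\<^bsub>F\<^esub> inv\<^bsub>F\<^esub> b)) = h' (r_coset F N (a \<otimes>\<^bsub>F\<^esub> inv\<^bsub>F\<^esub> b))"
      using diff ab by (simp only: q.hom_mult q.hom_inv q.G.inv_closed h.hom_mult h'.hom_mult h.hom_inv
          h'.hom_inv q.hom_closed q.H.inv_closed)
    then show ?case using F_diff[OF ab] by (simp only:)
  qed
  then show ?thesis using c by simp
qed

text \<open>The universal property of the tensor product. Extended to the free abelian group, a
  biadditive balanced map sends all defining relators to the unit, hence the subgroup they generate,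
  and so it factors through the quotient.\<close>

lemma T_lift:
  assumes B: "comm_group B" and f: "\<And>x a. x \<in> I \<Longrightarrow> a \<in> carrier \<Lambda> \<Longrightarrow> f x a \<in> carrier B"
    and left: "\<And>x y a. \<lbrakk>x \<in> I; y \<in> I; a \<in> carrier \<Lambda>\<rbrakk> \<Longrightarrow> f (x + y) a = f x a \<otimes>\<^bsub>B\<^esub> f y a"
    and right: "\<And>x a b. \<lbrakk>x \<in> I; a \<in> carrier \<Lambda>; b \<in> carrier \<Lambda>\<rbrakk> \<Longrightarrow> f x (a \<oplus> b) = f x a \<otimes>\<^bsub>B\<^esub> f x b"
    and bal: "\<And>x z a. \<lbrakk>x \<in> I; Poly_Mapping.keys z \<subseteq> carrier G; a \<in> carrier \<Lambda>\<rbrakk> \<Longrightarrow>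
      f (x \<otimes>\<^bsub>group_ring G\<^esub> z) a = f x (l z \<otimes> a)"
  obtains h where "h \<in> hom T B" "\<And>x a. x \<in> I \<Longrightarrow> a \<in> carrier \<Lambda> \<Longrightarrow> h (tens x a) = f x a"
proof -
  interpret B: comm_group B by fact
  have "(\<lambda>(x, a). f x a) ` (I \<times> carrier \<Lambda>) \<subseteq> carrier B" using f by auto
  then obtain k where k: "k \<in> hom F B" "\<And>p. p \<in> I \<times> carrier \<Lambda> \<Longrightarrow> k (frag_of p) = (\<lambda>(x, a). f x a) p"
    unfolding tensor_free_def using B.free_Abelian_group_universal by blast
  interpret k: group_hom F B k
    by (rule group_homI[OF comm_group.axioms(2)[OF comm_group_F] B.is_group k(1)])
  have kf: "k (frag_of (x, a)) = f x a" if "x \<in> I" "a \<in> carrier \<Lambda>" for x a using k(2) that by simp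
  have kd: "k (c - d) = k c \<otimes>\<^bsub>B\<^esub> inv\<^bsub>B\<^esub> k d \<and> c - d \<in> carrier F" if "c \<in> carrier F" "d \<in> carrier F" for c d
    using F_diff[OF that] that by (simp only: k.hom_mult k.hom_inv k.G.inv_closed)
  \<comment> \<open>The value of a biadditivity relator, f(x + y) - f(x) - f(y) in additive
    notation, takes this form once the sum is expanded.\<close>
  have cancel: "u \<otimes>\<^bsub>B\<^esub> v \<otimes>\<^bsub>B\<^esub> inv\<^bsub>B\<^esub> u \<otimes>\<^bsub>B\<^esub> inv\<^bsub>B\<^esub> v = \<one>\<^bsub>B\<^esub>"
    if "u \<in> carrier B" "v \<in> carrier B" for u v
  proof -
    have "u \<otimes>\<^bsub>B\<^esub> v \<otimes>\<^bsub>B\<^esub> inv\<^bsub>B\<^esub> u \<otimes>\<^bsub>B\<^esub> inv\<^bsub>B\<^esub> v = (u \<otimes>\<^bsub>B\<^esub> inv\<^bsub>B\<^esub> u) \<otimes>\<^bsub>B\<^esub> (v \<otimes>\<^bsub>B\<^esub> inv\<^bsub>B\<^esub> v)"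
      using that by (simp only: B.m_ac B.inv_closed B.m_closed)
    then show ?thesis using that by simp
  qed
  have "tensor_rels G \<Lambda> l \<subseteq> kernel F B k"
  proof
    fix c assume c: "c \<in> tensor_rels G \<Lambda> l"
    then have cF: "c \<in> carrier F" using tensor_rels_closed by blast
    have "k c = \<one>\<^bsub>B\<^esub>"
      using c unfolding tensor_rels_def
    proof (elim UnE CollectE exE conjE)
      fix x y a assume c: "c = frag_of (x + y, a) - frag_of (x, a) - frag_of (y, a)"
        and xya: "x \<in> I" "y \<in> I" "a \<in> carrier \<Lambda>"
      have "frag_of (x + y, a) \<in> carrier F" "frag_of (x, a) \<in> carrier F" "frag_of (y, a) \<in> carrier F"
        using xya by (simp_all add: I_add)
      then have "k c = f (x + y) a \<otimes>\<^bsub>B\<^esub> inv\<^bsub>B\<^esub> f x a \<otimes>\<^bsub>B\<^esub> inv\<^bsub>B\<^esub> f y a"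
        using xya by (simp only: c kd kf I_add)
      then show ?thesis using cancel f left xya by simp
    next
      fix x a b assume c: "c = frag_of (x, a \<oplus> b) - frag_of (x, a) - frag_of (x, b)"
        and xab: "x \<in> I" "a \<in> carrier \<Lambda>" "b \<in> carrier \<Lambda>"
      have "frag_of (x, a \<oplus> b) \<in> carrier F" "frag_of (x, a) \<in> carrier F" "frag_of (x, b) \<in> carrier F"
        using xab by simp_all
      then have "k c = f x (a \<oplus> b) \<otimes>\<^bsub>B\<^esub> inv\<^bsub>B\<^esub> f x a \<otimes>\<^bsub>B\<^esub> inv\<^bsub>B\<^esub> f x b"
        using xab by (simp only: c kd kf R.a_closed)
      then show ?thesis using cancel f right xab by simp
    next
      fix x z a assume c: "c = frag_of (x \<otimes>\<^bsub>group_ring G\<^esub> z, a) - frag_of (x, l z \<otimes> a)"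
        and xza: "x \<in> I" "z \<in> carrier (group_ring G)" "a \<in> carrier \<Lambda>"
      have z: "Poly_Mapping.keys z \<subseteq> carrier G" using xza by simp
      have "frag_of (x \<otimes>\<^bsub>group_ring G\<^esub> z, a) \<in> carrier F" "frag_of (x, l z \<otimes> a) \<in> carrier F"
        using xza z by (simp_all add: I_mult)
      then have "k c = f (x \<otimes>\<^bsub>group_ring G\<^esub> z) a \<otimes>\<^bsub>B\<^esub> inv\<^bsub>B\<^esub> f x (l z \<otimes> a)"
        using xza z by (simp only: c kd kf I_mult R.m_closed l_closed)
      then show ?thesis using f bal xza z by simp
    qed
    then show "c \<in> kernel F B k" using cF by (simp add: kernel_def)
  qed
  then have "N \<subseteq> kernel F B k"
    unfolding tensor_subgroup_def by (rule k.G.generate_subgroup_incl) (rule k.subgroup_kernel)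
  then obtain h where h: "h \<in> hom (F Mod N) B" "\<And>c. c \<in> carrier F \<Longrightarrow> h (r_coset F N c) = k c"
    using k.FactGroup_universal_kernel[OF normal_N] by blast
  show thesis
  proof (rule that[of h])
    show "h \<in> hom T B" using h(1) by (simp add: tensor_group_def)
    show "h (tens x a) = f x a" if "x \<in> I" "a \<in> carrier \<Lambda>" for x a
      unfolding tensor_def using h(2)[of "frag_of (x, a)"] that kf by simp
  qed
qed

text \<open>For each scalar \<open>r\<close>, sending x \<otimes> a to x \<otimes> ar is balanced
  and so defines an endomorphism of the tensor product. The module axioms are equations between
  homomorphisms and are checked on pure tensors.\<close>

lemma T_right_module:
  obtains act where "right_module \<Lambda> T act"
    "\<And>x a r. \<lbrakk>x \<in> I; a \<in> carrier \<Lambda>; r \<in> carrier \<Lambda>\<rbrakk> \<Longrightarrow> act (tens x a) r = tens x (a \<otimes> r)"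
proof -
  interpret T: comm_group T by (rule comm_group_T)
  have "\<exists>h. h \<in> hom T T \<and> (\<forall>x\<in>I. \<forall>a\<in>carrier \<Lambda>. h (tens x a) = tens x (a \<otimes> r))"
    if r: "r \<in> carrier \<Lambda>" for r
  proof -
    obtain h where "h \<in> hom T T" "\<And>x a. x \<in> I \<Longrightarrow> a \<in> carrier \<Lambda> \<Longrightarrow> h (tens x a) = tens x (a \<otimes> r)"
      by (rule T_lift[OF comm_group_T, of "\<lambda>x a. tens x (a \<otimes> r)"])
        (use r in \<open>auto simp: tens_add_left tens_add_right tens_balanced R.l_distr R.m_assoc\<close>)
    then show ?thesis by blast
  qed
  then obtain H where H: "\<And>r. r \<in> carrier \<Lambda> \<Longrightarrow> H r \<in> hom T T"
    "\<And>r x a. r \<in> carrier \<Lambda> \<Longrightarrow> x \<in> I \<Longrightarrow> a \<in> carrier \<Lambda> \<Longrightarrow> H r (tens x a) = tens x (a \<otimes> r)"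
    by metis
  have Hc: "H r t \<in> carrier T" if "r \<in> carrier \<Lambda>" "t \<in> carrier T" for r t
    using hom_in_carrier[OF H(1)[OF that(1)] that(2)] .
  show thesis
  proof (rule that[of "\<lambda>t r. H r t"])
    show "right_module \<Lambda> T (\<lambda>t r. H r t)"
    proof (intro right_module.intro right_module_axioms.intro R.ring_axioms comm_group_T)
      fix t r assume t: "t \<in> carrier T" and r: "r \<in> carrier \<Lambda>"
      show "H r t \<in> carrier T" by (rule Hc[OF r t])
      fix s assume s: "s \<in> carrier \<Lambda>"
      have hom: "(\<lambda>t. H r t \<otimes>\<^bsub>T\<^esub> H s t) \<in> hom T T"
        by (rule homI) (use r s Hc hom_mult[OF H(1)] in \<open>auto simp: T.m_ac\<close>)
      show "H (r \<oplus> s) t = H r t \<otimes>\<^bsub>T\<^esub> H s t"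
        by (rule T_hom_eq[OF T.is_group H(1) hom _ t])
          (use r s H in \<open>auto simp: R.r_distr tens_add_right\<close>)
      have hom: "(\<lambda>t. H s (H r t)) \<in> hom T T"
        by (rule homI) (use r s Hc hom_mult[OF H(1)] in auto)
      show "H s (H r t) = H (r \<otimes> s) t"
        by (rule T_hom_eq[OF T.is_group hom H(1) _ t])
          (use r s H in \<open>auto simp: R.m_assoc\<close>)
    next
      fix t u r assume "t \<in> carrier T" "u \<in> carrier T" "r \<in> carrier \<Lambda>"
      then show "H r (t \<otimes>\<^bsub>T\<^esub> u) = H r t \<otimes>\<^bsub>T\<^esub> H r u" using hom_mult[OF H(1)] by blast
    next
      fix t assume t: "t \<in> carrier T"
      have hom: "(\<lambda>t. t) \<in> hom T T" by (rule homI) auto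
      show "H \<one> t = t"
        by (rule T_hom_eq[OF T.is_group H(1) hom _ t]) (use H in auto)
    qed
  qed (rule H(2))
qed

text \<open>If every group element has value \<open>c\<close>, then \<open>x\<close> has value
  \<open>c\<close> to the power of its augmentation. It serves to show that a defect that is
  constant on group elements vanishes on the augmentation ideal.\<close>

lemma hom_const_on_ideal:
  assumes B: "group B" and h: "h \<in> hom (free_Abelian_group (carrier G)) B" and c: "c \<in> carrier B"
    and hc: "\<And>g. g \<in> carrier G \<Longrightarrow> h (frag_of g) = c" and x: "x \<in> I"
  shows "h x = \<one>\<^bsub>B\<^esub>"
proof -
  interpret h: group_hom "free_Abelian_group (carrier G)" B h
    by (rule group_homI[OF group_free_Abelian_group B h])
  have "Poly_Mapping.keys x \<subseteq> carrier G" using x by (simp add: in_I)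
  then have "Poly_Mapping.keys x \<subseteq> carrier G \<and> h x = c [^]\<^bsub>B\<^esub> augmentation x"
  proof (induction x rule: frag_induction)
    case zero
    then show ?case using h.hom_one by simp
  next
    case (one g)
    then show ?case using hc c by simp
  next
    case (diff a b)
    have "h (a - b) = h a \<otimes>\<^bsub>B\<^esub> inv\<^bsub>B\<^esub> h b"
      using diff h.hom_mult[of a "- b"] h.hom_inv[of b] by simp
    moreover have "Poly_Mapping.keys (a - b) \<subseteq> carrier G" using diff keys_diff[of a b] by blast
    ultimately show ?case using diff c by (simp add: h.H.int_pow_diff)
  qed
  then show ?thesis using x by (simp add: in_I)
qed

text \<open>The identity (gh)^-1 - 1 = (h^-1 - 1) g^-1 + (g^-1 - 1) is the source of the product
  rule for derivations used throughout, with its twist by g^-1 on the right.\<close>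

lemma inv_minus_one_mult:
  "\<lbrakk>g \<in> carrier G; h \<in> carrier G\<rbrakk> \<Longrightarrow> inv_minus_one G (g \<otimes>\<^bsub>G\<^esub> h)
    = inv_minus_one G h \<otimes>\<^bsub>group_ring G\<^esub> frag_of (inv\<^bsub>G\<^esub> g) + inv_minus_one G g"
  by (simp add: inv_minus_one_def group_ring_mult_diff_left G.inv_mult_group)

end

lemma (in group_hom) hom_finprod:
  assumes "comm_group G" "comm_group H" "finite S" "f \<in> S \<rightarrow> carrier G"
  shows "h (finprod G f S) = (\<Otimes>\<^bsub>H\<^esub>i\<in>S. h (f i))"
proof -
  interpret CG: comm_group G by fact
  interpret CH: comm_group H by fact
  show ?thesis
    using assms(3,4)
  proof (induction S rule: finite_induct)
    case (insert i S)
    have "(\<lambda>i. h (f i)) \<in> S \<rightarrow> carrier H" using insert by (auto simp: Pi_iff)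
    then show ?case using insert by (simp add: Pi_iff)
  qed simp
qed

section \<open>The crossed homomorphism\<close>

locale magnus_setup = free_acyclic_closure n G \<iota> + cohn_localization G \<Lambda> l
  for n :: nat and G :: "'u monoid" and \<iota> and \<Lambda> :: "'u ring" (structure)
    and l :: "('u \<Rightarrow>\<^sub>0 int) \<Rightarrow> 'u" +
  assumes inf: "infinite (UNIV :: 'u set)"

sublocale magnus_setup \<subseteq> magnus_tensor G \<Lambda> l by unfold_locales

sublocale magnus_setup \<subseteq> L: group_ring_module G \<Lambda> l "add_monoid \<Lambda>" "\<lambda>a r. a \<otimes> r"
proof (intro group_ring_module.intro group_ring_hom_axioms right_module.intro R.ring_axioms R.a_comm_group
    right_module_axioms.intro)
qed (auto simp: R.l_distr R.r_distr R.m_assoc)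

context magnus_setup
begin

lemma group_add_\<Lambda>: "group (add_monoid \<Lambda>)" and comm_monoid_add_\<Lambda>: "comm_monoid (add_monoid \<Lambda>)"
  using R.a_comm_group by (auto dest: comm_group.axioms)

text \<open>Derivations into the localization as a right module over itself, restated in ring
  notation instead of that of \<open>add_monoid\<close>.\<close>

definition fox_like :: "('u \<Rightarrow> 'u) \<Rightarrow> ('u \<Rightarrow> 'u) \<Rightarrow> bool"
  where "fox_like \<phi> D \<longleftrightarrow> D \<in> carrier G \<rightarrow> carrier \<Lambda> \<and>
    (\<forall>g\<in>carrier G. \<forall>h\<in>carrier G. D (g \<otimes>\<^bsub>G\<^esub> h) = D g \<oplus> D h \<otimes> l (frag_of (inv\<^bsub>G\<^esub> (\<phi> g))))"

lemma fox_like_eq_derivation: "fox_like = L.derivation"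
  by (intro ext) (simp only: fox_like_def L.derivation_def monoid.select_convs partial_object.select_convs)

lemma closure_module_\<Lambda>: "\<exists>j. closure_module n G \<iota> \<Lambda> l (add_monoid \<Lambda>) (\<lambda>a r. a \<otimes> r) j"
proof -
  obtain j :: "'u \<times> 'u \<Rightarrow> 'u" where "inj j" by (rule inj_pair[OF inf])
  then have "inj_on j (carrier (add_monoid \<Lambda>) \<times> carrier G)" by (rule inj_on_subset) simp
  then show ?thesis
    by (intro exI[of _ j] closure_module.intro free_acyclic_closure_axioms L.group_ring_module_axioms
        closure_module_axioms.intro inverting_l)
qed

lemma fox_like_unique:
  assumes "\<phi> \<in> hom G G" "fox_like \<phi> D" "fox_like \<phi> D'"
    "\<And>i. i < n \<Longrightarrow> D (gen i) = D' (gen i)" "g \<in> carrier G"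
  shows "D g = D' g"
proof -
  obtain j where "closure_module n G \<iota> \<Lambda> l (add_monoid \<Lambda>) (\<lambda>a r. a \<otimes> r) j"
    using closure_module_\<Lambda> by blast
  then show ?thesis
    using assms unfolding fox_like_eq_derivation by (rule closure_module.derivation_unique)
qed

lemma fox_exists:
  "\<exists>D. fox_like (\<lambda>g. g) D \<and> (\<forall>j<n. D (gen j) = (if i = j then \<one> else \<zero>))"
proof -
  obtain j where "closure_module n G \<iota> \<Lambda> l (add_monoid \<Lambda>) (\<lambda>a r. a \<otimes> r) j"
    using closure_module_\<Lambda> by blast
  moreover have "(\<lambda>j. if i = j then \<one> else \<zero>) \<in> {..<n} \<rightarrow> carrier (add_monoid \<Lambda>)" by simp
  ultimately obtain D where "L.derivation (\<lambda>g. g) D"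
    "\<And>k. k < n \<Longrightarrow> D (gen k) = (if i = k then \<one> else \<zero>)"
    by (rule closure_module.derivation_exists) blast
  then show ?thesis unfolding fox_like_eq_derivation by blast
qed

text \<open>The derivation dual to the i-th generator. It is the bar of the Fox derivative: its
  product rule multiplies on the right by the inverse of \<open>g\<close>, where Fox's rule
  multiplies on the left by \<open>g\<close>.\<close>

definition fox :: "nat \<Rightarrow> 'u \<Rightarrow> 'u"
  where "fox i = (SOME D. fox_like (\<lambda>g. g) D \<and> (\<forall>j<n. D (gen j) = (if i = j then \<one> else \<zero>)))"

lemma fox:
  shows fox_derivation: "fox_like (\<lambda>g. g) (fox i)"
    and fox_gen: "j < n \<Longrightarrow> fox i (gen j) = (if i = j then \<one> else \<zero>)"
  using someI_ex[OF fox_exists[of i]] unfolding fox_def by blast+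

lemma fox_closed [simp]: "g \<in> carrier G \<Longrightarrow> fox i g \<in> carrier \<Lambda>"
  using fox_derivation[of i] by (auto simp: fox_like_def)

lemma fox_mult:
  "\<lbrakk>g \<in> carrier G; h \<in> carrier G\<rbrakk> \<Longrightarrow>
   fox i (g \<otimes>\<^bsub>G\<^esub> h) = fox i g \<oplus> fox i h \<otimes> l (frag_of (inv\<^bsub>G\<^esub> g))"
  using fox_derivation[of i] by (simp add: fox_like_def)

lemma fox_one: "fox i \<one>\<^bsub>G\<^esub> = \<zero>"
  using fox_mult[of "\<one>\<^bsub>G\<^esub>" "\<one>\<^bsub>G\<^esub>" i] R.add.l_cancel_one'[of "fox i \<one>\<^bsub>G\<^esub>" "fox i \<one>\<^bsub>G\<^esub>"] by simp

text \<open>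
  Extending \<open>g \<mapsto> fox i (g\<^sup>-\<^sup>1)\<close> additively to the group ring gives a map that is right linear
  on the augmentation ideal; this yields the coordinates on the tensor product.
\<close>

lemma coordinate_exists:
  "\<exists>h. h \<in> hom T (add_monoid \<Lambda>) \<and>
    (\<forall>g\<in>carrier G. \<forall>a\<in>carrier \<Lambda>. h (tens (inv_minus_one G g) a) = fox i g \<otimes> a)"
proof -
  let ?FG = "free_Abelian_group (carrier G)"
  have "(\<lambda>g. fox i (inv\<^bsub>G\<^esub> g)) ` carrier G \<subseteq> carrier (add_monoid \<Lambda>)" by auto
  then obtain E where E: "E \<in> hom ?FG (add_monoid \<Lambda>)"
    "\<And>g. g \<in> carrier G \<Longrightarrow> E (frag_of g) = fox i (inv\<^bsub>G\<^esub> g)"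
    using comm_group.free_Abelian_group_universal[OF R.a_comm_group] by blast
  interpret E: group_hom ?FG "add_monoid \<Lambda>" E
    by (rule group_homI[OF group_free_Abelian_group group_add_\<Lambda> E(1)])
  have Ec: "E x \<in> carrier \<Lambda>" if "Poly_Mapping.keys x \<subseteq> carrier G" for x
    using E.hom_closed[of x] that by simp
  have Eadd: "E (x + y) = E x \<oplus> E y"
    if "Poly_Mapping.keys x \<subseteq> carrier G" "Poly_Mapping.keys y \<subseteq> carrier G" for x y
    using E.hom_mult[of x y] that by simp
  have E0: "E 0 = \<zero>" using E.hom_one by simp
  have Eminus: "E (- x) = \<ominus> E x" if "Poly_Mapping.keys x \<subseteq> carrier G" for x
    using E.hom_inv[of x] that by (simp add: a_inv_def)
  have Ediff: "E (x - y) = E x \<ominus> E y"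
    if "Poly_Mapping.keys x \<subseteq> carrier G" "Poly_Mapping.keys y \<subseteq> carrier G" for x y
    using Eadd[of x "- y"] Eminus[of y] that by (simp add: R.minus_eq)
  have Eh: "E (x \<otimes>\<^bsub>group_ring G\<^esub> frag_of h) = E x \<otimes> l (frag_of h)" if x: "x \<in> I" and h: "h \<in> carrier G" for x h
  proof -
    have kh: "Poly_Mapping.keys (frag_of h) \<subseteq> carrier G" using h by simp
    note km = keys_group_ring_mult[OF G.is_group _ kh]
    \<comment> \<open>The failure of right linearity. On a group element \<open>g\<close> the
      product rule gives E(gh) = fox(h^-1) + E(g) l(h), so the defect fox(h^-1) does not depend on
      \<open>g\<close> and vanishes on elements of augmentation zero.\<close>
    let ?D = "\<lambda>x. E (x \<otimes>\<^bsub>group_ring G\<^esub> frag_of h) \<ominus> E x \<otimes> l (frag_of h)"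
    have add: "(x + y) \<otimes>\<^bsub>group_ring G\<^esub> frag_of h = x \<otimes>\<^bsub>group_ring G\<^esub> frag_of h + y \<otimes>\<^bsub>group_ring G\<^esub> frag_of h" for x y
      by (simp add: group_ring_mult frag_extend_add)
    have "?D \<in> hom ?FG (add_monoid \<Lambda>)"
    proof (rule homI)
      fix x y assume xy: "x \<in> carrier ?FG" "y \<in> carrier ?FG"
      then have kx: "Poly_Mapping.keys x \<subseteq> carrier G" "Poly_Mapping.keys y \<subseteq> carrier G" by simp_all
      have c: "E x \<in> carrier \<Lambda>" "E y \<in> carrier \<Lambda>" "E (x \<otimes>\<^bsub>group_ring G\<^esub> frag_of h) \<in> carrier \<Lambda>"
        "E (y \<otimes>\<^bsub>group_ring G\<^esub> frag_of h) \<in> carrier \<Lambda>" "l (frag_of h) \<in> carrier \<Lambda>"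
        by (rule Ec[OF kx(1)], rule Ec[OF kx(2)], rule Ec[OF km[OF kx(1)]], rule Ec[OF km[OF kx(2)]],
          rule l_closed[OF kh])
      show "?D x \<in> carrier (add_monoid \<Lambda>)" using c by simp
      have "?D (x + y) = (E (x \<otimes>\<^bsub>group_ring G\<^esub> frag_of h) \<oplus> E (y \<otimes>\<^bsub>group_ring G\<^esub> frag_of h))
          \<ominus> (E x \<oplus> E y) \<otimes> l (frag_of h)"
        using Eadd[OF kx] Eadd[OF km[OF kx(1)] km[OF kx(2)]] by (simp add: add)
      also have "\<dots> = ?D x \<oplus> ?D y"
        using c by (simp add: R.minus_eq R.l_distr R.minus_add R.a_ac)
      finally show "?D (x \<otimes>\<^bsub>?FG\<^esub> y) = ?D x \<otimes>\<^bsub>add_monoid \<Lambda>\<^esub> ?D y" by simp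
    qed
    moreover have "?D (frag_of g) = fox i (inv\<^bsub>G\<^esub> h)" if g: "g \<in> carrier G" for g
    proof -
      have "E (frag_of g \<otimes>\<^bsub>group_ring G\<^esub> frag_of h) = fox i (inv\<^bsub>G\<^esub> h) \<oplus> fox i (inv\<^bsub>G\<^esub> g) \<otimes> l (frag_of h)"
        using g h by (simp add: E(2) G.inv_mult_group fox_mult)
      then show ?thesis using g h by (simp add: E(2) R.minus_eq R.a_assoc R.r_neg)
    qed
    moreover have "fox i (inv\<^bsub>G\<^esub> h) \<in> carrier (add_monoid \<Lambda>)" using h by simp
    ultimately have "?D x = \<one>\<^bsub>add_monoid \<Lambda>\<^esub>"
      using x by (intro hom_const_on_ideal[OF group_add_\<Lambda>])
    moreover have "E (x \<otimes>\<^bsub>group_ring G\<^esub> frag_of h) \<in> carrier \<Lambda>" "E x \<otimes> l (frag_of h) \<in> carrier \<Lambda>"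
      using x h km by (auto simp: in_I intro!: Ec R.m_closed)
    ultimately show ?thesis by (simp add: R.r_right_minus_eq)
  qed
  have Ez: "E (x \<otimes>\<^bsub>group_ring G\<^esub> z) = E x \<otimes> l z" if x: "x \<in> I" and z: "Poly_Mapping.keys z \<subseteq> carrier G" for x z
  proof -
    have kx: "Poly_Mapping.keys x \<subseteq> carrier G" using x by (simp add: in_I)
    note km = keys_group_ring_mult[OF G.is_group kx]
    have "Poly_Mapping.keys z \<subseteq> carrier G \<and> E (x \<otimes>\<^bsub>group_ring G\<^esub> z) = E x \<otimes> l z"
      using z
    proof (induction z rule: frag_induction)
      case zero
      then show ?case using Ec[OF kx] by (simp add: E0)
    next
      case (one g)
      then show ?case using Eh[OF x] by simp
    next
      case (diff a b)
      then have ka: "Poly_Mapping.keys a \<subseteq> carrier G" and kb: "Poly_Mapping.keys b \<subseteq> carrier G" by blast+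
      have "E (x \<otimes>\<^bsub>group_ring G\<^esub> (a - b)) = E x \<otimes> l a \<ominus> E x \<otimes> l b"
        using diff Ediff[OF km[OF ka] km[OF kb]] by (simp add: group_ring_mult_diff_right)
      also have "\<dots> = E x \<otimes> l (a - b)"
        using Ec[OF kx] l_closed[OF ka] l_closed[OF kb] l_diff[OF ka kb]
        by (simp add: R.minus_eq R.r_distr R.r_minus)
      finally show ?case using ka kb keys_diff[of a b] by blast
    qed
    then show ?thesis by blast
  qed
  have Ix: "Poly_Mapping.keys x \<subseteq> carrier G" if "x \<in> I" for x using that by (simp add: in_I)
  obtain h where h: "h \<in> hom T (add_monoid \<Lambda>)" "\<And>x a. x \<in> I \<Longrightarrow> a \<in> carrier \<Lambda> \<Longrightarrow> h (tens x a) = E x \<otimes> a"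
    by (rule T_lift[OF R.a_comm_group, of "\<lambda>x a. E x \<otimes> a"])
      (use Ec Ix Eadd Ez in \<open>simp_all add: R.l_distr R.r_distr R.m_assoc\<close>)
  \<comment> \<open>The two inverses cancel: E(g^-1) is \<open>fox i g\<close>, and E(1) is zero
    because derivations vanish at the unit.\<close>
  have "E (inv_minus_one G g) = fox i g" if "g \<in> carrier G" for g
    unfolding inv_minus_one_def using that by (simp add: Ediff E(2) fox_one R.minus_eq)
  then show ?thesis using h inv_minus_one_in_I by auto
qed

lemma magnus_v_closed:
  "a \<in> {..<n} \<rightarrow> carrier \<Lambda> \<Longrightarrow> magnus_v n G gen \<Lambda> l a \<in> carrier T"
  unfolding magnus_v_def
  by (rule comm_monoid.finprod_closed[OF comm_group.axioms(1)[OF comm_group_T]])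
    (auto simp: Pi_iff inv_minus_one_in_I)

text \<open>Since \<open>fox i\<close> takes the value 1 on the i-th generator and 0 on the others,
  the coordinate map selects the i-th summand of v(a).\<close>

lemma coordinate_magnus_v:
  assumes h: "h \<in> hom T (add_monoid \<Lambda>)"
    "\<And>g a. g \<in> carrier G \<Longrightarrow> a \<in> carrier \<Lambda> \<Longrightarrow> h (tens (inv_minus_one G g) a) = fox i g \<otimes> a"
    and a: "a \<in> {..<n} \<rightarrow> carrier \<Lambda>" and i: "i < n"
  shows "h (magnus_v n G gen \<Lambda> l a) = a i"
proof -
  interpret T: comm_group T by (rule comm_group_T)
  interpret h: group_hom T "add_monoid \<Lambda>" h by (rule group_homI[OF T.is_group group_add_\<Lambda> h(1)])
  have "h (magnus_v n G gen \<Lambda> l a)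
      = (\<Otimes>\<^bsub>add_monoid \<Lambda>\<^esub>j\<in>{..<n}. h (tens (inv_minus_one G (gen j)) (a j)))"
    unfolding magnus_v_def
    by (rule h.hom_finprod[OF comm_group_T R.a_comm_group]) (use a inv_minus_one_in_I in \<open>auto simp: Pi_iff\<close>)
  also have "\<dots> = h (tens (inv_minus_one G (gen i)) (a i))"
    by (rule comm_monoid.finprod_delta[OF comm_monoid_add_\<Lambda>])
      (use a i in \<open>auto simp: h(2) fox_gen Pi_iff inv_minus_one_in_I\<close>)
  also have "\<dots> = a i" using a i by (simp add: h(2) fox_gen Pi_iff)
  finally show ?thesis .
qed

lemma inj_on_magnus_v: "inj_on (magnus_v n G gen \<Lambda> l) ({..<n} \<rightarrow>\<^sub>E carrier \<Lambda>)"
proof (rule inj_onI)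
  fix a b assume ab: "a \<in> {..<n} \<rightarrow>\<^sub>E carrier \<Lambda>" "b \<in> {..<n} \<rightarrow>\<^sub>E carrier \<Lambda>"
    and eq: "magnus_v n G gen \<Lambda> l a = magnus_v n G gen \<Lambda> l b"
  show "a = b"
  proof (rule extensionalityI[of _ "{..<n}"])
    fix i assume i: "i \<in> {..<n}"
    obtain h where h: "h \<in> hom T (add_monoid \<Lambda>)"
      "\<And>g a. g \<in> carrier G \<Longrightarrow> a \<in> carrier \<Lambda> \<Longrightarrow> h (tens (inv_minus_one G g) a) = fox i g \<otimes> a"
      using coordinate_exists[of i] by blast
    have c: "a \<in> {..<n} \<rightarrow> carrier \<Lambda>" "b \<in> {..<n} \<rightarrow> carrier \<Lambda>" "i < n" using ab i by auto
    show "a i = b i"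
      using coordinate_magnus_v[OF h c(1,3)] coordinate_magnus_v[OF h c(2,3)] eq by simp
  qed (use ab in \<open>auto simp: PiE_def\<close>)
qed

text \<open>This exhibits the preimage under v of the element at which the Fox derivatives read
  \<open>inv_into\<close>: its coordinates are the values \<open>fox i g\<close>.\<close>

lemma magnus_v_fox:
  assumes g: "g \<in> carrier G"
  shows "magnus_v n G gen \<Lambda> l (\<lambda>i. fox i g) = tens (inv_minus_one G g) \<one>"
proof -
  obtain act where act: "right_module \<Lambda> T act"
    "\<And>x a r. \<lbrakk>x \<in> I; a \<in> carrier \<Lambda>; r \<in> carrier \<Lambda>\<rbrakk> \<Longrightarrow> act (tens x a) r = tens x (a \<otimes> r)"
    by (rule T_right_module) blast
  interpret M: group_ring_module G \<Lambda> l T act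
    by (intro group_ring_module.intro group_ring_hom_axioms act)
  obtain j where cm: "closure_module n G \<iota> \<Lambda> l T act j"
  proof -
    \<comment> \<open>An injection of the tensor product into \<open>'u\<close> in stages: a coset
      goes to a representative, a formal sum of pairs; group ring elements are encoded in
      \<open>'u\<close>, then pairs, then formal sums of such pairs.\<close>
    obtain q :: "_ \<Rightarrow> (('u \<Rightarrow>\<^sub>0 int) \<times> 'u) \<Rightarrow>\<^sub>0 int" where q: "inj_on q (carrier T)"
      unfolding tensor_group_def by (rule inj_rcosets)
    obtain q1 :: "('u \<Rightarrow>\<^sub>0 int) \<Rightarrow> 'u" where q1: "inj q1" by (rule inj_frag[OF inf, of "\<lambda>x. x"]) auto
    have "inj (\<lambda>x :: 'u. x)" by simp
    with q1 obtain q2 :: "('u \<Rightarrow>\<^sub>0 int) \<times> 'u \<Rightarrow> 'u" where q2: "inj_on q2 (UNIV \<times> UNIV)"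
      by (rule inj_prod[OF inf])
    then have "inj q2" by simp
    then obtain q3 :: "((('u \<Rightarrow>\<^sub>0 int) \<times> 'u) \<Rightarrow>\<^sub>0 int) \<Rightarrow> 'u" where q3: "inj q3"
      by (rule inj_frag[OF inf])
    have "inj_on (\<lambda>t. q3 (q t)) (carrier T)"
      using q q3 by (auto simp: inj_on_def)
    moreover have "inj_on (\<lambda>x :: 'u. x) (carrier G)" by simp
    ultimately obtain j :: "_ \<times> 'u \<Rightarrow> 'u" where j: "inj_on j (carrier T \<times> carrier G)"
      by (rule inj_prod[OF inf])
    show thesis
      by (rule that[of j])
        (intro closure_module.intro free_acyclic_closure_axioms M.group_ring_module_axioms
          closure_module_axioms.intro inverting_l j)
  qed
  have id: "(\<lambda>g. g) \<in> hom G G" by (rule homI) auto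
  have d1: "M.derivation (\<lambda>g. g) (\<lambda>g. tens (inv_minus_one G g) \<one>)"
    unfolding M.derivation_def
  proof (intro conjI ballI)
    show "(\<lambda>g. tens (inv_minus_one G g) \<one>) \<in> carrier G \<rightarrow> carrier T"
      by (auto simp: inv_minus_one_in_I)
    fix g h assume gh: "g \<in> carrier G" "h \<in> carrier G"
    then have x: "inv_minus_one G g \<in> I" "inv_minus_one G h \<in> I" by (auto simp: inv_minus_one_in_I)
    have k: "Poly_Mapping.keys (frag_of (inv\<^bsub>G\<^esub> g)) \<subseteq> carrier G" using gh by simp
    have "tens (inv_minus_one G (g \<otimes>\<^bsub>G\<^esub> h)) \<one>
        = tens (inv_minus_one G h \<otimes>\<^bsub>group_ring G\<^esub> frag_of (inv\<^bsub>G\<^esub> g)) \<one> \<otimes>\<^bsub>T\<^esub> tens (inv_minus_one G g) \<one>"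
      unfolding inv_minus_one_mult[OF gh] by (rule tens_add_left) (use x k I_mult in auto)
    also have "tens (inv_minus_one G h \<otimes>\<^bsub>group_ring G\<^esub> frag_of (inv\<^bsub>G\<^esub> g)) \<one>
        = act (tens (inv_minus_one G h) \<one>) (l (frag_of (inv\<^bsub>G\<^esub> g)))"
      using tens_balanced[OF x(2) k] act(2)[OF x(2)] l_closed[OF k] by simp
    finally show "tens (inv_minus_one G (g \<otimes>\<^bsub>G\<^esub> h)) \<one> = tens (inv_minus_one G g) \<one> \<otimes>\<^bsub>T\<^esub>
        act (tens (inv_minus_one G h) \<one>) (l (frag_of (inv\<^bsub>G\<^esub> g)))"
      using x l_closed[OF k] by (simp add: M.A.m_comm)
  qed
  have d2: "M.derivation (\<lambda>g. g) (\<lambda>g. magnus_v n G gen \<Lambda> l (\<lambda>i. fox i g))"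
    unfolding M.derivation_def
  proof (intro conjI ballI)
    show "(\<lambda>g. magnus_v n G gen \<Lambda> l (\<lambda>i. fox i g)) \<in> carrier G \<rightarrow> carrier T"
      by (auto intro!: magnus_v_closed)
    fix g h assume gh: "g \<in> carrier G" "h \<in> carrier G"
    let ?r = "l (frag_of (inv\<^bsub>G\<^esub> g))"
    let ?t = "\<lambda>g i. tens (inv_minus_one G (gen i)) (fox i g)"
    have r: "?r \<in> carrier \<Lambda>" using gh by simp
    have x: "inv_minus_one G (gen i) \<in> I" if "i < n" for i using that by (simp add: inv_minus_one_in_I)
    have "magnus_v n G gen \<Lambda> l (\<lambda>i. fox i (g \<otimes>\<^bsub>G\<^esub> h))
        = (\<Otimes>\<^bsub>T\<^esub>i\<in>{..<n}. ?t g i \<otimes>\<^bsub>T\<^esub> act (?t h i) ?r)"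
      unfolding magnus_v_def
      by (rule M.A.finprod_cong')
        (use gh r x in \<open>auto simp: fox_mult tens_add_right act(2)\<close>)
    also have "\<dots> = (\<Otimes>\<^bsub>T\<^esub>i\<in>{..<n}. ?t g i) \<otimes>\<^bsub>T\<^esub> (\<Otimes>\<^bsub>T\<^esub>i\<in>{..<n}. act (?t h i) ?r)"
      by (rule M.A.finprod_multf) (use gh r x in auto)
    also have "(\<Otimes>\<^bsub>T\<^esub>i\<in>{..<n}. act (?t h i) ?r) = act (\<Otimes>\<^bsub>T\<^esub>i\<in>{..<n}. ?t h i) ?r"
      by (rule M.finprod_act[symmetric]) (use gh r x in auto)
    finally show "magnus_v n G gen \<Lambda> l (\<lambda>i. fox i (g \<otimes>\<^bsub>G\<^esub> h))
        = magnus_v n G gen \<Lambda> l (\<lambda>i. fox i g) \<otimes>\<^bsub>T\<^esub> act (magnus_v n G gen \<Lambda> l (\<lambda>i. fox i h)) ?r"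
      unfolding magnus_v_def .
  qed
  show ?thesis
  proof (rule closure_module.derivation_unique[OF cm id d2 d1 _ g])
    fix k assume k: "k < n"
    have x: "inv_minus_one G (gen i) \<in> I" if "i < n" for i using that by (simp add: inv_minus_one_in_I)
    \<comment> \<open>x \<otimes> 0 is the image of x \<otimes> 1 under the scalar zero, hence
      trivial. This removes all factors but the k-th one below.\<close>
    have zero: "tens (inv_minus_one G (gen i)) \<zero> = \<one>\<^bsub>T\<^esub>" if "i < n" for i
      using act(2)[OF x[OF that] R.one_closed R.zero_closed] x[OF that] by simp
    have "magnus_v n G gen \<Lambda> l (\<lambda>i. fox i (gen k)) = tens (inv_minus_one G (gen k)) (fox k (gen k))"
      unfolding magnus_v_def
      by (rule M.A.finprod_delta) (use k x zero in \<open>auto simp: fox_gen\<close>)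
    then show "magnus_v n G gen \<Lambda> l (\<lambda>i. fox i (gen k)) = tens (inv_minus_one G (gen k)) \<one>"
      using k by (simp add: fox_gen)
  qed
qed

lemma fox_derivative_eq:
  assumes g: "g \<in> carrier G" and i: "i < n"
  shows "fox_derivative n G gen \<Lambda> l g i = bar (fox i g)"
proof -
  \<comment> \<open>\<open>inv_into\<close> returns a member of the extensional function space, so
    the coordinates are cut off outside the index range before injectivity of v is used.\<close>
  let ?a = "\<lambda>i\<in>{..<n}. fox i g"
  have "magnus_v n G gen \<Lambda> l ?a = magnus_v n G gen \<Lambda> l (\<lambda>i. fox i g)"
    unfolding magnus_v_def
    by (rule comm_monoid.finprod_cong'[OF comm_group.axioms(1)[OF comm_group_T]])
      (use g in \<open>auto simp: inv_minus_one_in_I\<close>)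
  then have "magnus_v n G gen \<Lambda> l ?a = tens (inv_minus_one G g) \<one>" using magnus_v_fox[OF g] by simp
  moreover have "?a \<in> {..<n} \<rightarrow>\<^sub>E carrier \<Lambda>" using g by auto
  ultimately have "inv_into ({..<n} \<rightarrow>\<^sub>E carrier \<Lambda>) (magnus_v n G gen \<Lambda> l) (tens (inv_minus_one G g) \<one>) = ?a"
    using inv_into_f_eq[OF inj_on_magnus_v] by blast
  then show ?thesis using i by (simp add: fox_derivative_def)
qed

text \<open>The Fox derivative is \<open>bar\<close> of \<open>fox\<close>, and
  \<open>magnus_rep\<close> applies \<open>bar\<close> once more; the two cancel.\<close>

lemma magnus_rep_eq:
  assumes \<phi>: "\<phi> \<in> hom G G"
  shows "magnus_rep n G gen \<Lambda> l \<phi> = mat n n (\<lambda>(i, j). fox i (\<phi> (gen j)))"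
  unfolding magnus_rep_def
  by (rule eq_matI) (use hom_in_carrier[OF \<phi>] in \<open>auto simp: fox_derivative_eq bar_bar\<close>)

lemma fox_chain_rule:
  assumes \<phi>: "\<phi> \<in> hom G G" and g: "g \<in> carrier G"
  shows "fox i (\<phi> g) = (\<Oplus>k\<in>{..<n}. fox i (\<phi> (gen k)) \<otimes> localization_map G \<Lambda> l \<phi> (fox k g))"
proof -
  let ?L = "localization_map G \<Lambda> l \<phi>"
  have Lh: "?L \<in> Ring.ring_hom \<Lambda> \<Lambda>" by (rule localization_map_hom[OF \<phi>])
  note \<phi>c = hom_in_carrier[OF \<phi>]
  have Lc: "?L a \<in> carrier \<Lambda>" if "a \<in> carrier \<Lambda>" for a using ring_hom_closed[OF Lh that] .
  have L0: "?L \<zero> = \<zero>" by (rule ring_hom_zero[OF Lh ring_\<Lambda> ring_\<Lambda>])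
  show ?thesis
  proof (rule fox_like_unique[OF \<phi> _ _ _ g])
    show "fox_like \<phi> (\<lambda>g. fox i (\<phi> g))"
      using \<phi>c by (simp add: fox_like_def hom_mult[OF \<phi>] fox_mult)
    show "fox_like \<phi> (\<lambda>g. \<Oplus>k\<in>{..<n}. fox i (\<phi> (gen k)) \<otimes> ?L (fox k g))"
      unfolding fox_like_def
    proof (intro conjI ballI)
      show "(\<lambda>g. \<Oplus>k\<in>{..<n}. fox i (\<phi> (gen k)) \<otimes> ?L (fox k g)) \<in> carrier G \<rightarrow> carrier \<Lambda>"
        using \<phi>c Lc by (auto intro!: R.finsum_closed)
      fix g h assume gh: "g \<in> carrier G" "h \<in> carrier G"
      let ?r = "l (frag_of (inv\<^bsub>G\<^esub> (\<phi> g)))"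
      have r: "?r \<in> carrier \<Lambda>" using gh \<phi>c by simp
      \<comment> \<open>The induced map sends l(g^-1) to l(\<phi>(g)^-1), so it converts the twist
        of the untwisted derivations \<open>fox k\<close> into the twist by
        \<open>\<phi>\<close>.\<close>
      have "\<phi> (inv\<^bsub>G\<^esub> g) = inv\<^bsub>G\<^esub> (\<phi> g)"
        by (rule group_hom.hom_inv[OF group_homI[OF G.is_group G.is_group \<phi>] gh(1)])
      then have L: "?L (fox k (g \<otimes>\<^bsub>G\<^esub> h)) = ?L (fox k g) \<oplus> ?L (fox k h) \<otimes> ?r" for k
        using gh ring_hom_add[OF Lh] ring_hom_mult[OF Lh] localization_map_l[OF \<phi>, of "frag_of (inv\<^bsub>G\<^esub> g)"]
        by (simp add: fox_mult)
      have "(\<Oplus>k\<in>{..<n}. fox i (\<phi> (gen k)) \<otimes> ?L (fox k (g \<otimes>\<^bsub>G\<^esub> h)))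
        = (\<Oplus>k\<in>{..<n}. fox i (\<phi> (gen k)) \<otimes> ?L (fox k g) \<oplus> (fox i (\<phi> (gen k)) \<otimes> ?L (fox k h)) \<otimes> ?r)"
        by (rule R.finsum_cong') (use gh \<phi>c Lc r in \<open>auto simp: L R.r_distr R.m_assoc\<close>)
      also have "\<dots> = (\<Oplus>k\<in>{..<n}. fox i (\<phi> (gen k)) \<otimes> ?L (fox k g))
          \<oplus> (\<Oplus>k\<in>{..<n}. (fox i (\<phi> (gen k)) \<otimes> ?L (fox k h)) \<otimes> ?r)"
        by (rule R.finsum_addf) (use gh \<phi>c Lc r in auto)
      also have "(\<Oplus>k\<in>{..<n}. (fox i (\<phi> (gen k)) \<otimes> ?L (fox k h)) \<otimes> ?r)
          = (\<Oplus>k\<in>{..<n}. fox i (\<phi> (gen k)) \<otimes> ?L (fox k h)) \<otimes> ?r"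
        by (rule R.finsum_ldistr[symmetric]) (use gh \<phi>c Lc r in auto)
      finally show "(\<Oplus>k\<in>{..<n}. fox i (\<phi> (gen k)) \<otimes> ?L (fox k (g \<otimes>\<^bsub>G\<^esub> h)))
        = (\<Oplus>k\<in>{..<n}. fox i (\<phi> (gen k)) \<otimes> ?L (fox k g))
          \<oplus> (\<Oplus>k\<in>{..<n}. fox i (\<phi> (gen k)) \<otimes> ?L (fox k h)) \<otimes> ?r" .
    qed
    fix j assume j: "j < n"
    \<comment> \<open>On the j-th generator only the summand k = j survives, because the ring
      homomorphism \<open>?L\<close> maps 0 to 0 and 1 to 1.\<close>
    have "(\<Oplus>k\<in>{..<n}. fox i (\<phi> (gen k)) \<otimes> ?L (fox k (gen j))) = fox i (\<phi> (gen j)) \<otimes> ?L (fox j (gen j))"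
      unfolding finsum_def
      by (rule comm_monoid.finprod_delta[OF comm_group.axioms(1)[OF R.a_comm_group]])
        (use j \<phi>c Lc L0 in \<open>auto simp: fox_gen\<close>)
    then show "fox i (\<phi> (gen j)) = (\<Oplus>k\<in>{..<n}. fox i (\<phi> (gen k)) \<otimes> ?L (fox k (gen j)))"
      using j \<phi>c ring_hom_one[OF Lh] by (simp add: fox_gen)
  qed
qed

section \<open>The matrices: crossed homomorphism and invertibility\<close>

abbreviation rep :: "('u \<Rightarrow> 'u) \<Rightarrow> 'u mat" where "rep \<equiv> magnus_rep n G gen \<Lambda> l"

lemma rep_closed: "\<phi> \<in> hom G G \<Longrightarrow> rep \<phi> \<in> carrier (matrix_ring \<Lambda> n)"
  using hom_in_carrier[of \<phi> G G] by (simp add: magnus_rep_eq matrix_ring_def)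

text \<open>Entrywise this is the chain rule at the images of the generators under
  \<open>\<psi>\<close>. The composite enters as a separate map \<open>\<chi>\<close>, since
  products in \<open>AutoGroup\<close> are restricted to the carrier and agree with plain
  composition only there.\<close>

lemma rep_crossed:
  assumes \<phi>: "\<phi> \<in> hom G G" and \<psi>: "\<psi> \<in> hom G G" and \<chi>: "\<chi> \<in> hom G G"
    and eq: "\<And>g. g \<in> carrier G \<Longrightarrow> \<chi> g = \<phi> (\<psi> g)"
  shows "rep \<chi> = rep \<phi> \<otimes>\<^bsub>matrix_ring \<Lambda> n\<^esub> map_mat (localization_map G \<Lambda> l \<phi>) (rep \<psi>)"
proof (rule eq_matI)
  let ?L = "localization_map G \<Lambda> l \<phi>"
  fix i j assume "i < dim_row (rep \<phi> \<otimes>\<^bsub>matrix_ring \<Lambda> n\<^esub> map_mat ?L (rep \<psi>))"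
    "j < dim_col (rep \<phi> \<otimes>\<^bsub>matrix_ring \<Lambda> n\<^esub> map_mat ?L (rep \<psi>))"
  then have ij: "i < n" "j < n" by (auto simp: matrix_ring_def)
  have Lc: "?L a \<in> carrier \<Lambda>" if "a \<in> carrier \<Lambda>" for a
    using ring_hom_closed[OF localization_map_hom[OF \<phi>] that] .
  have "rep \<chi> $$ (i, j) = fox i (\<phi> (\<psi> (gen j)))"
    using ij eq by (simp add: magnus_rep_eq[OF \<chi>])
  also have "\<dots> = (\<Oplus>k\<in>{..<n}. fox i (\<phi> (gen k)) \<otimes> ?L (fox k (\<psi> (gen j))))"
    by (rule fox_chain_rule[OF \<phi>]) (use ij hom_in_carrier[OF \<psi>] in simp)
  also have "\<dots> = (\<Oplus>k\<in>{..<n}. rep \<phi> $$ (i, k) \<otimes> map_mat ?L (rep \<psi>) $$ (k, j))"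
    by (rule R.finsum_cong')
      (use ij Lc hom_in_carrier[OF \<phi>] hom_in_carrier[OF \<psi>] in \<open>auto simp: magnus_rep_eq[OF \<phi>] magnus_rep_eq[OF \<psi>]\<close>)
  also have "\<dots> = (rep \<phi> \<otimes>\<^bsub>matrix_ring \<Lambda> n\<^esub> map_mat ?L (rep \<psi>)) $$ (i, j)"
    using ij by (simp add: matrix_ring_def)
  finally show "rep \<chi> $$ (i, j) = (rep \<phi> \<otimes>\<^bsub>matrix_ring \<Lambda> n\<^esub> map_mat ?L (rep \<psi>)) $$ (i, j)" .
qed (auto simp: matrix_ring_def magnus_rep_eq[OF \<chi>])

lemma rep_id: "\<chi> \<in> hom G G \<Longrightarrow> (\<And>g. g \<in> carrier G \<Longrightarrow> \<chi> g = g) \<Longrightarrow> rep \<chi> = \<one>\<^bsub>matrix_ring \<Lambda> n\<^esub>"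
  by (rule eq_matI) (auto simp: magnus_rep_eq matrix_ring_def fox_gen)

lemma map_mat_hom_mult:
  assumes h: "h \<in> Ring.ring_hom \<Lambda> \<Lambda>"
    and A: "A \<in> carrier (matrix_ring \<Lambda> m)" and B: "B \<in> carrier (matrix_ring \<Lambda> m)"
  shows "map_mat h (A \<otimes>\<^bsub>matrix_ring \<Lambda> m\<^esub> B) = map_mat h A \<otimes>\<^bsub>matrix_ring \<Lambda> m\<^esub> map_mat h B"
proof (rule eq_matI)
  fix i j assume "i < dim_row (map_mat h A \<otimes>\<^bsub>matrix_ring \<Lambda> m\<^esub> map_mat h B)"
    "j < dim_col (map_mat h A \<otimes>\<^bsub>matrix_ring \<Lambda> m\<^esub> map_mat h B)"
  then have ij: "i < m" "j < m" by (auto simp: matrix_ring_def)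
  have A': "A \<in> carrier_mat m m" "\<And>i j. i < m \<Longrightarrow> j < m \<Longrightarrow> A $$ (i, j) \<in> carrier \<Lambda>"
    and B': "B \<in> carrier_mat m m" "\<And>i j. i < m \<Longrightarrow> j < m \<Longrightarrow> B $$ (i, j) \<in> carrier \<Lambda>"
    using A B by (auto simp: matrix_ring_def)
  have hh: "h \<in> hom (add_monoid \<Lambda>) (add_monoid \<Lambda>)"
    using h by (auto simp: Ring.ring_hom_def hom_def)
  interpret h: group_hom "add_monoid \<Lambda>" "add_monoid \<Lambda>" h
    by (rule group_homI[OF R.a_group R.a_group hh])
  have "h (\<Oplus>k\<in>{..<m}. A $$ (i, k) \<otimes> B $$ (k, j)) = (\<Oplus>k\<in>{..<m}. h (A $$ (i, k) \<otimes> B $$ (k, j)))"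
    unfolding finsum_def
    by (rule h.hom_finprod[OF R.a_comm_group R.a_comm_group]) (use ij A' B' in auto)
  also have "\<dots> = (\<Oplus>k\<in>{..<m}. map_mat h A $$ (i, k) \<otimes> map_mat h B $$ (k, j))"
    by (rule R.finsum_cong')
      (use ij A' B' ring_hom_mult[OF h] ring_hom_closed[OF h] in auto)
  finally show "map_mat h (A \<otimes>\<^bsub>matrix_ring \<Lambda> m\<^esub> B) $$ (i, j)
      = (map_mat h A \<otimes>\<^bsub>matrix_ring \<Lambda> m\<^esub> map_mat h B) $$ (i, j)"
    using ij by (simp add: matrix_ring_def)
qed (auto simp: matrix_ring_def)

lemma map_mat_hom_one:
  assumes h: "h \<in> Ring.ring_hom \<Lambda> \<Lambda>"
  shows "map_mat h \<one>\<^bsub>matrix_ring \<Lambda> m\<^esub> = \<one>\<^bsub>matrix_ring \<Lambda> m\<^esub>"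
  by (rule eq_matI)
    (auto simp: matrix_ring_def ring_hom_one[OF h] ring_hom_zero[OF h ring_\<Lambda> ring_\<Lambda>])

text \<open>The crossed rule for \<open>\<phi>\<close> and its inverse \<open>\<psi>\<close> yields
  a right inverse of \<open>rep \<phi>\<close>. Over a noncommutative ring the left inverse has to
  be obtained separately, from the rule for \<open>\<psi>\<close> followed by
  \<open>\<phi>\<close>.\<close>

lemma rep_unit:
  assumes \<phi>: "\<phi> \<in> hom G G" and \<psi>: "\<psi> \<in> hom G G"
    and inv: "\<And>g. g \<in> carrier G \<Longrightarrow> \<phi> (\<psi> g) = g" "\<And>g. g \<in> carrier G \<Longrightarrow> \<psi> (\<phi> g) = g"
  shows "rep \<phi> \<in> Units (matrix_ring \<Lambda> n)"
proof -
  let ?L = "localization_map G \<Lambda> l \<phi>" and ?K = "localization_map G \<Lambda> l \<psi>"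
  let ?V = "map_mat ?L (rep \<psi>)"
  have id: "(\<lambda>g. g) \<in> hom G G" by (rule homI) auto
  have Lc: "?L a \<in> carrier \<Lambda>" "?K a \<in> carrier \<Lambda>" if "a \<in> carrier \<Lambda>" for a
    using ring_hom_closed[OF localization_map_hom[OF \<phi>] that]
      ring_hom_closed[OF localization_map_hom[OF \<psi>] that] by auto
  have V: "?V \<in> carrier (matrix_ring \<Lambda> n)"
    using rep_closed[OF \<psi>] by (rule map_mat_matrix_ring) (rule Lc)
  have K: "map_mat ?K (rep \<phi>) \<in> carrier (matrix_ring \<Lambda> n)"
    using rep_closed[OF \<phi>] by (rule map_mat_matrix_ring) (rule Lc)
  have one: "rep (\<lambda>g. g) = \<one>\<^bsub>matrix_ring \<Lambda> n\<^esub>" by (rule rep_id[OF id]) simp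
  have 1: "rep \<phi> \<otimes>\<^bsub>matrix_ring \<Lambda> n\<^esub> ?V = \<one>\<^bsub>matrix_ring \<Lambda> n\<^esub>"
    using rep_crossed[OF \<phi> \<psi> id] inv one by simp
  have "\<one>\<^bsub>matrix_ring \<Lambda> n\<^esub> = rep \<psi> \<otimes>\<^bsub>matrix_ring \<Lambda> n\<^esub> map_mat ?K (rep \<phi>)"
    using rep_crossed[OF \<psi> \<phi> id] inv one by simp
  \<comment> \<open>Apply the map induced by \<open>\<phi>\<close> to the identity for
    \<open>\<psi>\<close> and \<open>\<phi>\<close>. It undoes \<open>?K\<close> on the second
    factor and turns the first into the same \<open>?V\<close> that is already the right
    inverse.\<close>
  then have "map_mat ?L \<one>\<^bsub>matrix_ring \<Lambda> n\<^esub> = ?V \<otimes>\<^bsub>matrix_ring \<Lambda> n\<^esub> map_mat ?L (map_mat ?K (rep \<phi>))"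
    using map_mat_hom_mult[OF localization_map_hom[OF \<phi>] rep_closed[OF \<psi>] K] by simp
  moreover have "map_mat ?L (map_mat ?K (rep \<phi>)) = rep \<phi>"
    by (rule eq_matI)
      (use localization_map_inverse[OF \<phi> \<psi> inv(1)] rep_closed[OF \<phi>] in \<open>auto simp: matrix_ring_def\<close>)
  ultimately have "?V \<otimes>\<^bsub>matrix_ring \<Lambda> n\<^esub> rep \<phi> = \<one>\<^bsub>matrix_ring \<Lambda> n\<^esub>"
    by (simp add: map_mat_hom_one[OF localization_map_hom[OF \<phi>]])
  with 1 V rep_closed[OF \<phi>] show ?thesis by (auto simp: Units_def)
qed

end

theorem proposition5p14:
  fixes n :: nat
    and G :: "'u monoid" and \<iota> :: "free_elem \<Rightarrow> 'u"
    and \<Lambda> :: "'u ring" and l :: "('u \<Rightarrow>\<^sub>0 int) \<Rightarrow> 'u"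
    and r :: "('u \<Rightarrow> 'u) \<Rightarrow> 'u mat"
  assumes "infinite (UNIV :: 'u set)"
    and "acyclic_closure (free_group n) G \<iota>"
    and "Cohn_localization G \<Lambda> l"
  defines "r \<equiv> magnus_rep n G (\<lambda>i. \<iota> (free_gen n i)) \<Lambda> l"
  shows "r \<in> carrier (AutoGroup G) \<rightarrow> carrier (matrix_ring \<Lambda> n) \<and>
    (\<forall>\<phi>\<in>carrier (AutoGroup G). \<forall>\<psi>\<in>carrier (AutoGroup G).
       r (\<phi> \<otimes>\<^bsub>AutoGroup G\<^esub> \<psi>) =
       r \<phi> \<otimes>\<^bsub>matrix_ring \<Lambda> n\<^esub> map_mat (localization_map G \<Lambda> l \<phi>) (r \<psi>)) \<and>
    r ` carrier (AutoGroup G) \<subseteq> Units (matrix_ring \<Lambda> n)"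
proof -
  interpret free_acyclic_closure n G \<iota> by unfold_locales (rule assms(2))
  interpret grp: group G by (rule group_G)
  interpret magnus_setup n G \<iota> \<Lambda> l
    by unfold_locales (use assms in auto)
  have r: "r = rep"
    unfolding r_def by (simp add: gen_def[abs_def])
  have aut: "\<phi> \<in> hom G G" "\<phi> \<in> Bij (carrier G)" if "\<phi> \<in> carrier (AutoGroup G)" for \<phi>
    using that by (auto simp: AutoGroup_def auto_def)
  have crossed: "r (\<phi> \<otimes>\<^bsub>AutoGroup G\<^esub> \<psi>) = r \<phi> \<otimes>\<^bsub>matrix_ring \<Lambda> n\<^esub> map_mat (localization_map G \<Lambda> l \<phi>) (r \<psi>)"
    if "\<phi> \<in> carrier (AutoGroup G)" "\<psi> \<in> carrier (AutoGroup G)" for \<phi> \<psi>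
  proof -
    have "\<phi> \<otimes>\<^bsub>AutoGroup G\<^esub> \<psi> \<in> carrier (AutoGroup G)"
      using grp.AutoGroup that by (intro monoid.m_closed) (auto simp: group_def)
    moreover have "(\<phi> \<otimes>\<^bsub>AutoGroup G\<^esub> \<psi>) g = \<phi> (\<psi> g)" if "g \<in> carrier G" for g
      using aut(2) \<open>\<phi> \<in> _\<close> \<open>\<psi> \<in> _\<close> that by (simp add: AutoGroup_def BijGroup_def auto_def compose_def)
    ultimately show ?thesis unfolding r using that aut(1) by (intro rep_crossed)
  qed
  have unit: "r \<phi> \<in> Units (matrix_ring \<Lambda> n)" if \<phi>: "\<phi> \<in> carrier (AutoGroup G)" for \<phi>
  proof -
    have b: "bij_betw \<phi> (carrier G) (carrier G)" using aut(2)[OF \<phi>] by (simp add: Bij_def)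
    show ?thesis
      unfolding r
    proof (rule rep_unit[OF aut(1)[OF \<phi>] grp.restrict_inv_into_hom[OF aut[OF \<phi>]]])
      fix g assume g: "g \<in> carrier G"
      then show "\<phi> (restrict (inv_into (carrier G) \<phi>) (carrier G) g) = g"
        using b by (simp add: bij_betw_inv_into_right)
      have "\<phi> g \<in> carrier G" using hom_in_carrier[OF aut(1)[OF \<phi>] g] .
      then show "restrict (inv_into (carrier G) \<phi>) (carrier G) (\<phi> g) = g"
        using b g by (simp add: bij_betw_inv_into_left)
    qed
  qed
  show ?thesis
    using crossed unit rep_closed aut(1) r by auto
qed

end
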